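(* Let $\varphi$ satisfy (i)–(vi) of the context, let $(a,b)\subset\mathbb{R}$ be a bounded or unbounded open interval, let $\mathscr{A}(x)=\{a_{ij}(x)\}$ be an $m\times m$ matrix with complex-valued entries in $L^1_{\rm loc}((a,b))$, and let $Au=(\mathscr{A}(x)u')'$. Assume $\Lambda_\infty^2=\sup_{t>0}\Lambda^2(t)<1$. Then the following statements are equivalent: (a) the operator $A$ is strict $L^\Phi$-dissipative; (b) there exists $\kappa>0$ such that $A-\kappa I(d^2/dx^2)$, i.e. $u\mapsto((\mathscr{A}(x)-\kappa I)u')'$, is $L^\Phi$-dissipative; (c) the matrix $\mathscr{A}$ satisfies the strong $\Phi$-ellipticity condition; (d) the matrix $\mathscr{A}$ satisfies the integral $\Phi$-ellipticity condition; (e) the matrix $\mathscr{A}$ satisfies the weak $\Phi$-ellipticity condition.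
   Context: Conditions on $\varphi:(0,+\infty)\to(0,+\infty)$: (i) $\varphi\in C^1((0,+\infty))$; (ii) $(s\varphi(s))'>0$ for all $s>0$; (iii) the range of $s\mapsto s\varphi(s)$ is $(0,+\infty)$; (iv) there are $s_0>0$, $C_1,C_2>0$ and a real $r>-1$ with $C_1s^r\le(s\varphi(s))'\le C_2s^r$ for $s\in(0,s_0)$, and if $r=0$ moreover the finite limit $\lim_{s\to0^+}\varphi(s)>0$ exists and $\lim_{s\to0^+}s\varphi'(s)=0$; (v) there is $s_1>s_0$ such that either $\varphi'(s)\ge0$ for all $s\ge s_1$ or $\varphi'(s)\le0$ for all $s\ge s_1$; (vi) $s\mapsto|s\varphi'(s)/\varphi(s)|$ is non-decreasing on $(0,+\infty)$. The function $\Lambda$ on $(0,+\infty)$ is defined by $\Lambda(s\sqrt{\varphi(s)})=-\dfrac{s\varphi'(s)}{s\varphi'(s)+2\varphi(s)}$, $s>0$. Under (i)–(vi), $\Lambda$ is monotone with constant sign and $\Lambda^2$ is non-decreasing; $\Lambda_\infty:=\lim_{t\to+\infty}\Lambda(t)$, so $\Lambda_\infty^2=\sup_{t>0}\Lambda^2(t)$. $\langle\cdot,\cdot\rangle$ is the standard Hermitian inner product on $\mathbb{C}^m$, $|\cdot|$ its norm, $^*$ denotes the conjugate transpose; $C^1_0((a,b))$ is the space of complex-valued $C^1$ functions with compact support in $(a,b)$; $\varphi(|u|)u$ and $\sqrt{\varphi(|u|)}\,u$ are understood as $0$ where $u=0$. - $A$ is $L^\Phi$-dissipative if $\mathrm{Re}\int_a^b\langle\mathscr{A}u',(\varphi(|u|)u)'\rangle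 dx\ge0$ for all $u\in[C^1_0((a,b))]^m$ such that $\varphi(|u|)u\in[C^1_0((a,b))]^m$; it is strict $L^\Phi$-dissipative if for some $\kappa>0$ the same integral is $\ge\kappa\int_a^b|(\sqrt{\varphi(|u|)}\,u)'|^2dx$ for all such $u$. - Strong $\Phi$-ellipticity: there is $\kappa>0$ such that $\mathrm{Re}\langle\mathscr{A}(x)\xi,\xi\rangle+\Lambda(t)\,\mathrm{Re}\langle(\mathscr{A}(x)-\mathscr{A}^*(x))\omega,\xi\rangle\,\mathrm{Re}\langle\omega,\xi\rangle-\Lambda^2(t)\,\mathrm{Re}\langle\mathscr{A}(x)\omega,\omega\rangle(\mathrm{Re}\langle\omega,\xi\rangle)^2\ge\kappa|\xi|^2$ for all $\xi,\omega\in\mathbb{C}^m$ with $|\omega|=1$, all $t>0$ and almost every $x\in(a,b)$. - Integral $\Phi$-ellipticity: there is $\kappa>0$ such that for all $v\in[C^1_0((a,b))]^m$, $\mathrm{Re}\int_a^b\big(\langle\mathscr{A}v',v'\rangle+\Lambda(|v|)|v|^{-2}\langle(\mathscr{A}-\mathscr{A}^* )v,v'\rangle\mathrm{Re}\langle v,v'\rangle-\Lambda^2(|v|)|v|^{-4}\langle\mathscr{A}v,v\rangle(\mathrm{Re}\langle v,v'\rangle)^2\big)dx\ge\kappa\int_a^b|v'|^2dx$, the integrand on the left being extended by zero where $v=0$. - Weak (Legendre–Hadamard) $\Phi$-ellipticity: there is $\kappa>0$ such that $\mathrm{Re}\langle q^2\mathscr{A}(x)\lambda,\lambda\rangle-\Lambda^2(t)\mathrm{Re}\langle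 q^2\mathscr{A}(x)\omega,\omega\rangle(\mathrm{Re}\langle\lambda,\omega\rangle)^2+\Lambda(t)\mathrm{Re}(\langle q^2\mathscr{A}(x)\omega,\lambda\rangle-\langle q^2\mathscr{A}(x)\lambda,\omega\rangle)\mathrm{Re}\langle\lambda,\omega\rangle\ge\kappa q^2|\lambda|^2$ for all $q\in\mathbb{R}$, $\lambda,\omega\in\mathbb{C}^m$ with $|\omega|=1$, $t>0$ and almost every $x\in(a,b)$. *)

theory Defs
  imports "HOL-Analysis.Analysis"
begin

section \<open>The function \<open>\<phi>\<close> and the associated function \<open>\<Lambda>\<close>\<close>

text \<open>
  A function on \<open>(0,\<infinity>)\<close> is a total function whose values outside \<open>(0,\<infinity>)\<close> are irrelevant.
  The conditions near \<open>0\<close> and near infinity share the witness \<open>s0\<close>.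
\<close>

definition admissible_phi :: "(real \<Rightarrow> real) \<Rightarrow> bool" where
  "admissible_phi \<phi> \<longleftrightarrow>
     (\<forall>s>0. \<phi> s > 0) \<and>
     \<phi> C1_differentiable_on {0<..} \<and>
     (\<forall>s>0. deriv (\<lambda>\<sigma>. \<sigma> * \<phi> \<sigma>) s > 0) \<and>
     (\<lambda>s. s * \<phi> s) ` {0<..} = {0<..} \<and>
     (\<exists>s0>0.
        (\<exists>C1>0. \<exists>C2>0. \<exists>r>-1.
           (\<forall>s\<in>{0<..<s0}. C1 * s powr r \<le> deriv (\<lambda>\<sigma>. \<sigma> * \<phi> \<sigma>) s \<and>
                             deriv (\<lambda>\<sigma>. \<sigma> * \<phi> \<sigma>) s \<le> C2 * s powr r) \<and>
           (r = 0 \<longrightarrow> (\<exists>L>0. (\<phi> \<longlongrightarrow> L) (at_right 0)) \<and>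
                       ((\<lambda>s. s * deriv \<phi> s) \<longlongrightarrow> 0) (at_right 0))) \<and>
        (\<exists>s1>s0. (\<forall>s\<ge>s1. deriv \<phi> s \<ge> 0) \<or> (\<forall>s\<ge>s1. deriv \<phi> s \<le> 0))) \<and>
     mono_on {0<..} (\<lambda>s. \<bar>s * deriv \<phi> s / \<phi> s\<bar>)"

text \<open>
  \<open>\<Lambda>\<close> is given implicitly by its values at the points \<open>s \<surd>(\<phi> s)\<close>; the lemmas below show
  that \<open>s \<mapsto> s \<surd>(\<phi> s)\<close> is a bijection of \<open>(0,\<infinity>)\<close> onto itself.
\<close>

definition Lambda :: "(real \<Rightarrow> real) \<Rightarrow> real \<Rightarrow> real" where
  "Lambda \<phi> t =
     (let s = the_inv_into {0<..} (\<lambda>\<sigma>. \<sigma> * sqrt (\<phi> \<sigma>)) t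
      in - (s * deriv \<phi> s / (s * deriv \<phi> s + 2 * \<phi> s)))"

definition Lambda_infinity :: "(real \<Rightarrow> real) \<Rightarrow> real" where
  "Lambda_infinity \<phi> = Lim at_top (Lambda \<phi>)"

lemma admissible_phi_continuous_on:
  assumes "admissible_phi \<phi>"
  shows "continuous_on {0<..} \<phi>"
  using assms by (auto simp: admissible_phi_def intro: C1_differentiable_imp_continuous_on)

lemma admissible_phi_strict_mono:
  assumes "admissible_phi \<phi>" and "0 < s" and "s < t"
  shows "s * \<phi> s < t * \<phi> t"
proof (rule DERIV_pos_imp_increasing[OF \<open>s < t\<close>])
  fix x assume x: "s \<le> x" "x \<le> t"
  then have "x > 0" using assms by simp
  then have "\<phi> differentiable (at x)"
    using assms(1) by (auto simp: admissible_phi_def C1_differentiable_on_eq)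
  then have "(\<lambda>\<sigma>. \<sigma> * \<phi> \<sigma>) differentiable (at x)"
    by (intro differentiable_mult differentiable_ident)
  then have "((\<lambda>\<sigma>. \<sigma> * \<phi> \<sigma>) has_real_derivative deriv (\<lambda>\<sigma>. \<sigma> * \<phi> \<sigma>) x) (at x)"
    by (simp add: DERIV_deriv_iff_real_differentiable)
  moreover have "deriv (\<lambda>\<sigma>. \<sigma> * \<phi> \<sigma>) x > 0"
    using assms(1) \<open>x > 0\<close> by (auto simp: admissible_phi_def)
  ultimately show "\<exists>y. ((\<lambda>\<sigma>. \<sigma> * \<phi> \<sigma>) has_real_derivative y) (at x) \<and> y > 0" by blast
qed

lemma bij_betw_mult_sqrt_phi:
  assumes adm: "admissible_phi \<phi>"
  shows "bij_betw (\<lambda>\<sigma>. \<sigma> * sqrt (\<phi> \<sigma>)) {0<..} {0<..}"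
proof -
  let ?G = "\<lambda>\<sigma>. \<sigma> * \<phi> \<sigma>"
  have pos: "\<phi> s > 0" if "s > 0" for s
    using adm that by (auto simp: admissible_phi_def)
  have rng: "?G ` {0<..} = {0<..}"
    using adm by (auto simp: admissible_phi_def)
  have form: "s * sqrt (\<phi> s) = sqrt (s * ?G s)" if "s > 0" for s
    using that by (simp add: real_sqrt_mult flip: mult.assoc)
  have less: "s * sqrt (\<phi> s) < t * sqrt (\<phi> t)" if "0 < s" "s < t" for s t
  proof -
    have "s * ?G s < t * ?G t"
      by (rule mult_strict_mono)
         (use that pos[of s] admissible_phi_strict_mono[OF adm that] in auto)
    then show ?thesis using that form by simp
  qed
  have inj: "inj_on (\<lambda>\<sigma>. \<sigma> * sqrt (\<phi> \<sigma>)) {0<..}"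
    by (rule linorder_inj_onI') (use less in fastforce)
  have "t \<in> (\<lambda>\<sigma>. \<sigma> * sqrt (\<phi> \<sigma>)) ` {0<..}" if "t > 0" for t
  proof -
    obtain u where u: "u > 0" "?G u = t" using rng \<open>t > 0\<close> by (metis greaterThan_iff imageE)
    have cont: "continuous_on {min u t..max u t} (\<lambda>s. s * ?G s)"
      using u \<open>t > 0\<close>
      by (intro continuous_intros continuous_on_subset[OF admissible_phi_continuous_on[OF adm]]) auto
    have "\<exists>s\<ge>min u t. s \<le> max u t \<and> s * ?G s = t * t"
    proof (cases "u \<le> t")
      case True
      then have "?G u \<le> ?G t"
        using admissible_phi_strict_mono[OF adm u(1), of t] by (cases "u = t") auto
      then have "u * ?G u \<le> t * t" "t * t \<le> t * ?G t"
        using True u \<open>t > 0\<close> by auto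
      then show ?thesis using True cont IVT'[of "\<lambda>s. s * ?G s" u "t * t" t] by simp
    next
      case False
      then have "?G t \<le> ?G u"
        using admissible_phi_strict_mono[OF adm \<open>t > 0\<close>, of u] by simp
      then have "t * ?G t \<le> t * t" "t * t \<le> u * ?G u"
        using False u \<open>t > 0\<close> by auto
      then show ?thesis using False cont IVT'[of "\<lambda>s. s * ?G s" t "t * t" u] by simp
    qed
    then obtain s where s: "s \<ge> min u t" "s * ?G s = t * t" by blast
    then have "s > 0" using u \<open>t > 0\<close> by linarith
    with form[OF this] s(2) \<open>t > 0\<close> have "s * sqrt (\<phi> s) = t" by simp
    with \<open>s > 0\<close> show ?thesis by auto
  qed
  with inj pos show ?thesis by (auto simp: bij_betw_def)
qed

lemma Lambda_eq:
  assumes "admissible_phi \<phi>" and "s > 0"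
  shows "Lambda \<phi> (s * sqrt (\<phi> s)) = - (s * deriv \<phi> s / (s * deriv \<phi> s + 2 * \<phi> s))"
proof -
  have "the_inv_into {0<..} (\<lambda>\<sigma>. \<sigma> * sqrt (\<phi> \<sigma>)) (s * sqrt (\<phi> s)) = s"
    using bij_betw_mult_sqrt_phi[OF assms(1)] assms(2)
    by (intro the_inv_into_f_eq) (auto simp: bij_betw_def)
  then show ?thesis by (simp add: Lambda_def)
qed


section \<open>Hermitian product, test functions and coefficients\<close>

definition herm :: "complex ^ 'm \<Rightarrow> complex ^ 'm \<Rightarrow> complex" where
  "herm u v = (\<Sum>i\<in>UNIV. u $ i * cnj (v $ i))"

lemma herm_self: "herm u u = complex_of_real ((norm u)\<^sup>2)"
  by (simp add: herm_def norm_vec_def L2_set_def sum_nonneg complex_norm_square flip: of_real_power)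

definition conj_transpose :: "complex ^ 'm ^ 'm \<Rightarrow> complex ^ 'm ^ 'm" where
  "conj_transpose M = (\<chi> i j. cnj (M $ j $ i))"

text \<open>
  Functions on \<open>(a,b)\<close> are total functions on \<open>\<real>\<close> whose values outside the interval are irrelevant.
\<close>

definition C1_compact_support :: "ereal \<Rightarrow> ereal \<Rightarrow> (real \<Rightarrow> complex) set" where
  "C1_compact_support a b =
     {f. f C1_differentiable_on einterval a b \<and>
         compact (closure (support_on (einterval a b) f)) \<and>
         closure (support_on (einterval a b) f) \<subseteq> einterval a b}"

definition C1_compact_support_vec :: "ereal \<Rightarrow> ereal \<Rightarrow> (real \<Rightarrow> complex ^ 'm) set" where
  "C1_compact_support_vec a b = {u. \<forall>i. (\<lambda>x. u x $ i) \<in> C1_compact_support a b}"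

definition L1_loc :: "ereal \<Rightarrow> ereal \<Rightarrow> (real \<Rightarrow> complex) set" where
  "L1_loc a b =
     {f. \<forall>K. compact K \<and> K \<subseteq> einterval a b \<longrightarrow> f absolutely_integrable_on K}"


section \<open>Dissipativity of \<open>u \<mapsto> (A(x) u')'\<close>\<close>

text \<open>
  The operator is represented by its coefficient matrix \<open>A\<close>. Both \<open>\<phi>(|u|) u\<close> and \<open>\<surd>(\<phi>(|u|)) u\<close>
  vanish where \<open>u = 0\<close>, whatever the irrelevant value \<open>\<phi> 0\<close> is. If \<open>u\<close> and \<open>\<phi>(|u|) u\<close> are both
  \<open>C\<^sup>1\<close> with compact support and \<open>\<phi>\<close> is admissible, then \<open>\<surd>(\<phi>(|u|)) u\<close> is differentiable everywhere
  on the interval, with bounded derivative, so that the pointwise derivative below is meaningful.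
\<close>

definition LPhi_dissipative ::
    "(real \<Rightarrow> real) \<Rightarrow> ereal \<Rightarrow> ereal \<Rightarrow> (real \<Rightarrow> complex ^ 'm ^ 'm) \<Rightarrow> bool" where
  "LPhi_dissipative \<phi> a b A \<longleftrightarrow>
     (\<forall>u \<in> C1_compact_support_vec a b.
        (\<lambda>x. \<phi> (norm (u x)) *\<^sub>R u x) \<in> C1_compact_support_vec a b \<longrightarrow>
        Re (LINT x:einterval a b|lebesgue.
              herm (A x *v vector_derivative u (at x))
                   (vector_derivative (\<lambda>y. \<phi> (norm (u y)) *\<^sub>R u y) (at x))) \<ge> 0)"

definition strict_LPhi_dissipative ::
    "(real \<Rightarrow> real) \<Rightarrow> ereal \<Rightarrow> ereal \<Rightarrow> (real \<Rightarrow> complex ^ 'm ^ 'm) \<Rightarrow> bool" where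
  "strict_LPhi_dissipative \<phi> a b A \<longleftrightarrow>
     (\<exists>\<kappa>>0. \<forall>u \<in> C1_compact_support_vec a b.
        (\<lambda>x. \<phi> (norm (u x)) *\<^sub>R u x) \<in> C1_compact_support_vec a b \<longrightarrow>
        Re (LINT x:einterval a b|lebesgue.
              herm (A x *v vector_derivative u (at x))
                   (vector_derivative (\<lambda>y. \<phi> (norm (u y)) *\<^sub>R u y) (at x)))
        \<ge> \<kappa> * (LINT x:einterval a b|lebesgue.
              (norm (vector_derivative (\<lambda>y. sqrt (\<phi> (norm (u y))) *\<^sub>R u y) (at x)))\<^sup>2))"


section \<open>Ellipticity conditions\<close>

definition strong_Phi_elliptic ::
    "(real \<Rightarrow> real) \<Rightarrow> ereal \<Rightarrow> ereal \<Rightarrow> (real \<Rightarrow> complex ^ 'm ^ 'm) \<Rightarrow> bool" where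
  "strong_Phi_elliptic \<phi> a b A \<longleftrightarrow>
     (\<exists>\<kappa>>0. \<forall>\<xi> \<omega>. norm \<omega> = 1 \<longrightarrow> (\<forall>t>0. AE x in lebesgue. x \<in> einterval a b \<longrightarrow>
        Re (herm (A x *v \<xi>) \<xi>)
        + Lambda \<phi> t * Re (herm ((A x - conj_transpose (A x)) *v \<omega>) \<xi>) * Re (herm \<omega> \<xi>)
        - (Lambda \<phi> t)\<^sup>2 * Re (herm (A x *v \<omega>) \<omega>) * (Re (herm \<omega> \<xi>))\<^sup>2
        \<ge> \<kappa> * (norm \<xi>)\<^sup>2))"

definition integral_Phi_elliptic ::
    "(real \<Rightarrow> real) \<Rightarrow> ereal \<Rightarrow> ereal \<Rightarrow> (real \<Rightarrow> complex ^ 'm ^ 'm) \<Rightarrow> bool" where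
  "integral_Phi_elliptic \<phi> a b A \<longleftrightarrow>
     (\<exists>\<kappa>>0. \<forall>v \<in> C1_compact_support_vec a b.
        Re (LINT x:einterval a b|lebesgue.
              (let V = v x; V' = vector_derivative v (at x); \<Lambda> = Lambda \<phi> (norm V)
               in if V = 0 then 0
                  else herm (A x *v V') V'
                     + complex_of_real (\<Lambda> / (norm V)\<^sup>2)
                       * herm ((A x - conj_transpose (A x)) *v V) V'
                       * complex_of_real (Re (herm V V'))
                     - complex_of_real (\<Lambda>\<^sup>2 / (norm V)^4)
                       * herm (A x *v V) V
                       * complex_of_real ((Re (herm V V'))\<^sup>2)))
        \<ge> \<kappa> * (LINT x:einterval a b|lebesgue. (norm (vector_derivative v (at x)))\<^sup>2))"

definition weak_Phi_elliptic ::
    "(real \<Rightarrow> real) \<Rightarrow> ereal \<Rightarrow> ereal \<Rightarrow> (real \<Rightarrow> complex ^ 'm ^ 'm) \<Rightarrow> bool" where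
  "weak_Phi_elliptic \<phi> a b A \<longleftrightarrow>
     (\<exists>\<kappa>>0. \<forall>q::real. \<forall>\<eta> \<omega>. norm \<omega> = 1 \<longrightarrow> (\<forall>t>0. AE x in lebesgue. x \<in> einterval a b \<longrightarrow>
        Re (herm ((q\<^sup>2 *\<^sub>R A x) *v \<eta>) \<eta>)
        - (Lambda \<phi> t)\<^sup>2 * Re (herm ((q\<^sup>2 *\<^sub>R A x) *v \<omega>) \<omega>) * (Re (herm \<eta> \<omega>))\<^sup>2
        + Lambda \<phi> t * Re (herm ((q\<^sup>2 *\<^sub>R A x) *v \<omega>) \<eta> - herm ((q\<^sup>2 *\<^sub>R A x) *v \<eta>) \<omega>)
          * Re (herm \<eta> \<omega>)
        \<ge> \<kappa> * q\<^sup>2 * (norm \<eta>)\<^sup>2))"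

end

theory Submission
  imports Defs
begin

text \<open>
  With \<open>v = \<surd>(\<phi>(|u|)) u\<close> one has \<open>u = (\<zeta>(|v|) / |v|) v\<close> and \<open>\<phi>(|u|) u = (|v| / \<zeta>(|v|)) v\<close>, where \<open>\<zeta>\<close> is the
  inverse of \<open>s \<mapsto> s \<surd>(\<phi> s)\<close>, and the logarithmic derivatives \<open>t f'(t) / f(t)\<close> of the two factors are
  \<open>\<Lambda>\<close> and \<open>-\<Lambda>\<close>. Hence the dissipativity integrand in \<open>u\<close> equals the integral-ellipticity integrand
  in \<open>v\<close>, whose real part is the strong-ellipticity form at \<open>\<omega> = v / |v|\<close>, \<open>\<xi> = v'\<close>, \<open>t = |v|\<close>. For the
  identity matrix this form lies between \<open>(1 - \<Lambda>\<^sub>\<infinity>\<^sup>2) |v'|\<^sup>2\<close> and \<open>|v'|\<^sup>2\<close>, which settles the equivalence of strict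
  dissipativity with dissipativity of the shifted operator; almost everywhere on the zero set of \<open>v\<close>
  all derivatives vanish, so the strong condition can be integrated. Conversely one tests with
  \<open>\<eta> (t \<omega> + n powr (-1/2) p sin(n x) \<xi>)\<close> and its cosine twin, where \<open>\<eta>\<close> is a bump vanishing at the endpoints to so high an order that
  the corresponding \<open>u\<close> and \<open>\<phi>(|u|) u\<close> are still \<open>C\<^sup>1\<close>, and \<open>p\<close> is a polynomial. Adding the two, dividing by \<open>n\<close> and letting
  \<open>n \<rightarrow> \<infinity>\<close> leaves the strong form at \<open>(\<xi>, \<omega>, \<eta>(x) t)\<close> weighted by \<open>(\<eta> p)\<^sup>2\<close>; since \<open>p\<close> and \<open>t\<close> are arbitrary,
  the pointwise condition follows.
\<close>

subsection \<open>The quadratic form behind the ellipticity conditions\<close>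

text \<open>Two test classes have to be reconciled. Integral ellipticity tests with C^1 functions v,
  dissipativity with those v for which both \<open>ulift v\<close> and \<open>wlift v\<close> are
  C^1. The proof sandwiches both classes: the strong condition yields the integral bound on the
  larger class \<open>tame\<close>, and the test functions of the converse lie in the intersection.
  The assumption \<Lambda>_\<infinity>^2 < 1 enters twice. It makes 1 - \<Lambda>_\<infinity>^2
  positive, so that v' is controlled by the derivatives of u and \<phi>(|u|) u, and it lets a bump
  of finite order beat the singularity of the conversion factors at v = 0. The amplitude n^(-1/2) is
  chosen so that v' has size n^(1/2) while v itself converges to \<eta> t \<omega>; after division
  by n the form is thus evaluated at the limit of v. Since t \<omega> dominates the perturbation, v
  has no zeros inside the bump, and continuity of \<Lambda> on (0,\<infinity>) suffices for the
  limit. Weak ellipticity requires no analysis: q^2 factors out of it and leaves the strong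
  form.\<close>

lemma herm_cnj: "cnj (herm u v) = herm v u"
  by (simp add: herm_def mult.commute)

lemma Re_herm_eq_inner: "Re (herm u v) = u \<bullet> v"
  by (simp add: herm_def inner_vec_def inner_complex_def)

lemma herm_add_left: "herm (u + v) w = herm u w + herm v w"
  by (simp add: herm_def algebra_simps sum.distrib)

lemma herm_add_right: "herm w (u + v) = herm w u + herm w v"
  by (simp add: herm_def algebra_simps sum.distrib)

lemma herm_diff_left: "herm (u - v) w = herm u w - herm v w"
  by (simp add: herm_def algebra_simps sum_subtractf)

lemma herm_scaleR_left: "herm (c *\<^sub>R u) w = of_real c * herm u w"
  by (simp add: herm_def scaleR_conv_of_real[where 'a=complex] sum_distrib_left mult_ac)

lemma herm_scaleR_right: "herm w (c *\<^sub>R u) = of_real c * herm w u"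
  by (simp add: herm_def scaleR_conv_of_real[where 'a=complex] sum_distrib_left mult_ac)

lemma herm_zero [simp]: "herm 0 v = 0" "herm u 0 = 0"
  by (simp_all add: herm_def)

lemma herm_conj_transpose: "herm (conj_transpose M *v u) v = herm u (M *v v)"
proof -
  have "herm (conj_transpose M *v u) v = (\<Sum>i\<in>UNIV. \<Sum>j\<in>UNIV. cnj (M $ j $ i) * u $ j * cnj (v $ i))"
    by (simp add: herm_def conj_transpose_def matrix_vector_mult_def sum_distrib_right)
  also have "\<dots> = (\<Sum>j\<in>UNIV. \<Sum>i\<in>UNIV. cnj (M $ j $ i) * u $ j * cnj (v $ i))"
    by (rule sum.swap)
  also have "\<dots> = herm u (M *v v)"
    by (simp add: herm_def matrix_vector_mult_def sum_distrib_left mult_ac)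
  finally show ?thesis .
qed

lemma herm_matrix_vector: "herm (M *v u) v = (\<Sum>i\<in>UNIV. \<Sum>j\<in>UNIV. M $ i $ j * u $ j * cnj (v $ i))"
  by (simp add: herm_def matrix_vector_mult_def sum_distrib_right)

lemma matrix_vector_scaleR: "M *v (c *\<^sub>R u) = c *\<^sub>R (M *v u)" for M :: "complex^'m^'n"
  by (simp add: vec_eq_iff matrix_vector_mult_def scaleR_sum_right)

lemma scaleR_matrix_vector: "(c *\<^sub>R M) *v u = c *\<^sub>R (M *v u)" for M :: "complex^'m^'n"
  by (simp add: vec_eq_iff matrix_vector_mult_def scaleR_sum_right)

lemma mat_of_real_vector: "mat (complex_of_real k) *v u = k *\<^sub>R u" for u :: "complex^'n"
proof -
  have "mat (complex_of_real k) = (k *\<^sub>R mat 1 :: complex^'n^'n)"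
    by (simp add: vec_eq_iff mat_def scaleR_conv_of_real[where 'a=complex])
  then show ?thesis by (simp add: scaleR_matrix_vector)
qed

text \<open>The derivative of \<open>f(|v|) v\<close> is \<open>f(|v|)\<close> times \<open>radial l v v'\<close>, where \<open>l\<close> is the
  logarithmic derivative \<open>t f'(t) / f(t)\<close> at \<open>t = |v|\<close>.\<close>

definition radial :: "real \<Rightarrow> complex^'m \<Rightarrow> complex^'m \<Rightarrow> complex^'m" where
  "radial l V W = W + (l * (V \<bullet> W) / (norm V)\<^sup>2) *\<^sub>R V"

text \<open>The opposite signs of \<open>l\<close> mirror the derivatives of u and of \<phi>(|u|) u.
  Separate slots \<open>W\<close> and \<open>Z\<close> give a real-bilinear form (not sesquilinear,
  since \<open>radial\<close> uses the real inner product), which can be expanded around the leading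
  part of an oscillating derivative.\<close>

definition ellform ::
    "complex^'m^'m \<Rightarrow> real \<Rightarrow> complex^'m \<Rightarrow> complex^'m \<Rightarrow> complex^'m \<Rightarrow> complex" where
  "ellform M l V W Z = herm (M *v radial l V W) (radial (-l) V Z)"

lemma radial_add: "radial l V (W + Z) = radial l V W + radial l V Z"
  by (simp add: radial_def inner_add_right distrib_left add_divide_distrib scaleR_add_left)

lemma radial_scaleR: "radial l V (c *\<^sub>R W) = c *\<^sub>R radial l V W"
  by (simp add: radial_def scaleR_add_right mult_ac)

lemma radial_scaleR_left:
  assumes "c \<noteq> 0"
  shows "radial l (c *\<^sub>R V) W = radial l V W"
proof -
  have "(norm (c *\<^sub>R V))\<^sup>2 = c * c * (norm V)\<^sup>2"
    by (simp add: power_mult_distrib flip: power2_eq_square)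
  then show ?thesis using assms by (simp add: radial_def)
qed

lemma radial_zero [simp]: "radial l V 0 = 0" "radial l 0 W = W"
  by (simp_all add: radial_def)

text \<open>By Cauchy-Schwarz the correction term is at most |l| |W|, whatever the size of V. So
  \<open>radial\<close> stays bounded although its coefficient can blow up as V tends to 0.\<close>

lemma norm_radial_le:
  assumes "\<bar>l\<bar> \<le> c"
  shows "norm (radial l V W) \<le> (1 + c) * norm W"
proof -
  have "norm ((l * (V \<bullet> W) / (norm V)\<^sup>2) *\<^sub>R V) \<le> c * norm W"
  proof (cases "V = 0")
    case True
    then show ?thesis using assms abs_ge_zero[of l] by (simp del: abs_ge_zero)
  next
    case False
    have "norm ((l * (V \<bullet> W) / (norm V)\<^sup>2) *\<^sub>R V) = \<bar>l\<bar> * (\<bar>V \<bullet> W\<bar> / norm V)"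
      using False by (simp add: abs_mult power2_eq_square)
    also have "\<dots> \<le> c * norm W"
    proof (rule mult_mono)
      show "\<bar>V \<bullet> W\<bar> / norm V \<le> norm W"
        using False Cauchy_Schwarz_ineq2[of V W] by (simp add: field_simps)
    qed (use assms abs_ge_zero[of l] in auto)
    finally show ?thesis .
  qed
  then show ?thesis
    unfolding radial_def using norm_triangle_le[of W _ "norm W + c * norm W"] by (simp add: distrib_right)
qed

text \<open>The two arguments are W + p V and W - p V, so the mixed terms cancel and only -p^2 |V|^2
  survives.\<close>

lemma inner_radial_radial:
  "radial l V W \<bullet> radial (-l) V W = (norm W)\<^sup>2 - l\<^sup>2 * (V \<bullet> W)\<^sup>2 / (norm V)\<^sup>2"
proof (cases "V = 0")
  case False
  have "(W + p *\<^sub>R V) \<bullet> (W + (-p) *\<^sub>R V) = W \<bullet> W - p\<^sup>2 * (V \<bullet> V)" for p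
    by (simp add: inner_add_left inner_diff_right inner_commute[of W V] power2_eq_square algebra_simps)
  from this[of "l * (V \<bullet> W) / (norm V)\<^sup>2"] show ?thesis
    using False by (simp add: radial_def dot_square_norm power2_eq_square)
qed (simp add: dot_square_norm)

lemma ellform_add_left: "ellform M l V (W + W') Z = ellform M l V W Z + ellform M l V W' Z"
  by (simp add: ellform_def radial_add matrix_vector_right_distrib herm_add_left)

lemma ellform_add_right: "ellform M l V W (Z + Z') = ellform M l V W Z + ellform M l V W Z'"
  by (simp add: ellform_def radial_add herm_add_right)

lemma ellform_scaleR_left: "ellform M l V (c *\<^sub>R W) Z = of_real c * ellform M l V W Z"
  by (simp add: ellform_def radial_scaleR matrix_vector_scaleR herm_scaleR_left)

lemma ellform_scaleR_right: "ellform M l V W (c *\<^sub>R Z) = of_real c * ellform M l V W Z"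
  by (simp add: ellform_def radial_scaleR herm_scaleR_right)

lemma ellform_scaleR: "c \<noteq> 0 \<Longrightarrow> ellform M l (c *\<^sub>R V) W Z = ellform M l V W Z"
  by (simp add: ellform_def radial_scaleR_left)

lemma ellform_zero [simp]: "ellform M l V 0 Z = 0" "ellform M l V W 0 = 0"
  by (simp_all add: ellform_def)

lemma ellform_diff_mat:
  "ellform (M - mat (complex_of_real k)) l V W Z = ellform M l V W Z - of_real k * ellform (mat 1) l V W Z"
  by (simp add: ellform_def matrix_vector_mult_diff_rdistrib herm_diff_left mat_of_real_vector herm_scaleR_left)

lemma Re_ellform_mat_1:
  "Re (ellform (mat 1) l V W W) = (norm W)\<^sup>2 - l\<^sup>2 * (V \<bullet> W)\<^sup>2 / (norm V)\<^sup>2"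
  by (simp add: ellform_def Re_herm_eq_inner inner_radial_radial)

lemma Re_ellform_mat_1_le: "Re (ellform (mat 1) l V W W) \<le> (norm W)\<^sup>2"
  by (simp add: Re_ellform_mat_1)

text \<open>Cauchy-Schwarz bounds (V . W)^2 / |V|^2 by |W|^2. This is the origin of the factor 1 -
  lam^2 in the later estimates.\<close>

lemma Re_ellform_mat_1_ge:
  assumes "\<bar>l\<bar> \<le> c"
  shows "(1 - c\<^sup>2) * (norm W)\<^sup>2 \<le> Re (ellform (mat 1) l V W W)"
proof -
  have 1: "l\<^sup>2 \<le> c\<^sup>2" using power_mono[OF assms, of 2] by simp
  have 2: "(V \<bullet> W)\<^sup>2 / (norm V)\<^sup>2 \<le> (norm W)\<^sup>2"
  proof (cases "V = 0")
    case False
    then show ?thesis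
      using Cauchy_Schwarz_ineq[of V W] by (simp add: field_simps dot_square_norm)
  qed simp
  have "l\<^sup>2 * ((V \<bullet> W)\<^sup>2 / (norm V)\<^sup>2) \<le> c\<^sup>2 * (norm W)\<^sup>2"
    using 1 2 by (intro mult_mono) auto
  then show ?thesis by (simp add: Re_ellform_mat_1 algebra_simps)
qed

text \<open>With W + p V and W - p V in the two slots, the mixed terms are p <M V, W> and -p <M W,
  V>. Only after taking real parts does the second become the adjoint term, so the underlying
  complex expressions may differ in their imaginary parts.\<close>

lemma Re_ellform_expand:
  "Re (ellform M l V W W) =
     Re (herm (M *v W) W)
     + l / (norm V)\<^sup>2 * Re (herm ((M - conj_transpose M) *v V) W) * Re (herm V W)
     - l\<^sup>2 / (norm V)^4 * Re (herm (M *v V) V) * (Re (herm V W))\<^sup>2"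
proof -
  define p where "p = l * (V \<bullet> W) / (norm V)\<^sup>2"
  have ct: "(conj_transpose M *v V) \<bullet> W = (M *v W) \<bullet> V"
    by (metis herm_conj_transpose Re_herm_eq_inner inner_commute)
  have r: "radial l V W = W + p *\<^sub>R V" "radial (-l) V W = W + (-p) *\<^sub>R V"
    by (simp_all add: radial_def p_def)
  have eq: "ellform M l V W W = herm (M *v W) W + p * herm (M *v V) W - p * herm (M *v W) V - p\<^sup>2 * herm (M *v V) V"
    unfolding ellform_def r matrix_vector_right_distrib matrix_vector_scaleR herm_add_left herm_add_right
      herm_scaleR_left herm_scaleR_right
    by (simp add: algebra_simps power2_eq_square)
  have "Re (ellform M l V W W) =
      Re (herm (M *v W) W) + p * (Re (herm (M *v V) W) - Re (herm (M *v W) V)) - p\<^sup>2 * Re (herm (M *v V) V)"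
    unfolding eq by (simp add: right_diff_distrib flip: of_real_power)
  also have "\<dots> = Re (herm (M *v W) W)
     + l / (norm V)\<^sup>2 * Re (herm ((M - conj_transpose M) *v V) W) * Re (herm V W)
     - l\<^sup>2 / (norm V)^4 * Re (herm (M *v V) V) * (Re (herm V W))\<^sup>2"
    by (simp add: p_def matrix_vector_mult_diff_rdistrib herm_diff_left ct Re_herm_eq_inner power_divide diff_divide_distrib
        power_mult_distrib algebra_simps flip: power_mult)
  finally show ?thesis .
qed

text \<open>The entry sum serves as matrix norm because local integrability is assumed entry by
  entry; it later supplies the majorant of the test integrands.\<close>

lemma norm_herm_matrix_le:
  "cmod (herm (M *v u) v) \<le> (\<Sum>i\<in>UNIV. \<Sum>j\<in>UNIV. cmod (M $ i $ j)) * (norm u * norm v)"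
  unfolding herm_matrix_vector sum_distrib_right
proof (intro sum_norm_le)
  fix i j
  have "cmod (u $ j) * cmod (v $ i) \<le> norm u * norm v"
    by (intro mult_mono) (auto simp: Finite_Cartesian_Product.norm_nth_le)
  then show "cmod (M $ i $ j * u $ j * cnj (v $ i)) \<le> cmod (M $ i $ j) * (norm u * norm v)"
    by (simp add: norm_mult mult.assoc mult_left_mono)
qed

lemma norm_ellform_le:
  assumes "\<bar>l\<bar> \<le> 1"
  shows "cmod (ellform M l V W Z) \<le> (\<Sum>i\<in>UNIV. \<Sum>j\<in>UNIV. cmod (M $ i $ j)) * (4 * (norm W * norm Z))"
proof -
  have "norm (radial l V W) * norm (radial (-l) V Z) \<le> (2 * norm W) * (2 * norm Z)"
    using norm_radial_le[OF assms, of V W] norm_radial_le[of "-l" 1 V Z] assms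
    by (intro mult_mono) auto
  then show ?thesis
    unfolding ellform_def
    by (intro order_trans[OF norm_herm_matrix_le] mult_left_mono sum_nonneg) auto
qed

section \<open>Continuity of the form in its parameters\<close>

lemma tendsto_radial:
  assumes "(l \<longlongrightarrow> l0) F" "(V \<longlongrightarrow> V0) F" "V0 \<noteq> 0" "(W \<longlongrightarrow> W0) F"
  shows "((\<lambda>x. radial (l x) (V x) (W x)) \<longlongrightarrow> radial l0 V0 W0) F"
  unfolding radial_def using assms by (auto intro!: tendsto_intros)

lemma tendsto_herm:
  assumes "(u \<longlongrightarrow> u0) F" "(v \<longlongrightarrow> v0) F"
  shows "((\<lambda>x. herm (u x) (v x)) \<longlongrightarrow> herm u0 v0) F"
  unfolding herm_def using assms by (intro tendsto_intros)

lemma tendsto_ellform: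
  assumes "(l \<longlongrightarrow> l0) F" "(V \<longlongrightarrow> V0) F" "V0 \<noteq> 0" "(W \<longlongrightarrow> W0) F" "(Z \<longlongrightarrow> Z0) F"
  shows "((\<lambda>x. ellform M (l x) (V x) (W x) (Z x)) \<longlongrightarrow> ellform M l0 V0 W0 Z0) F"
proof -
  have mv: "((\<lambda>x. M *v U x) \<longlongrightarrow> M *v U0) F" if "(U \<longlongrightarrow> U0) F" for U U0
    unfolding matrix_vector_mult_def using that by (intro tendsto_intros)
  show ?thesis
    unfolding ellform_def using assms by (intro tendsto_herm mv tendsto_radial tendsto_minus) auto
qed

subsection \<open>Properties of \<open>\<Lambda>\<close>\<close>

locale admissible =
  fixes \<phi> :: "real \<Rightarrow> real"
  assumes adm: "admissible_phi \<phi>"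
begin

text \<open>The logarithmic derivative of \<phi>. Condition (vi) says that its modulus is
  non-decreasing, and \<Lambda> is -q / (q + 2) in terms of its value q.\<close>

definition qphi :: "real \<Rightarrow> real" where "qphi s = s * deriv \<phi> s / \<phi> s"

definition mphi :: "real \<Rightarrow> real" where "mphi s = s * sqrt (\<phi> s)"

definition zeta :: "real \<Rightarrow> real" where "zeta = the_inv_into {0<..} mphi"

lemma phi_pos: "s > 0 \<Longrightarrow> \<phi> s > 0"
  using adm by (auto simp: admissible_phi_def)

lemma phi_deriv: "s > 0 \<Longrightarrow> (\<phi> has_real_derivative deriv \<phi> s) (at s)"
  using adm by (auto simp: admissible_phi_def C1_differentiable_on_eq DERIV_deriv_iff_real_differentiable)

lemma continuous_on_deriv_phi: "continuous_on {0<..} (deriv \<phi>)"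
proof -
  have "continuous_on {0<..} (\<lambda>s. vector_derivative \<phi> (at s))"
    using adm by (auto simp: admissible_phi_def C1_differentiable_on_eq)
  moreover have "vector_derivative \<phi> (at s) = deriv \<phi> s" if "s \<in> {0<..}" for s
    using phi_deriv[of s] that
    by (auto intro!: vector_derivative_at simp: has_real_derivative_iff_has_vector_derivative)
  ultimately show ?thesis by (subst continuous_on_cong[OF refl, symmetric])
qed

lemma isCont_phi: "s > 0 \<Longrightarrow> isCont \<phi> s"
  using phi_deriv DERIV_isCont by blast

lemma isCont_deriv_phi: "s > 0 \<Longrightarrow> isCont (deriv \<phi>) s"
  using continuous_on_deriv_phi by (simp add: continuous_on_eq_continuous_at)

text \<open>The derivative of s \<phi>(s) is \<phi>(s) (1 + q), so its positivity is exactly q > -1.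
  This keeps q + 2 positive and forces |\<Lambda>| < 1.\<close>

lemma qphi_gt: "s > 0 \<Longrightarrow> qphi s > -1"
proof -
  assume s: "s > 0"
  have "((\<lambda>\<sigma>. \<sigma> * \<phi> \<sigma>) has_real_derivative (\<phi> s + s * deriv \<phi> s)) (at s)"
    using phi_deriv[OF s] by (auto intro!: derivative_eq_intros)
  moreover have "deriv (\<lambda>\<sigma>. \<sigma> * \<phi> \<sigma>) s > 0"
    using adm s by (auto simp: admissible_phi_def)
  ultimately have "\<phi> s + s * deriv \<phi> s > 0" by (simp add: DERIV_imp_deriv)
  then show ?thesis using phi_pos[OF s] by (simp add: qphi_def field_simps)
qed

lemma isCont_qphi: "s > 0 \<Longrightarrow> isCont qphi s"
  unfolding qphi_def using isCont_phi isCont_deriv_phi phi_pos[of s] by (auto intro!: continuous_intros)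

lemma bij_mphi: "bij_betw mphi {0<..} {0<..}"
  using bij_betw_mult_sqrt_phi[OF adm] by (simp add: mphi_def[abs_def])

lemma zeta_pos: "t > 0 \<Longrightarrow> zeta t > 0"
  using bij_mphi bij_betw_the_inv_into[OF bij_mphi] by (auto simp: zeta_def bij_betw_def)

lemma zeta_mphi: "s > 0 \<Longrightarrow> zeta (mphi s) = s"
  unfolding zeta_def using bij_mphi by (intro the_inv_into_f_f) (auto simp: bij_betw_def)

lemma mphi_zeta: "t > 0 \<Longrightarrow> mphi (zeta t) = t"
  unfolding zeta_def using bij_mphi by (intro f_the_inv_into_f) (auto simp: bij_betw_def)

lemma Lambda_zeta: "Lambda \<phi> t = - (zeta t * deriv \<phi> (zeta t) / (zeta t * deriv \<phi> (zeta t) + 2 * \<phi> (zeta t)))"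
  by (simp add: Lambda_def zeta_def mphi_def[abs_def] Let_def)

lemma Lambda_qphi: "t > 0 \<Longrightarrow> Lambda \<phi> t = - (qphi (zeta t) / (qphi (zeta t) + 2))"
  using phi_pos[OF zeta_pos, of t] by (simp add: Lambda_zeta qphi_def divide_simps)

lemma mphi_deriv:
  assumes "s > 0"
  shows "(mphi has_real_derivative (sqrt (\<phi> s) * (1 + qphi s / 2))) (at s)"
proof -
  have "(mphi has_real_derivative (sqrt (\<phi> s) + s * (deriv \<phi> s * (inverse (sqrt (\<phi> s)) / 2)))) (at s)"
    unfolding mphi_def[abs_def] using assms phi_pos[OF assms]
    by (auto intro!: derivative_eq_intros phi_deriv)
  moreover have "s * (deriv \<phi> s * (inverse (sqrt (\<phi> s)) / 2)) = sqrt (\<phi> s) * (qphi s / 2)"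
    using phi_pos[OF assms] by (simp add: qphi_def field_simps)
  ultimately show ?thesis by (simp add: distrib_left)
qed

lemma mphi_strict_mono:
  assumes "0 < s" "s < t"
  shows "mphi s < mphi t"
proof (rule DERIV_pos_imp_increasing[OF assms(2)])
  fix x assume "s \<le> x"
  with assms have "0 < x" by simp
  then show "\<exists>y. (mphi has_real_derivative y) (at x) \<and> y > 0"
    using mphi_deriv[of x] qphi_gt[of x] phi_pos[of x] by (force intro!: mult_pos_pos)
qed

lemma isCont_zeta: 
  assumes "t > 0"
  shows "isCont zeta t"
proof -
  \<comment> \<open>Within this radius the points stay positive, the domain on which
    \<open>zeta\<close> inverts \<open>mphi\<close>.\<close>
  have pos: "z > 0" if "\<bar>z - zeta t\<bar> \<le> zeta t / 2" for z
    using that zeta_pos[OF assms] by linarith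
  have "isCont zeta (mphi (zeta t))"
    using isCont_inverse_function[of "zeta t / 2" "zeta t" zeta mphi] zeta_pos[OF assms] pos
    by (auto intro!: zeta_mphi DERIV_isCont[OF mphi_deriv])
  then show ?thesis by (simp add: mphi_zeta assms)
qed

text \<open>The logarithmic derivative of \<open>mphi\<close> is 1 + q/2; that of its inverse is the
  reciprocal 2 / (q + 2), which is 1 + \<Lambda>. This is what makes \<Lambda> the natural
  parameter.\<close>

lemma zeta_deriv:
  assumes t: "t > 0"
  shows "(zeta has_real_derivative (zeta t / t * (1 + Lambda \<phi> t))) (at t)"
proof -
  define s where "s = zeta t"
  have s: "s > 0" "mphi s = t" using zeta_pos mphi_zeta t by (auto simp: s_def)
  have q: "qphi s + 2 > 0" using qphi_gt[OF s(1)] by linarith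
  have "(zeta has_real_derivative inverse (sqrt (\<phi> s) * (1 + qphi s / 2))) (at t)"
    by (rule DERIV_inverse_function[of mphi _ _ _ "t/2" "t+1"])
       (use t s q phi_pos[OF s(1)] mphi_deriv[OF s(1)] isCont_zeta[OF t] in \<open>auto simp: s_def[symmetric] mphi_zeta\<close>)
  moreover have "inverse (sqrt (\<phi> s) * (1 + qphi s / 2)) = zeta t / t * (1 + Lambda \<phi> t)"
  proof -
    have 1: "1 + Lambda \<phi> t = 2 / (qphi s + 2)"
      using q by (simp add: Lambda_qphi[OF t] s_def[symmetric] field_simps)
    have 2: "zeta t / t = 1 / sqrt (\<phi> s)"
      using s phi_pos[OF s(1)] by (auto simp: s_def[symmetric] mphi_def field_simps)
    show ?thesis unfolding 1 2 using q phi_pos[OF s(1)] by (simp add: field_simps)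
  qed
  ultimately show ?thesis by simp
qed

lemma isCont_Lambda: "t > 0 \<Longrightarrow> isCont (Lambda \<phi>) t"
proof -
  assume t: "t > 0"
  have "isCont (\<lambda>t. qphi (zeta t)) t"
    by (rule isCont_o2[OF isCont_zeta[OF t] isCont_qphi[OF zeta_pos[OF t]]])
  then have "isCont (\<lambda>t. - (qphi (zeta t) / (qphi (zeta t) + 2))) t"
    using qphi_gt[OF zeta_pos[OF t]] by (intro continuous_intros) auto
  moreover have "eventually (\<lambda>t. Lambda \<phi> t = - (qphi (zeta t) / (qphi (zeta t) + 2))) (nhds t)"
    using eventually_nhds_in_open[of "{0<..}" t] t by (auto elim!: eventually_mono simp: Lambda_qphi)
  ultimately show ?thesis by (subst isCont_cong)
qed

lemma continuous_on_Lambda: "continuous_on {0<..} (Lambda \<phi>)"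
  by (simp add: continuous_on_eq_continuous_at isCont_Lambda)

section \<open>Sign, monotonicity and limit of \<Lambda>\<close>

lemma zeta_strict_mono: "0 < t \<Longrightarrow> t < t' \<Longrightarrow> zeta t < zeta t'"
  using mphi_strict_mono[of "zeta t'" "zeta t"] zeta_pos mphi_zeta
  by (metis less_trans linorder_less_linear order_less_imp_not_less)

lemma qphi_abs_mono: "0 < s \<Longrightarrow> s \<le> t \<Longrightarrow> \<bar>qphi s\<bar> \<le> \<bar>qphi t\<bar>"
  using adm unfolding admissible_phi_def mono_on_def qphi_def by auto

text \<open>A sign change would produce a zero of q by the intermediate value theorem, to the right
  of the smaller of the two points. As |q| is non-decreasing, q would vanish at that smaller point
  too, where it is nonzero.\<close>

lemma qphi_constant_sign: "(\<forall>s>0. qphi s \<ge> 0) \<or> (\<forall>s>0. qphi s \<le> 0)"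
proof (rule ccontr)
  assume "\<not> ?thesis"
  then obtain s1 s2 where s: "s1 > 0" "s2 > 0" "qphi s1 < 0" "qphi s2 > 0" by force
  have cont: "continuous_on {min s1 s2..max s1 s2} qphi"
    using s by (intro continuous_at_imp_continuous_on ballI isCont_qphi) auto
  have "\<exists>x\<ge>min s1 s2. x \<le> max s1 s2 \<and> qphi x = 0"
    using IVT'[of qphi s1 0 s2] IVT2'[of qphi s1 0 s2] s cont
    by (cases "s1 \<le> s2") (auto simp: min_def max_def)
  then obtain x where x: "min s1 s2 \<le> x" "qphi x = 0" by auto
  have "\<bar>qphi (min s1 s2)\<bar> \<le> \<bar>qphi x\<bar>" using x s by (intro qphi_abs_mono) auto
  then show False using x s by (auto simp: min_def split: if_splits)
qed

text \<open>Because q has constant sign, |\<Lambda>| is either |q| / (2 + |q|) throughout or |q| /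
  (2 - |q|) throughout, and both increase with |q|.\<close>

lemma Lambda_abs_mono:
  assumes "0 < t" "t \<le> t'"
  shows "\<bar>Lambda \<phi> t\<bar> \<le> \<bar>Lambda \<phi> t'\<bar>"
proof -
  define p p' where "p = qphi (zeta t)" and "p' = qphi (zeta t')"
  have le: "zeta t \<le> zeta t'" using zeta_strict_mono[of t t'] assms by (cases "t = t'") auto
  have abs: "\<bar>p\<bar> \<le> \<bar>p'\<bar>" unfolding p_def p'_def using zeta_pos assms le by (intro qphi_abs_mono) auto
  have gt: "p > -1" "p' > -1" using qphi_gt zeta_pos assms by (auto simp: p_def p'_def)
  have sgn: "p \<ge> 0 \<and> p' \<ge> 0 \<or> p \<le> 0 \<and> p' \<le> 0"
    using qphi_constant_sign zeta_pos assms by (auto simp: p_def p'_def)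
  have L: "\<bar>Lambda \<phi> t\<bar> = \<bar>p\<bar> / (p + 2)" "\<bar>Lambda \<phi> t'\<bar> = \<bar>p'\<bar> / (p' + 2)"
    using assms gt by (simp_all add: Lambda_qphi p_def[symmetric] p'_def[symmetric])
  show ?thesis unfolding L using sgn
  proof
    assume a: "p \<ge> 0 \<and> p' \<ge> 0"
    then show "\<bar>p\<bar> / (p + 2) \<le> \<bar>p'\<bar> / (p' + 2)" using abs by (simp add: field_simps)
  next
    assume a: "p \<le> 0 \<and> p' \<le> 0"
    then show "\<bar>p\<bar> / (p + 2) \<le> \<bar>p'\<bar> / (p' + 2)" using abs gt by (simp add: field_simps)
  qed
qed

lemma Lambda_abs_less_1: "t > 0 \<Longrightarrow> \<bar>Lambda \<phi> t\<bar> < 1"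
  using qphi_gt[OF zeta_pos, of t] by (auto simp: Lambda_qphi abs_if field_simps)

text \<open>The limit defining \<open>Lambda_infinity\<close> must first be shown to exist:
  |\<Lambda>| increases to its supremum, and the constant sign \<sigma> transfers this to \<Lambda>
  itself.\<close>

lemma Lambda_le_Lambda_infinity:
  assumes t: "t > 0"
  shows "\<bar>Lambda \<phi> t\<bar> \<le> \<bar>Lambda_infinity \<phi>\<bar>"
proof -
  define S where "S = (SUP t\<in>{0<..}. \<bar>Lambda \<phi> t\<bar>)"
  have bdd: "bdd_above ((\<lambda>t. \<bar>Lambda \<phi> t\<bar>) ` {0<..})"
    using Lambda_abs_less_1 by (intro bdd_aboveI2[of _ _ 1]) force
  have le: "\<bar>Lambda \<phi> t\<bar> \<le> S" if "t > 0" for t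
    unfolding S_def using that by (intro cSUP_upper bdd) auto
  have lim: "((\<lambda>t. \<bar>Lambda \<phi> t\<bar>) \<longlongrightarrow> S) at_top"
  proof (rule increasing_tendsto)
    show "eventually (\<lambda>t. \<bar>Lambda \<phi> t\<bar> \<le> S) at_top"
      using eventually_gt_at_top[of 0] by eventually_elim (rule le)
  next
    fix x assume "x < S"
    then obtain u where u: "u > 0" "x < \<bar>Lambda \<phi> u\<bar>"
      unfolding S_def using less_cSUP_iff[OF _ bdd] by auto
    show "eventually (\<lambda>t. x < \<bar>Lambda \<phi> t\<bar>) at_top"
      using eventually_ge_at_top[of u]
      by eventually_elim (use u Lambda_abs_mono[of u] in \<open>force intro: less_le_trans\<close>)
  qed
  obtain \<sigma> :: real where \<sigma>: "\<bar>\<sigma>\<bar> = 1" "\<And>t. t > 0 \<Longrightarrow> Lambda \<phi> t = \<sigma> * \<bar>Lambda \<phi> t\<bar>"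
  proof (cases "\<forall>s>0. qphi s \<ge> 0")
    case True
    then have "Lambda \<phi> t \<le> 0" if "t > 0" for t using zeta_pos[OF that] that by (auto simp: Lambda_qphi)
    then show ?thesis by (intro that[of "-1"]) (auto simp: abs_if order.antisym)
  next
    case False
    then have "\<forall>s>0. qphi s \<le> 0" using qphi_constant_sign by blast
    then have "Lambda \<phi> t \<ge> 0" if "t > 0" for t
      using zeta_pos[OF that] qphi_gt[of "zeta t"] that by (auto simp: Lambda_qphi divide_nonpos_pos)
    then show ?thesis by (intro that[of 1]) auto
  qed
  have "(Lambda \<phi> \<longlongrightarrow> \<sigma> * S) at_top"
  proof (rule Lim_transform_eventually)
    show "((\<lambda>t. \<sigma> * \<bar>Lambda \<phi> t\<bar>) \<longlongrightarrow> \<sigma> * S) at_top"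
      by (intro tendsto_intros lim)
    show "eventually (\<lambda>t. \<sigma> * \<bar>Lambda \<phi> t\<bar> = Lambda \<phi> t) at_top"
      using eventually_gt_at_top[of 0] by eventually_elim (metis \<sigma>(2))
  qed
  then have "Lambda_infinity \<phi> = \<sigma> * S"
    unfolding Lambda_infinity_def by (intro tendsto_Lim) auto
  then show ?thesis using \<sigma>(1) le[OF t] by (simp add: abs_mult)
qed

end

subsection \<open>Changing between \<open>u\<close>, \<open>\<phi>(|u|) u\<close> and \<open>\<surd>(\<phi>(|u|)) u\<close>\<close>

lemma has_vector_derivative_norm:
  fixes v :: "real \<Rightarrow> 'a::real_inner"
  assumes "(v has_vector_derivative V') (at x)" "v x \<noteq> 0"
  shows "((\<lambda>y. norm (v y)) has_real_derivative (v x \<bullet> V' / norm (v x))) (at x)"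
proof -
  have "((\<lambda>y. norm (v y)) has_derivative (\<lambda>h. (h *\<^sub>R V') \<bullet> sgn (v x))) (at x)"
    using has_derivative_compose[OF assms(1)[unfolded has_vector_derivative_def] has_derivative_norm[OF assms(2)]]
    by simp
  moreover have "(\<lambda>h. (h *\<^sub>R V') \<bullet> sgn (v x)) = (*) (v x \<bullet> V' / norm (v x))"
    by (auto simp: sgn_div_norm inner_commute field_simps)
  ultimately show ?thesis by (simp add: has_field_derivative_def)
qed

lemma has_vector_derivative_radial:
  fixes v :: "real \<Rightarrow> complex^'m"
  assumes v: "(v has_vector_derivative V') (at x)" "v x \<noteq> 0"
    and f: "(f has_real_derivative (f (norm (v x)) * l / norm (v x))) (at (norm (v x)))"
  shows "((\<lambda>y. f (norm (v y)) *\<^sub>R v y) has_vector_derivative (f (norm (v x)) *\<^sub>R radial l (v x) V')) (at x)"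
proof -
  have "((\<lambda>y. f (norm (v y))) has_real_derivative
      (f (norm (v x)) * l / norm (v x)) * (v x \<bullet> V' / norm (v x))) (at x)"
    by (rule DERIV_chain2[OF f has_vector_derivative_norm[OF v]])
  from has_vector_derivative_scaleR[OF this v(1)]
  have "((\<lambda>y. f (norm (v y)) *\<^sub>R v y) has_vector_derivative
      (f (norm (v x)) *\<^sub>R V' + ((f (norm (v x)) * l / norm (v x)) * (v x \<bullet> V' / norm (v x))) *\<^sub>R v x)) (at x)" .
  moreover have "f (norm (v x)) *\<^sub>R V' + ((f (norm (v x)) * l / norm (v x)) * (v x \<bullet> V' / norm (v x))) *\<^sub>R v x
      = f (norm (v x)) *\<^sub>R radial l (v x) V'"
    by (simp add: radial_def scaleR_add_right power2_eq_square)
  ultimately show ?thesis by simp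
qed

text \<open>The logarithmic derivative of f(t) t^c is (l + c) / t, which is non-negative, so this
  product increases. The result limits the blow-up of the conversion factors at 0 to the power
  t^(-c).\<close>

lemma logarithmic_derivative_bound:
  fixes f :: "real \<Rightarrow> real"
  assumes deriv: "\<And>t. t > 0 \<Longrightarrow> (f has_real_derivative (f t * l t / t)) (at t)"
    and pos: "\<And>t. t > 0 \<Longrightarrow> f t > 0"
    and l: "\<And>t. t > 0 \<Longrightarrow> \<bar>l t\<bar> \<le> c"
    and t: "0 < t" "t \<le> R"
  shows "f t \<le> f R * R powr c * t powr (-c)"
proof -
  have "f t * t powr c \<le> f R * R powr c"
  proof (rule DERIV_nonneg_imp_nondecreasing[OF t(2)])
    fix x assume "t \<le> x"
    then have x: "x > 0" using t by simp
    have "((\<lambda>t. f t * t powr c) has_real_derivative (f x * l x / x * x powr c + f x * (c * x powr (c - 1)))) (at x)"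
      using x by (auto intro!: derivative_eq_intros deriv)
    moreover have "f x * l x / x * x powr c + f x * (c * x powr (c - 1)) = f x * x powr c / x * (l x + c)"
      using x by (simp add: powr_diff field_simps)
    moreover have "f x * x powr c / x * (l x + c) \<ge> 0"
      using pos[OF x] l[OF x] x by (intro mult_nonneg_nonneg) auto
    ultimately show "\<exists>y. ((\<lambda>t. f t * t powr c) has_real_derivative y) (at x) \<and> y \<ge> 0" by metis
  qed
  then show ?thesis using t by (simp add: powr_minus field_simps)
qed

section \<open>The test space in vector-valued form\<close>

lemma has_vector_derivative_vec_iff:
  fixes u :: "real \<Rightarrow> ('a::real_normed_vector)^'m"
  shows "(u has_vector_derivative U) (at x) \<longleftrightarrow> (\<forall>i. ((\<lambda>x. u x $ i) has_vector_derivative U $ i) (at x))"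
proof
  assume "(u has_vector_derivative U) (at x)"
  then show "\<forall>i. ((\<lambda>x. u x $ i) has_vector_derivative U $ i) (at x)"
    using bounded_linear.has_vector_derivative[OF bounded_linear_vec_nth] by blast
next
  assume "\<forall>i. ((\<lambda>x. u x $ i) has_vector_derivative U $ i) (at x)"
  then have "((\<lambda>y. (1 / norm (y - x)) *\<^sub>R (u y $ i - (u x $ i + (y - x) *\<^sub>R U $ i))) \<longlongrightarrow> 0) (at x)" for i
    by (auto simp: has_vector_derivative_def has_derivative_within)
  then have "((\<lambda>y. (1 / norm (y - x)) *\<^sub>R (u y - (u x + (y - x) *\<^sub>R U))) \<longlongrightarrow> 0) (at x)"
    by (intro vec_tendstoI) simp
  then show "(u has_vector_derivative U) (at x)"
    by (simp add: has_vector_derivative_def has_derivative_within bounded_linear_scaleR_left)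
qed

text \<open>The components have separate supports; as they are finitely many, the union of the
  closures is a single compact set. In this form membership is checked without passing to
  coordinates.\<close>

lemma C1_compact_support_vec_iff:
  fixes u :: "real \<Rightarrow> complex^'m"
  shows "u \<in> C1_compact_support_vec a b \<longleftrightarrow>
    (\<exists>D. (\<forall>x\<in>einterval a b. (u has_vector_derivative D x) (at x)) \<and> continuous_on (einterval a b) D) \<and>
    (\<exists>K. compact K \<and> K \<subseteq> einterval a b \<and> (\<forall>x\<in>einterval a b - K. u x = 0))" (is "?L \<longleftrightarrow> ?R1 \<and> ?R2")
proof
  assume L: ?L
  then have comp: "(\<lambda>x. u x $ i) \<in> C1_compact_support a b" for i
    by (simp add: C1_compact_support_vec_def)
  then have "\<forall>i. \<exists>D. (\<forall>x\<in>einterval a b. ((\<lambda>x. u x $ i) has_vector_derivative D x) (at x)) \<and> continuous_on (einterval a b) D"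
    by (simp add: C1_compact_support_def C1_differentiable_on_def)
  then obtain D where D: "\<And>i x. x \<in> einterval a b \<Longrightarrow> ((\<lambda>x. u x $ i) has_vector_derivative D i x) (at x)"
    "\<And>i. continuous_on (einterval a b) (D i)" by metis
  have ?R1
  proof (intro exI[of _ "\<lambda>x. \<chi> i. D i x"] conjI ballI)
    show "(u has_vector_derivative (\<chi> i. D i x)) (at x)" if "x \<in> einterval a b" for x
      using D(1)[OF that] by (simp add: has_vector_derivative_vec_iff)
    show "continuous_on (einterval a b) (\<lambda>x. \<chi> i. D i x)"
      using D(2) by (intro continuous_on_vec_lambda)
  qed
  moreover have ?R2
  proof (intro exI[of _ "\<Union>i. closure (support_on (einterval a b) (\<lambda>x. u x $ i))"] conjI ballI)
    show "compact (\<Union>i. closure (support_on (einterval a b) (\<lambda>x. u x $ i)))"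
      using comp by (intro compact_UN) (auto simp: C1_compact_support_def)
    show "(\<Union>i. closure (support_on (einterval a b) (\<lambda>x. u x $ i))) \<subseteq> einterval a b"
      using comp by (auto simp: C1_compact_support_def)
    fix x assume x: "x \<in> einterval a b - (\<Union>i. closure (support_on (einterval a b) (\<lambda>x. u x $ i)))"
    have "u x $ i = 0" for i
    proof -
      have "x \<notin> support_on (einterval a b) (\<lambda>x. u x $ i)"
        using x closure_subset by blast
      then show ?thesis using x by (simp add: support_on_def)
    qed
    then show "u x = 0" by (simp add: vec_eq_iff)
  qed
  ultimately show "?R1 \<and> ?R2" ..
next
  assume R: "?R1 \<and> ?R2"
  then obtain D K where D: "\<And>x. x \<in> einterval a b \<Longrightarrow> (u has_vector_derivative D x) (at x)"
      "continuous_on (einterval a b) D"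
    and K: "compact K" "K \<subseteq> einterval a b" "\<And>x. x \<in> einterval a b - K \<Longrightarrow> u x = 0" by blast
  have "(\<lambda>x. u x $ i) \<in> C1_compact_support a b" for i
  proof -
    have "closure (support_on (einterval a b) (\<lambda>x. u x $ i)) \<subseteq> K"
      using K by (intro closure_minimal compact_imp_closed) (fastforce simp: support_on_def)+
    moreover from this have "compact (closure (support_on (einterval a b) (\<lambda>x. u x $ i)))"
      using K(1) by (metis closed_closure compact_Int_closed inf.absorb_iff2)
    moreover have "(\<lambda>x. u x $ i) C1_differentiable_on einterval a b"
      unfolding C1_differentiable_on_def
      using D by (intro exI[of _ "\<lambda>x. D x $ i"]) (auto intro!: continuous_intros simp: has_vector_derivative_vec_iff)
    ultimately show ?thesis using K(2) by (auto simp: C1_compact_support_def)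
  qed
  then show ?L by (simp add: C1_compact_support_vec_def)
qed

context admissible
begin

definition vmap :: "(real \<Rightarrow> complex^'m) \<Rightarrow> real \<Rightarrow> complex^'m" where
  "vmap u x = sqrt (\<phi> (norm (u x))) *\<^sub>R u x"

text \<open>This is the inverse of \<open>vmap\<close>. At a zero of v the coefficient is a
  meaningless default, but it multiplies the zero vector, so the value is right without a case
  distinction.\<close>

definition ulift :: "(real \<Rightarrow> complex^'m) \<Rightarrow> real \<Rightarrow> complex^'m" where
  "ulift v x = (zeta (norm (v x)) / norm (v x)) *\<^sub>R v x"

text \<open>Since \<phi>(\<zeta>(t)) = (t / \<zeta>(t))^2, multiplying the factor of
  \<open>ulift\<close> by \<phi>(|u|) inverts it.\<close>

definition wlift :: "(real \<Rightarrow> complex^'m) \<Rightarrow> real \<Rightarrow> complex^'m" where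
  "wlift v x = (norm (v x) / zeta (norm (v x))) *\<^sub>R v x"

lemma norm_vmap: "u x \<noteq> 0 \<Longrightarrow> norm (vmap u x) = mphi (norm (u x))"
  using phi_pos[of "norm (u x)"] by (simp add: vmap_def mphi_def)

lemma norm_ulift: "v x \<noteq> 0 \<Longrightarrow> norm (ulift v x) = zeta (norm (v x))"
  using zeta_pos[of "norm (v x)"] by (simp add: ulift_def)

lemma sqrt_phi_zeta: "t > 0 \<Longrightarrow> sqrt (\<phi> (zeta t)) = t / zeta t"
  using mphi_zeta[of t] zeta_pos[of t] by (simp add: mphi_def field_simps)

lemma phi_zeta: "t > 0 \<Longrightarrow> \<phi> (zeta t) = (t / zeta t)\<^sup>2"
  using phi_pos[OF zeta_pos, of t] by (simp flip: sqrt_phi_zeta)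

lemma ulift_vmap: "ulift (vmap u) x = u x"
proof (cases "u x = 0")
  case False
  then show ?thesis
    using phi_pos[of "norm (u x)"]
    by (simp add: ulift_def norm_vmap zeta_mphi) (simp add: vmap_def mphi_def)
qed (simp add: ulift_def vmap_def)

lemma vmap_ulift: "vmap (ulift v) x = v x"
proof (cases "v x = 0")
  case False
  then show ?thesis
    using zeta_pos[of "norm (v x)"]
    by (simp add: vmap_def norm_ulift sqrt_phi_zeta) (simp add: ulift_def)
qed (simp add: ulift_def vmap_def)

lemma phi_ulift: "\<phi> (norm (ulift v x)) *\<^sub>R ulift v x = wlift v x"
proof (cases "v x = 0")
  case False
  then show ?thesis
    using zeta_pos[of "norm (v x)"]
    by (simp add: norm_ulift phi_zeta power2_eq_square) (simp add: ulift_def wlift_def)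
qed (simp add: ulift_def wlift_def)

lemma ulift_eq_0_iff: "ulift v x = 0 \<longleftrightarrow> v x = 0"
  using zeta_pos[of "norm (v x)"] by (cases "v x = 0") (simp_all add: ulift_def)

text \<open>Dividing by t lowers the logarithmic derivative 1 + \<Lambda> of \<open>zeta\<close> by
  one; the reciprocal factor then has -\<Lambda>.\<close>

lemma zeta_over_deriv:
  "t > 0 \<Longrightarrow> ((\<lambda>t. zeta t / t) has_real_derivative (zeta t / t * Lambda \<phi> t / t)) (at t)"
  by (auto intro!: derivative_eq_intros zeta_deriv simp: field_simps)

lemma over_zeta_deriv:
  "t > 0 \<Longrightarrow> ((\<lambda>t. t / zeta t) has_real_derivative (t / zeta t * (- Lambda \<phi> t) / t)) (at t)"
  using zeta_pos[of t] by (auto intro!: derivative_eq_intros zeta_deriv simp: field_simps)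

lemma sqrt_phi_deriv:
  "s > 0 \<Longrightarrow> ((\<lambda>s. sqrt (\<phi> s)) has_real_derivative (sqrt (\<phi> s) * (qphi s / 2) / s)) (at s)"
  using phi_pos[of s] by (auto intro!: derivative_eq_intros phi_deriv simp: qphi_def field_simps)

lemma ulift_deriv:
  assumes "(v has_vector_derivative V') (at x)" "v x \<noteq> 0"
  shows "(ulift v has_vector_derivative
      (zeta (norm (v x)) / norm (v x)) *\<^sub>R radial (Lambda \<phi> (norm (v x))) (v x) V') (at x)"
  unfolding ulift_def[abs_def]
  by (rule has_vector_derivative_radial[OF assms, of "\<lambda>t. zeta t / t"], rule zeta_over_deriv)
     (use assms(2) in simp)

lemma wlift_deriv:
  assumes "(v has_vector_derivative V') (at x)" "v x \<noteq> 0"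
  shows "(wlift v has_vector_derivative
      (norm (v x) / zeta (norm (v x))) *\<^sub>R radial (- Lambda \<phi> (norm (v x))) (v x) V') (at x)"
  unfolding wlift_def[abs_def]
  by (rule has_vector_derivative_radial[OF assms, of "\<lambda>t. t / zeta t"], rule over_zeta_deriv)
     (use assms(2) in simp)

lemma vmap_deriv:
  assumes "(u has_vector_derivative U') (at x)" "u x \<noteq> 0"
  shows "(vmap u has_vector_derivative
      sqrt (\<phi> (norm (u x))) *\<^sub>R radial (qphi (norm (u x)) / 2) (u x) U') (at x)"
  unfolding vmap_def[abs_def]
  by (rule has_vector_derivative_radial[OF assms, of "\<lambda>s. sqrt (\<phi> s)"], rule sqrt_phi_deriv)
     (use assms(2) in simp)

text \<open>The two scalar factors are reciprocal and cancel, which is why the quadratic form in v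
  carries no weight.\<close>

lemma herm_lift_deriv:
  assumes "V \<noteq> 0"
  shows "herm (M *v ((zeta (norm V) / norm V) *\<^sub>R radial l V W)) ((norm V / zeta (norm V)) *\<^sub>R radial (-l) V W)
    = ellform M l V W W"
  using zeta_pos[of "norm V"] assms
  by (simp add: ellform_def matrix_vector_scaleR herm_scaleR_left herm_scaleR_right)

end

subsection \<open>Integrals over test functions\<close>

text \<open>Each isolated point of Z has a basis set meeting Z in that point alone; choosing one is
  an injection into a countable basis.\<close>

lemma countable_not_islimpt:
  fixes Z :: "'a::{second_countable_topology} set"
  shows "countable {x\<in>Z. \<not> x islimpt Z}" (is "countable ?T")
proof -
  obtain B :: "'a set set" where B: "countable B" "topological_basis B"
    using ex_countable_basis by blast
  have "\<exists>b\<in>B. x \<in> b \<and> b \<inter> Z = {x}" if x: "x \<in> ?T" for x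
  proof -
    obtain U where "open U" "x \<in> U" "\<forall>y\<in>Z. y \<in> U \<longrightarrow> y = x"
      using x unfolding islimpt_def by auto
    moreover then obtain b where "b \<in> B" "x \<in> b" "b \<subseteq> U"
      using topological_basisE[OF B(2)] by metis
    ultimately show ?thesis using x by blast
  qed
  then obtain f where f: "\<And>x. x \<in> ?T \<Longrightarrow> f x \<in> B \<and> x \<in> f x \<and> f x \<inter> Z = {x}" by metis
  then have "inj_on f ?T" by (intro inj_onI) (metis singleton_inject)
  moreover have "countable (f ` ?T)"
    using f by (intro countable_subset[OF _ B(1)]) auto
  ultimately show ?thesis by (rule countable_image_inj_on[rotated])
qed

lemma AE_islimpt: "AE x in lebesgue. x \<in> Z \<longrightarrow> x islimpt Z" for Z :: "real set"
proof -
  have "{x\<in>Z. \<not> x islimpt Z} \<in> null_sets lebesgue"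
    using countable_imp_null_set_lborel[OF countable_not_islimpt[of Z]]
    by (simp add: null_sets_completionI)
  then show ?thesis by (rule AE_I'[of "{x\<in>Z. \<not> x islimpt Z}"]) auto
qed

text \<open>Within Z the function is constantly 0, and at a limit point of Z the derivative within Z
  is unique.\<close>

lemma vector_derivative_zero_at_islimpt:
  fixes u :: "real \<Rightarrow> 'a::real_normed_vector"
  assumes "(u has_vector_derivative D) (at x)" "x islimpt Z" "\<And>y. y \<in> Z \<Longrightarrow> u y = 0" "x \<in> Z"
  shows "D = 0"
proof -
  have "(u has_vector_derivative D) (at x within Z)"
    using assms(1) by (rule has_vector_derivative_at_within)
  moreover have "(u has_vector_derivative 0) (at x within Z)"
    using assms(3,4)
    by (intro has_vector_derivative_transform_within[OF has_vector_derivative_const[of 0], of 1] ) auto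
  moreover have "at x within Z \<noteq> bot"
    using assms(2) by (simp add: trivial_limit_within)
  ultimately show ?thesis by (metis vector_derivative_unique_within)
qed

text \<open>No measurability of g is assumed: the measure \<open>lebesgue\<close> is complete, so a
  change on a null set preserves integrability.\<close>

lemma set_integral_cong_AE_lebesgue:
  fixes f g :: "real \<Rightarrow> 'b::euclidean_space"
  assumes f: "set_integrable lebesgue S f" and eq: "AE x in lebesgue. x \<in> S \<longrightarrow> g x = f x"
  shows "set_integrable lebesgue S g" "(LINT x:S|lebesgue. g x) = (LINT x:S|lebesgue. f x)"
proof -
  obtain N where N: "N \<in> null_sets lebesgue" "{x. \<not> (x \<in> S \<longrightarrow> g x = f x)} \<subseteq> N"
    using eq by (auto simp: eventually_ae_filter)
  then have neg: "negligible N" by (simp add: negligible_iff_null_sets)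
  have eq': "g x = f x" if "x \<in> S - N" for x using that N by auto
  show g: "set_integrable lebesgue S g"
    by (rule absolutely_integrable_spike[OF f neg eq'])
  show "(LINT x:S|lebesgue. g x) = (LINT x:S|lebesgue. f x)"
    using set_lebesgue_integral_eq_integral(2)[OF f] set_lebesgue_integral_eq_integral(2)[OF g]
      integral_spike[OF neg eq'] by simp
qed

section \<open>Integrability of matrix forms with locally integrable entries\<close>

lemma measurable_indicator_open_lebesgue:
  fixes f :: "real \<Rightarrow> 'b::real_normed_vector"
  assumes "open S" "continuous_on S f"
  shows "(\<lambda>x. indicator S x *\<^sub>R f x) \<in> borel_measurable lebesgue"
  using borel_measurable_continuous_on_indicator[of S f] assms
  by (simp add: measurable_completion)

lemma L1_loc_mult_integrable:
  assumes f: "f \<in> L1_loc a b" and K: "compact K" "K \<subseteq> einterval a b"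
    and g: "(\<lambda>x. indicator (einterval a b) x *\<^sub>R g x) \<in> borel_measurable lebesgue"
    and bdd: "\<And>x. x \<in> K \<Longrightarrow> cmod (g x) \<le> C"
    and zero: "\<And>x. x \<in> einterval a b - K \<Longrightarrow> g x = 0"
  shows "set_integrable lebesgue (einterval a b) (\<lambda>x. f x * g x)"
proof -
  have intK: "integrable lebesgue (\<lambda>x. indicator K x *\<^sub>R f x)"
    using f K by (auto simp: L1_loc_def set_integrable_def)
  have eq: "indicator (einterval a b) x *\<^sub>R (f x * g x)
      = (indicator K x *\<^sub>R f x) * (indicator (einterval a b) x *\<^sub>R g x)" for x
    using K(2) zero[of x] by (auto simp: indicator_def)
  show ?thesis
    unfolding set_integrable_def eq
  proof (rule Bochner_Integration.integrable_bound[of _ "\<lambda>x. C * norm (indicator K x *\<^sub>R f x)"])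
    show "integrable lebesgue (\<lambda>x. C * norm (indicator K x *\<^sub>R f x))"
      using intK by (intro integrable_mult_right integrable_norm)
    show "(\<lambda>x. indicator K x *\<^sub>R f x * indicator (einterval a b) x *\<^sub>R g x) \<in> borel_measurable lebesgue"
      using g intK by (intro borel_measurable_times) (auto dest: borel_measurable_integrable)
    show "AE x in lebesgue. norm (indicator K x *\<^sub>R f x * indicator (einterval a b) x *\<^sub>R g x)
        \<le> norm (C * norm (indicator K x *\<^sub>R f x))"
    proof (intro AE_I2)
      fix x
      show "norm (indicator K x *\<^sub>R f x * indicator (einterval a b) x *\<^sub>R g x)
        \<le> norm (C * norm (indicator K x *\<^sub>R f x))"
      proof (cases "x \<in> K")
        case True
        then have "cmod (f x) * cmod (g x) \<le> cmod (f x) * \<bar>C\<bar>"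
          using bdd[OF True] by (intro mult_left_mono) auto
        then show ?thesis using True K(2) by (auto simp: norm_mult abs_mult mult.commute)
      qed simp
    qed
  qed
qed

text \<open>These fields can be paired with entries known only to be locally integrable.
  Measurability replaces continuity because the fields of interest are set to 0 at the zeros of
  v.\<close>

definition bounded_test_field :: "real set \<Rightarrow> (real \<Rightarrow> complex^'m) \<Rightarrow> bool" where
  "bounded_test_field S U \<longleftrightarrow>
     (\<forall>i. (\<lambda>x. indicator S x *\<^sub>R (U x $ i)) \<in> borel_measurable lebesgue) \<and>
     (\<exists>K C. compact K \<and> K \<subseteq> S \<and> (\<forall>x\<in>K. norm (U x) \<le> C) \<and> (\<forall>x\<in>S - K. U x = 0))"

lemma herm_integrable:
  fixes A :: "real \<Rightarrow> complex^'m^'m"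
  assumes A: "\<And>i j. (\<lambda>x. A x $ i $ j) \<in> L1_loc a b"
    and U: "bounded_test_field (einterval a b) U" and W: "bounded_test_field (einterval a b) W"
  shows "set_integrable lebesgue (einterval a b) (\<lambda>x. herm (A x *v U x) (W x))"
proof -
  obtain K C where K: "compact K" "K \<subseteq> einterval a b" "\<And>x. x \<in> K \<Longrightarrow> norm (U x) \<le> C"
     "\<And>x. x \<in> einterval a b - K \<Longrightarrow> U x = 0" using U unfolding bounded_test_field_def by blast
  obtain L D where L: "compact L" "L \<subseteq> einterval a b" "\<And>x. x \<in> L \<Longrightarrow> norm (W x) \<le> D"
     "\<And>x. x \<in> einterval a b - L \<Longrightarrow> W x = 0" using W unfolding bounded_test_field_def by blast
  have "set_integrable lebesgue (einterval a b) (\<lambda>x. A x $ i $ j * (U x $ j * cnj (W x $ i)))" for i j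
  proof (rule L1_loc_mult_integrable[OF A, of "K \<inter> L" _ "\<bar>C\<bar> * \<bar>D\<bar>"])
    show "compact (K \<inter> L)" using K(1) L(1) by (simp add: compact_Int)
    show "K \<inter> L \<subseteq> einterval a b" using K(2) by auto
    have "(\<lambda>x. (indicator (einterval a b) x *\<^sub>R (U x $ j)) * cnj (indicator (einterval a b) x *\<^sub>R (W x $ i)))
        \<in> borel_measurable lebesgue"
      using U W unfolding bounded_test_field_def
      by (intro borel_measurable_times borel_measurable_continuous_on[of cnj]) (auto intro: continuous_intros)
    moreover have "(\<lambda>x. (indicator (einterval a b) x *\<^sub>R (U x $ j)) * cnj (indicator (einterval a b) x *\<^sub>R (W x $ i)))
       = (\<lambda>x. indicator (einterval a b) x *\<^sub>R (U x $ j * cnj (W x $ i)))"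
      by (auto simp: indicator_def)
    ultimately show "(\<lambda>x. indicator (einterval a b) x *\<^sub>R (U x $ j * cnj (W x $ i))) \<in> borel_measurable lebesgue"
      by simp
    show "cmod (U x $ j * cnj (W x $ i)) \<le> \<bar>C\<bar> * \<bar>D\<bar>" if "x \<in> K \<inter> L" for x
    proof -
      have "cmod (U x $ j) \<le> \<bar>C\<bar>" "cmod (W x $ i) \<le> \<bar>D\<bar>"
        using K(3)[of x] L(3)[of x] that Finite_Cartesian_Product.norm_nth_le[of "U x" j] Finite_Cartesian_Product.norm_nth_le[of "W x" i]
        by auto
      then show ?thesis by (simp add: norm_mult mult_mono)
    qed
    show "U x $ j * cnj (W x $ i) = 0" if "x \<in> einterval a b - (K \<inter> L)" for x
      using K(4)[of x] L(4)[of x] that by auto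
  qed
  then have "set_integrable lebesgue (einterval a b) (\<lambda>x. \<Sum>i\<in>UNIV. \<Sum>j\<in>UNIV. A x $ i $ j * (U x $ j * cnj (W x $ i)))"
    unfolding set_integrable_def scaleR_sum_right by (intro Bochner_Integration.integrable_sum)
  then show ?thesis by (simp add: herm_matrix_vector mult.assoc)
qed

lemma L1_loc_const: "(\<lambda>x. c) \<in> L1_loc a b"
  unfolding L1_loc_def by (auto simp: lmeasurable_compact)

lemma Re_set_integral:
  assumes "set_integrable M S f"
  shows "set_integrable M S (\<lambda>x. Re (f x))" "Re (LINT x:S|M. f x) = (LINT x:S|M. Re (f x))"
proof -
  have eq: "indicator S x *\<^sub>R Re (f x) = Re (indicator S x *\<^sub>R f x)" for x
    by simp
  have i: "integrable M (\<lambda>x. indicator S x *\<^sub>R f x)"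
    using assms by (simp add: set_integrable_def)
  show "set_integrable M S (\<lambda>x. Re (f x))"
    unfolding set_integrable_def eq using i by (rule integrable_Re)
  show "Re (LINT x:S|M. f x) = (LINT x:S|M. Re (f x))"
    unfolding set_lebesgue_integral_def eq using i by (rule integral_Re[symmetric])
qed

lemma continuous_on_radial:
  assumes "continuous_on S l" "continuous_on S V" "\<And>x. x \<in> S \<Longrightarrow> V x \<noteq> 0" "continuous_on S W"
  shows "continuous_on S (\<lambda>x. radial (l x) (V x) (W x))"
  using assms by (auto simp: continuous_on_def intro!: tendsto_radial)

text \<open>Measurability of the extension by 0 comes from continuity of f on the open set where v
  is nonzero; regularity at the zeros of v does not enter.\<close>

lemma bounded_test_field_restrict:
  fixes f v :: "real \<Rightarrow> complex^'m"
  assumes "open {x\<in>S. v x \<noteq> 0}" "continuous_on {x\<in>S. v x \<noteq> 0} f"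
    and "compact K" "K \<subseteq> S" "{x\<in>S. v x \<noteq> 0} \<subseteq> K" "\<And>x. x \<in> S \<Longrightarrow> v x \<noteq> 0 \<Longrightarrow> norm (f x) \<le> C"
  shows "bounded_test_field S (\<lambda>x. if v x = 0 then 0 else f x)"
  unfolding bounded_test_field_def
proof (intro conjI allI exI[of _ K] exI[of _ "\<bar>C\<bar>"] ballI)
  fix i
  have "(\<lambda>x. indicator {x\<in>S. v x \<noteq> 0} x *\<^sub>R (f x $ i)) \<in> borel_measurable lebesgue"
    using assms(1,2) by (intro measurable_indicator_open_lebesgue continuous_intros)
  moreover have "(\<lambda>x. indicator {x\<in>S. v x \<noteq> 0} x *\<^sub>R (f x $ i))
     = (\<lambda>x. indicator S x *\<^sub>R ((if v x = 0 then 0 else f x) $ i))"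
    by (auto simp: indicator_def)
  ultimately show "(\<lambda>x. indicator S x *\<^sub>R ((if v x = 0 then 0 else f x) $ i)) \<in> borel_measurable lebesgue"
    by simp
next
  fix x assume "x \<in> K"
  then show "norm (if v x = 0 then 0 else f x) \<le> \<bar>C\<bar>"
    using assms(4) assms(6)[of x] by (auto intro: order_trans)
qed (use assms in auto)

text \<open>A common home for both test classes. Off its zeros v is C^1 with bounded derivative; on
  them only the almost-everywhere value 0 of \<open>vector_derivative\<close> is recorded.\<close>

definition tame :: "ereal \<Rightarrow> ereal \<Rightarrow> (real \<Rightarrow> complex^'m) \<Rightarrow> bool" where
  "tame a b v \<longleftrightarrow>
     (let S = {x\<in>einterval a b. v x \<noteq> 0} in
       open S \<and> continuous_on S v \<and>
       (\<forall>x\<in>S. (v has_vector_derivative vector_derivative v (at x)) (at x)) \<and>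
       continuous_on S (\<lambda>x. vector_derivative v (at x)) \<and>
       (\<exists>K C. compact K \<and> K \<subseteq> einterval a b \<and> S \<subseteq> K \<and> (\<forall>x\<in>S. norm (vector_derivative v (at x)) \<le> C)) \<and>
       (AE x in lebesgue. x \<in> einterval a b \<longrightarrow> v x = 0 \<longrightarrow> vector_derivative v (at x) = 0))"

lemma tame_energy_integrable:
  fixes v :: "real \<Rightarrow> complex^'m"
  assumes "tame a b v"
  shows "set_integrable lebesgue (einterval a b) (\<lambda>x. (norm (vector_derivative v (at x)))\<^sup>2)"
proof -
  define S where "S = {x\<in>einterval a b. v x \<noteq> 0}"
  obtain K C where K: "compact K" "K \<subseteq> einterval a b" "S \<subseteq> K" "\<And>x. x\<in>S \<Longrightarrow> norm (vector_derivative v (at x)) \<le> C"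
    using assms unfolding tame_def S_def[symmetric] Let_def by blast
  define U where "U x = (if v x = 0 then 0 else vector_derivative v (at x))" for x
  have U: "bounded_test_field (einterval a b) U"
    unfolding U_def by (rule bounded_test_field_restrict[of _ _ _ K C])
      (use assms K in \<open>auto simp: tame_def S_def Let_def\<close>)
  \<comment> \<open>With the identity matrix the energy becomes an instance of integrability of
    matrix forms.\<close>
  have "set_integrable lebesgue (einterval a b) (\<lambda>x. herm (mat 1 *v U x) (U x))"
    by (rule herm_integrable[OF _ U U]) (simp add: L1_loc_const)
  from Re_set_integral(1)[OF this]
  have "set_integrable lebesgue (einterval a b) (\<lambda>x. (norm (U x))\<^sup>2)"
    by (simp add: herm_self)
  then show ?thesis
    by (rule set_integral_cong_AE_lebesgue(1)) (use assms in \<open>auto simp: tame_def Let_def U_def elim!: eventually_mono\<close>)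
qed

lemma C1_compact_support_vecE:
  fixes u :: "real \<Rightarrow> complex^'m"
  assumes "u \<in> C1_compact_support_vec a b"
  obtains K C where
    "\<And>x. x \<in> einterval a b \<Longrightarrow> (u has_vector_derivative vector_derivative u (at x)) (at x)"
    "continuous_on (einterval a b) u"
    "continuous_on (einterval a b) (\<lambda>x. vector_derivative u (at x))"
    "compact K" "K \<subseteq> einterval a b" "{x\<in>einterval a b. u x \<noteq> 0} \<subseteq> K"
    "\<And>x. x \<in> K \<Longrightarrow> norm (vector_derivative u (at x)) \<le> C"
proof -
  obtain D K where D: "\<And>x. x\<in>einterval a b \<Longrightarrow> (u has_vector_derivative D x) (at x)" "continuous_on (einterval a b) D"
    and K: "compact K" "K \<subseteq> einterval a b" "\<And>x. x\<in>einterval a b - K \<Longrightarrow> u x = 0"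
    using assms unfolding C1_compact_support_vec_iff by blast
  have eq: "vector_derivative u (at x) = D x" if "x \<in> einterval a b" for x
    using D(1)[OF that] by (rule vector_derivative_at)
  have cont: "continuous_on (einterval a b) (\<lambda>x. vector_derivative u (at x))"
    using D(2) by (subst continuous_on_cong[OF refl eq])
  have "bounded ((\<lambda>x. vector_derivative u (at x)) ` K)"
    using K by (intro compact_imp_bounded compact_continuous_image continuous_on_subset[OF cont])
  then obtain C where C: "\<And>x. x \<in> K \<Longrightarrow> norm (vector_derivative u (at x)) \<le> C"
    by (auto simp: bounded_iff)
  show ?thesis
  proof (rule that[of K C])
    show "continuous_on (einterval a b) u"
      using D(1) by (intro continuous_at_imp_continuous_on ballI has_vector_derivative_continuous) auto
  qed (use D K C eq cont in auto)
qed

text \<open>Isolated zeros are countable, hence null; at the other zeros the difference quotients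
  along the zero set vanish.\<close>

lemma AE_vector_derivative_zero:
  fixes u :: "real \<Rightarrow> 'a::real_normed_vector"
  assumes "\<And>x. x \<in> I \<Longrightarrow> (u has_vector_derivative vector_derivative u (at x)) (at x)"
  shows "AE x in lebesgue. x \<in> I \<longrightarrow> u x = 0 \<longrightarrow> vector_derivative u (at x) = 0"
  using AE_islimpt[of "{x. u x = 0}"]
proof eventually_elim
  case (elim x)
  show ?case
  proof (intro impI)
    assume x: "x \<in> I" "u x = 0"
    show "vector_derivative u (at x) = 0"
      by (rule vector_derivative_zero_at_islimpt[OF assms[OF x(1)], of "{x. u x = 0}"]) (use x elim in auto)
  qed
qed

lemma open_nonzero:
  fixes u :: "real \<Rightarrow> complex^'m"
  assumes "continuous_on (einterval a b) u"
  shows "open {x\<in>einterval a b. u x \<noteq> 0}"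
proof -
  have "open (einterval a b \<inter> u -` (- {0}))"
    using assms by (intro continuous_open_preimage) auto
  moreover have "einterval a b \<inter> u -` (- {0}) = {x\<in>einterval a b. u x \<noteq> 0}" by auto
  ultimately show ?thesis by simp
qed

lemma C1_compact_support_vec_tame:
  assumes "v \<in> C1_compact_support_vec a b"
  shows "tame a b v"
proof -
  obtain K C where v:
    "\<And>x. x \<in> einterval a b \<Longrightarrow> (v has_vector_derivative vector_derivative v (at x)) (at x)"
    "continuous_on (einterval a b) v"
    "continuous_on (einterval a b) (\<lambda>x. vector_derivative v (at x))"
    "compact K" "K \<subseteq> einterval a b" "{x\<in>einterval a b. v x \<noteq> 0} \<subseteq> K"
    "\<And>x. x \<in> K \<Longrightarrow> norm (vector_derivative v (at x)) \<le> C"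
    using assms by (rule C1_compact_support_vecE) blast
  have "\<exists>K C. compact K \<and> K \<subseteq> einterval a b \<and> {x\<in>einterval a b. v x \<noteq> 0} \<subseteq> K \<and>
      (\<forall>x\<in>{x\<in>einterval a b. v x \<noteq> 0}. norm (vector_derivative v (at x)) \<le> C)"
    using v by (intro exI[of _ K] exI[of _ C]) auto
  then show ?thesis
    unfolding tame_def Let_def
    using open_nonzero[OF v(2)] v AE_vector_derivative_zero[of "einterval a b" v]
    by (auto intro: continuous_on_subset)
qed

text \<open>The quotient |v(y)| / |y - x| is the geometric mean of those of u and w, which both tend
  to 0. The norm identity holds when u and w are the two lifts of v.\<close>

lemma has_vector_derivative_zero_geometric_mean:
  fixes u w v :: "real \<Rightarrow> 'a::real_normed_vector"
  assumes "(u has_vector_derivative 0) (at x)" "(w has_vector_derivative 0) (at x)"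
    "u x = 0" "w x = 0" "\<And>y. (norm (v y))\<^sup>2 = norm (u y) * norm (w y)"
  shows "(v has_vector_derivative 0) (at x)"
proof -
  have v0: "v x = 0" using assms(3) assms(5)[of x] by simp
  have "((\<lambda>y. norm (u y) / \<bar>y - x\<bar>) \<longlongrightarrow> 0) (at x)" "((\<lambda>y. norm (w y) / \<bar>y - x\<bar>) \<longlongrightarrow> 0) (at x)"
    using assms(1-4) by (simp_all add: has_vector_derivative_def has_derivative_iff_norm)
  then have "((\<lambda>y. sqrt ((norm (u y) / \<bar>y - x\<bar>) * (norm (w y) / \<bar>y - x\<bar>))) \<longlongrightarrow> sqrt (0 * 0)) (at x)"
    by (intro tendsto_intros)
  moreover have "sqrt ((norm (u y) / \<bar>y - x\<bar>) * (norm (w y) / \<bar>y - x\<bar>)) = norm (v y) / \<bar>y - x\<bar>" for y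
  proof -
    have "(norm (u y) / \<bar>y - x\<bar>) * (norm (w y) / \<bar>y - x\<bar>) = (norm (v y) / \<bar>y - x\<bar>)\<^sup>2"
      by (simp add: power_divide assms(5) power2_eq_square[of "\<bar>y - x\<bar>"] del: power2_abs abs_mult_self)
    then show ?thesis by simp
  qed
  ultimately show ?thesis
    using v0 by (simp add: has_vector_derivative_def has_derivative_iff_norm)
qed

section \<open>Energy functionals in the variable v\<close>

locale bounded_Lambda = admissible +
  fixes lam :: real
  assumes lam: "lam < 1" and Lambda_le: "\<And>t. t > 0 \<Longrightarrow> \<bar>Lambda \<phi> t\<bar> \<le> lam"
begin

lemma lam_nonneg: "lam \<ge> 0"
  using Lambda_le[of 1] by linarith

definition eterm :: "(real \<Rightarrow> complex^'m^'m) \<Rightarrow> (real \<Rightarrow> complex^'m) \<Rightarrow> real \<Rightarrow> complex" where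
  "eterm M v x = (if v x = 0 then 0 else
     ellform (M x) (Lambda \<phi> (norm (v x))) (v x) (vector_derivative v (at x)) (vector_derivative v (at x)))"

definition energy :: "ereal \<Rightarrow> ereal \<Rightarrow> (real \<Rightarrow> complex^'m) \<Rightarrow> real" where
  "energy a b v = (LINT x:einterval a b|lebesgue. (norm (vector_derivative v (at x)))\<^sup>2)"

definition efun :: "ereal \<Rightarrow> ereal \<Rightarrow> (real \<Rightarrow> complex^'m^'m) \<Rightarrow> (real \<Rightarrow> complex^'m) \<Rightarrow> real" where
  "efun a b M v = (LINT x:einterval a b|lebesgue. Re (eterm M v x))"

lemma continuous_on_Lambda_norm:
  fixes v :: "real \<Rightarrow> complex^'m"
  assumes "continuous_on S v" "\<And>x. x \<in> S \<Longrightarrow> v x \<noteq> 0"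
  shows "continuous_on S (\<lambda>x. Lambda \<phi> (norm (v x)))"
  by (rule continuous_on_compose2[OF continuous_on_Lambda])
     (use assms in \<open>auto intro!: continuous_intros\<close>)

text \<open>The parameter \<sigma> is 1 or -1 for the two lifted derivatives, up to their scalar
  factors, and 0 for v' itself. The common bound 2 C comes from |\<Lambda>| < 1.\<close>

lemma tame_bounded_test_field:
  fixes v :: "real \<Rightarrow> complex^'m"
  assumes tame: "tame a b v" and \<sigma>: "\<bar>\<sigma>\<bar> \<le> 1"
  shows "bounded_test_field (einterval a b)
     (\<lambda>x. if v x = 0 then 0 else radial (\<sigma> * Lambda \<phi> (norm (v x))) (v x) (vector_derivative v (at x)))"
proof -
  define S where "S = {x\<in>einterval a b. v x \<noteq> 0}"
  obtain K C where K: "compact K" "K \<subseteq> einterval a b" "S \<subseteq> K" "\<And>x. x\<in>S \<Longrightarrow> norm (vector_derivative v (at x)) \<le> C"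
    using assms unfolding tame_def S_def[symmetric] Let_def by blast
  have cont: "open S" "continuous_on S v" "continuous_on S (\<lambda>x. vector_derivative v (at x))"
    using tame unfolding tame_def S_def[symmetric] Let_def by auto
  show ?thesis
  proof (rule bounded_test_field_restrict[OF _ _ K(1,2), where C = "2 * C"])
    show "open {x \<in> einterval a b. v x \<noteq> 0}" "{x \<in> einterval a b. v x \<noteq> 0} \<subseteq> K"
      using cont K by (auto simp: S_def)
    show "continuous_on {x \<in> einterval a b. v x \<noteq> 0}
       (\<lambda>x. radial (\<sigma> * Lambda \<phi> (norm (v x))) (v x) (vector_derivative v (at x)))"
      unfolding S_def[symmetric]
      by (intro continuous_on_radial continuous_on_mult_left continuous_on_Lambda_norm cont) (auto simp: S_def)
    fix x assume x: "x \<in> einterval a b" "v x \<noteq> 0"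
    have "\<bar>\<sigma> * Lambda \<phi> (norm (v x))\<bar> \<le> 1"
      using \<sigma> Lambda_abs_less_1[of "norm (v x)"] x(2) mult_mono[of "\<bar>\<sigma>\<bar>" 1 "\<bar>Lambda \<phi> (norm (v x))\<bar>" 1]
      by (simp add: abs_mult)
    from norm_radial_le[OF this, of "v x" "vector_derivative v (at x)"]
    show "norm (radial (\<sigma> * Lambda \<phi> (norm (v x))) (v x) (vector_derivative v (at x))) \<le> 2 * C"
      using K(4)[of x] x by (auto simp: S_def intro: order_trans)
  qed
qed

lemma eterm_integrable:
  assumes A: "\<And>i j. (\<lambda>x. A x $ i $ j) \<in> L1_loc a b" and tame: "tame a b v"
  shows "set_integrable lebesgue (einterval a b) (eterm A v)"
proof -
  have "eterm A v = (\<lambda>x. herm (A x *v (if v x = 0 then 0 else radial (1 * Lambda \<phi> (norm (v x))) (v x) (vector_derivative v (at x))))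
    (if v x = 0 then 0 else radial ((-1) * Lambda \<phi> (norm (v x))) (v x) (vector_derivative v (at x))))"
    by (auto simp: eterm_def ellform_def)
  then show ?thesis
    by (simp only:) (intro herm_integrable A tame_bounded_test_field tame; simp)
qed

lemma eterm_diff_mat: "eterm (\<lambda>x. A x - mat (complex_of_real k)) v x = eterm A v x - of_real k * eterm (\<lambda>_. mat 1) v x"
  by (simp add: eterm_def ellform_diff_mat)

lemma efun_diff_mat:
  assumes A: "\<And>i j. (\<lambda>x. A x $ i $ j) \<in> L1_loc a b" and tame: "tame a b v"
  shows "efun a b (\<lambda>x. A x - mat (complex_of_real k)) v = efun a b A v - k * efun a b (\<lambda>_. mat 1) v"
proof -
  have 1: "set_integrable lebesgue (einterval a b) (\<lambda>x. Re (eterm A v x))"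
    by (intro Re_set_integral eterm_integrable A tame)
  have 2: "set_integrable lebesgue (einterval a b) (\<lambda>x. Re (eterm (\<lambda>_. mat 1) v x))"
    by (intro Re_set_integral eterm_integrable L1_loc_const tame)
  have 3: "set_integrable lebesgue (einterval a b) (\<lambda>x. k * Re (eterm (\<lambda>_. mat 1) v x))"
    using 2 by simp
  show ?thesis
    using set_integral_diff(2)[OF 1 3] by (simp add: efun_def eterm_diff_mat)
qed

lemma set_integral_mono_AE_lebesgue:
  fixes f g :: "real \<Rightarrow> real"
  assumes "set_integrable lebesgue S f" "set_integrable lebesgue S g" "AE x in lebesgue. x \<in> S \<longrightarrow> f x \<le> g x"
  shows "(LINT x:S|lebesgue. f x) \<le> (LINT x:S|lebesgue. g x)"
  using assms unfolding set_integrable_def set_lebesgue_integral_def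
  by (intro integral_mono_AE) (auto simp: indicator_def elim!: eventually_mono)

text \<open>At the zeros of v the integrand of \<open>efun\<close> is 0 by convention, so the lower
  bound there rests on v' = 0 almost everywhere.\<close>

lemma efun_mat_1_bounds:
  assumes tame: "tame a b v"
  shows "(1 - lam\<^sup>2) * energy a b v \<le> efun a b (\<lambda>_. mat 1) v" "efun a b (\<lambda>_. mat 1) v \<le> energy a b v"
proof -
  have 1: "set_integrable lebesgue (einterval a b) (\<lambda>x. Re (eterm (\<lambda>_. mat 1) v x))"
    by (intro Re_set_integral eterm_integrable L1_loc_const tame)
  have z: "AE x in lebesgue. x \<in> einterval a b \<longrightarrow> v x = 0 \<longrightarrow> vector_derivative v (at x) = 0"
    using tame by (simp add: tame_def Let_def)
  have "(LINT x:einterval a b|lebesgue. (1 - lam\<^sup>2) * (norm (vector_derivative v (at x)))\<^sup>2) \<le> efun a b (\<lambda>_. mat 1) v"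
    unfolding efun_def
  proof (rule set_integral_mono_AE_lebesgue[OF _ 1])
    show "AE x in lebesgue. x \<in> einterval a b \<longrightarrow>
       (1 - lam\<^sup>2) * (norm (vector_derivative v (at x)))\<^sup>2 \<le> Re (eterm (\<lambda>_. mat 1) v x)"
      using z by eventually_elim (auto simp: eterm_def intro!: Re_ellform_mat_1_ge Lambda_le)
  qed (use tame_energy_integrable[OF tame] in simp)
  then show "(1 - lam\<^sup>2) * energy a b v \<le> efun a b (\<lambda>_. mat 1) v"
    by (simp add: energy_def)
  show "efun a b (\<lambda>_. mat 1) v \<le> energy a b v"
    unfolding efun_def energy_def
    by (rule set_integral_mono_AE_lebesgue[OF 1 tame_energy_integrable[OF tame]])
       (auto simp: eterm_def Re_ellform_mat_1_le)
qed

text \<open>Off its zeros v inherits C^1 regularity from \<open>vmap u\<close>. The factor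
  sqrt(\<phi>(|u|)) need not stay bounded as u tends to 0, so boundedness of v' comes from the form
  itself: (1 - lam^2) |v'|^2 \<le> Re <u', w'> \<le> |u'| |w'|. At zeros of v where u' and w'
  vanish, the geometric mean identity gives v' = 0.\<close>

lemma lifts_tame:
  fixes v :: "real \<Rightarrow> complex^'m"
  assumes u: "ulift v \<in> C1_compact_support_vec a b" and w: "wlift v \<in> C1_compact_support_vec a b"
  shows "tame a b v"
    and "\<And>x. x \<in> einterval a b \<Longrightarrow> v x \<noteq> 0 \<Longrightarrow>
       herm (M *v vector_derivative (ulift v) (at x)) (vector_derivative (wlift v) (at x))
       = ellform M (Lambda \<phi> (norm (v x))) (v x) (vector_derivative v (at x)) (vector_derivative v (at x))"
    and "AE x in lebesgue. x \<in> einterval a b \<longrightarrow> v x = 0 \<longrightarrow>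
       vector_derivative (ulift v) (at x) = 0 \<and> vector_derivative (wlift v) (at x) = 0"
proof -
  define I where "I = einterval a b"
  define S where "S = {x\<in>I. v x \<noteq> 0}"
  define u w where "u = ulift v" and "w = wlift v"
  obtain K C where u:
    "\<And>x. x \<in> I \<Longrightarrow> (u has_vector_derivative vector_derivative u (at x)) (at x)"
    "continuous_on I u" "continuous_on I (\<lambda>x. vector_derivative u (at x))"
    "compact K" "K \<subseteq> I" "{x\<in>I. u x \<noteq> 0} \<subseteq> K"
    "\<And>x. x \<in> K \<Longrightarrow> norm (vector_derivative u (at x)) \<le> C"
    using assms(1) unfolding I_def u_def by (rule C1_compact_support_vecE) blast
  obtain K' C' where w:
    "\<And>x. x \<in> I \<Longrightarrow> (w has_vector_derivative vector_derivative w (at x)) (at x)"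
    "continuous_on I w" "continuous_on I (\<lambda>x. vector_derivative w (at x))"
    "compact K'" "K' \<subseteq> I" "{x\<in>I. w x \<noteq> 0} \<subseteq> K'"
    "\<And>x. x \<in> K' \<Longrightarrow> norm (vector_derivative w (at x)) \<le> C'"
    using assms(2) unfolding I_def w_def by (rule C1_compact_support_vecE) blast
  have v_eq: "v = vmap u" by (auto simp: u_def vmap_ulift)
  have u0: "u x = 0 \<longleftrightarrow> v x = 0" for x by (simp add: u_def ulift_eq_0_iff)
  have w0: "w x = 0 \<longleftrightarrow> v x = 0" for x
    using zeta_pos[of "norm (v x)"] by (cases "v x = 0") (simp_all add: w_def wlift_def)
  have S: "S = {x\<in>I. u x \<noteq> 0}" by (simp add: S_def u0)
  have der: "(v has_vector_derivative
      sqrt (\<phi> (norm (u x))) *\<^sub>R radial (qphi (norm (u x)) / 2) (u x) (vector_derivative u (at x))) (at x)"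
    if "x \<in> S" for x
    unfolding v_eq using that by (intro vmap_deriv u(1)) (auto simp: S)
  have vd: "(v has_vector_derivative vector_derivative v (at x)) (at x)" if "x \<in> S" for x
    using der[OF that] vector_derivative_at by metis
  have openS: "open S" unfolding S I_def by (rule open_nonzero) (use u(2) I_def in auto)
  have contu: "continuous_on S u" "continuous_on S (\<lambda>x. vector_derivative u (at x))"
    by (auto intro: continuous_on_subset[OF u(2)] continuous_on_subset[OF u(3)] simp: S_def)
  have contf: "continuous_on S (\<lambda>x. f (norm (u x)))" if "\<And>s. s > 0 \<Longrightarrow> isCont f s" for f :: "real \<Rightarrow> real"
  proof (rule continuous_on_compose2[of "{0<..}" f])
    show "continuous_on {0<..} f" using that by (intro continuous_at_imp_continuous_on) auto
    show "continuous_on S (\<lambda>x. norm (u x))" by (intro continuous_on_norm contu)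
  qed (auto simp: S)
  have contvd: "continuous_on S (\<lambda>x. vector_derivative v (at x))"
  proof (subst continuous_on_cong[OF refl vector_derivative_at[OF der]])
    show "continuous_on S (\<lambda>x. sqrt (\<phi> (norm (u x))) *\<^sub>R radial (qphi (norm (u x)) / 2) (u x) (vector_derivative u (at x)))"
      by (intro continuous_on_scaleR continuous_on_radial continuous_on_divide continuous_on_real_sqrt contu contf isCont_phi isCont_qphi
          continuous_on_const) (auto simp: S)
  qed
  have hu: "(u has_vector_derivative
      (zeta (norm (v x)) / norm (v x)) *\<^sub>R radial (Lambda \<phi> (norm (v x))) (v x) (vector_derivative v (at x))) (at x)"
    and hw: "(w has_vector_derivative
      (norm (v x) / zeta (norm (v x))) *\<^sub>R radial (- Lambda \<phi> (norm (v x))) (v x) (vector_derivative v (at x))) (at x)"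
    if "x \<in> S" for x
    unfolding u_def w_def using that vd[OF that] by (auto intro!: ulift_deriv wlift_deriv simp: S_def)
  have herm: "herm (M *v vector_derivative u (at x)) (vector_derivative w (at x))
       = ellform M (Lambda \<phi> (norm (v x))) (v x) (vector_derivative v (at x)) (vector_derivative v (at x))"
    if "x \<in> S" for x and M :: "complex^'m^'m"
    unfolding vector_derivative_at[OF hu[OF that]] vector_derivative_at[OF hw[OF that]]
    using that by (intro herm_lift_deriv) (auto simp: S_def)
  then show "\<And>x. x \<in> einterval a b \<Longrightarrow> v x \<noteq> 0 \<Longrightarrow>
       herm (M *v vector_derivative (ulift v) (at x)) (vector_derivative (wlift v) (at x))
       = ellform M (Lambda \<phi> (norm (v x))) (v x) (vector_derivative v (at x)) (vector_derivative v (at x))"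
    by (simp add: S_def I_def u_def w_def)
  have AEu: "AE x in lebesgue. x \<in> I \<longrightarrow> v x = 0 \<longrightarrow> vector_derivative u (at x) = 0"
    using AE_vector_derivative_zero[of I u] u(1) by (simp add: u0)
  have AEw: "AE x in lebesgue. x \<in> I \<longrightarrow> v x = 0 \<longrightarrow> vector_derivative w (at x) = 0"
    using AE_vector_derivative_zero[of I w] w(1) by (simp add: w0)
  have "AE x in lebesgue. x \<in> I \<longrightarrow> v x = 0 \<longrightarrow>
       vector_derivative u (at x) = 0 \<and> vector_derivative w (at x) = 0"
    using AEu AEw by eventually_elim auto
  then show "AE x in lebesgue. x \<in> einterval a b \<longrightarrow> v x = 0 \<longrightarrow>
       vector_derivative (ulift v) (at x) = 0 \<and> vector_derivative (wlift v) (at x) = 0"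
    by (simp add: u_def w_def I_def)
  have AEv: "AE x in lebesgue. x \<in> I \<longrightarrow> v x = 0 \<longrightarrow> vector_derivative v (at x) = 0"
    using AEu AEw
  proof eventually_elim
    case (elim x)
    show ?case
    proof (intro impI)
      assume x: "x \<in> I" "v x = 0"
      have "(v has_vector_derivative 0) (at x)"
      proof (rule has_vector_derivative_zero_geometric_mean)
        show "(u has_vector_derivative 0) (at x)" "(w has_vector_derivative 0) (at x)"
          using elim x u(1)[of x] w(1)[of x] by auto
        show "u x = 0" "w x = 0" using x u0 w0 by auto
        show "(norm (v y))\<^sup>2 = norm (u y) * norm (w y)" for y
          using zeta_pos[of "norm (v y)"] by (cases "v y = 0") (simp_all add: u_def w_def ulift_def wlift_def power2_eq_square)
      qed
      then show "vector_derivative v (at x) = 0" by (rule vector_derivative_at)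
    qed
  qed
  have lam2: "1 - lam\<^sup>2 > 0" using lam lam_nonneg by (simp add: abs_square_less_1)
  have bd: "norm (vector_derivative v (at x)) \<le> sqrt (C * \<bar>C'\<bar> / (1 - lam\<^sup>2))" if x: "x \<in> S" for x
  proof -
    have xK: "x \<in> K" "x \<in> K'" using x u(6) w(6) by (auto simp: S_def u0 w0)
    have "(1 - lam\<^sup>2) * (norm (vector_derivative v (at x)))\<^sup>2 \<le>
       Re (ellform (mat 1) (Lambda \<phi> (norm (v x))) (v x) (vector_derivative v (at x)) (vector_derivative v (at x)))"
      using x by (intro Re_ellform_mat_1_ge Lambda_le) (auto simp: S_def)
    also have "\<dots> = vector_derivative u (at x) \<bullet> vector_derivative w (at x)"
      by (simp add: herm[OF x, symmetric] Re_herm_eq_inner)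
    also have "\<dots> \<le> norm (vector_derivative u (at x)) * norm (vector_derivative w (at x))"
      by (rule norm_cauchy_schwarz)
    also have "\<dots> \<le> C * \<bar>C'\<bar>"
      using u(7)[OF xK(1)] w(7)[OF xK(2)] by (intro mult_mono) (auto intro: order_trans[OF norm_ge_zero])
    finally have "(norm (vector_derivative v (at x)))\<^sup>2 \<le> C * \<bar>C'\<bar> / (1 - lam\<^sup>2)"
      using lam2 by (simp add: field_simps)
    then show ?thesis by (rule real_le_rsqrt)
  qed
  have K: "\<exists>K C. compact K \<and> K \<subseteq> I \<and> S \<subseteq> K \<and> (\<forall>x\<in>S. norm (vector_derivative v (at x)) \<le> C)"
    using u(4,5,6) bd unfolding S[symmetric] by blast
  have contv: "continuous_on S v"
    using vd by (intro continuous_at_imp_continuous_on ballI has_vector_derivative_continuous) auto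
  show "tame a b v"
    unfolding tame_def Let_def I_def[symmetric] S_def[symmetric]
    using openS contv vd contvd K AEv by auto
qed

lemma dissipativity_integral:
  fixes A :: "real \<Rightarrow> complex^'m^'m"
  assumes A: "\<And>i j. (\<lambda>x. A x $ i $ j) \<in> L1_loc a b"
    and u: "ulift v \<in> C1_compact_support_vec a b" and w: "wlift v \<in> C1_compact_support_vec a b"
  shows "Re (LINT x:einterval a b|lebesgue.
       herm (A x *v vector_derivative (ulift v) (at x)) (vector_derivative (wlift v) (at x))) = efun a b A v"
proof -
  note t = lifts_tame[OF u w]
  have int: "set_integrable lebesgue (einterval a b) (eterm A v)"
    by (rule eterm_integrable[OF A t(1)])
  have "(LINT x:einterval a b|lebesgue.
       herm (A x *v vector_derivative (ulift v) (at x)) (vector_derivative (wlift v) (at x)))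
     = (LINT x:einterval a b|lebesgue. eterm A v x)"
    by (rule set_integral_cong_AE_lebesgue(2)[OF int])
       (use t(3) in \<open>eventually_elim, auto simp: eterm_def t(2)\<close>)
  then show ?thesis
    using Re_set_integral(2)[OF int] by (simp add: efun_def)
qed

text \<open>The defining integrand is matched with \<open>eterm\<close> in its real part only, so
  its own integrability is established before \<open>Re\<close> moves inside the integral.\<close>

lemma ellipticity_integral:
  fixes A :: "real \<Rightarrow> complex^'m^'m"
  assumes A: "\<And>i j. (\<lambda>x. A x $ i $ j) \<in> L1_loc a b" and tame: "tame a b v"
  shows "Re (LINT x:einterval a b|lebesgue.
              (let V = v x; V' = vector_derivative v (at x); \<Lambda> = Lambda \<phi> (norm V)
               in if V = 0 then 0
                  else herm (A x *v V') V'
                     + complex_of_real (\<Lambda> / (norm V)\<^sup>2)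
                       * herm ((A x - conj_transpose (A x)) *v V) V'
                       * complex_of_real (Re (herm V V'))
                     - complex_of_real (\<Lambda>\<^sup>2 / (norm V)^4)
                       * herm (A x *v V) V
                       * complex_of_real ((Re (herm V V'))\<^sup>2))) = efun a b A v"
    (is "Re (LINT x:_|_. ?F x) = _")
proof -
  define U where "U x = (if v x = 0 then 0 else radial (0 * Lambda \<phi> (norm (v x))) (v x) (vector_derivative v (at x)))" for x
  define R where "R x = (if v x = 0 then 0 else radial (1 * Lambda \<phi> (norm (v x))) (v x) (vector_derivative v (at x)))" for x
  have bU: "bounded_test_field (einterval a b) U" and bR: "bounded_test_field (einterval a b) R"
    unfolding U_def R_def by (intro tame_bounded_test_field tame; simp)+
  have int: "set_integrable lebesgue (einterval a b) (\<lambda>x. herm (A x *v X x) (Y x))"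
    if "X \<in> {U, R}" "Y \<in> {U, R}" for X Y
    using that bU bR herm_integrable[OF A] by auto
  have int_cnj: "set_integrable lebesgue (einterval a b) (\<lambda>x. cnj (f x))"
    if "set_integrable lebesgue (einterval a b) f" for f
    using that unfolding set_integrable_def by (simp flip: complex_cnj_scaleR)
  define P where "P x = R x - U x" for x
  \<comment> \<open>Coefficients such as \<Lambda> / |v|^2 can be singular at the zeros of v.
    Writing p v as the difference R - U of bounded fields turns every term into a pairing of
    \<open>A\<close> with \<open>U\<close> and \<open>R\<close>, up to conjugation.\<close>
  have F: "?F x = herm (A x *v U x) (U x) + (herm (A x *v R x) (U x) - herm (A x *v U x) (U x))
      - cnj (herm (A x *v U x) (R x) - herm (A x *v U x) (U x))
      - (herm (A x *v R x) (R x) - herm (A x *v R x) (U x) - herm (A x *v U x) (R x) + herm (A x *v U x) (U x))" for x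
  proof (cases "v x = 0")
    case False
    define p where "p = Lambda \<phi> (norm (v x)) * (v x \<bullet> vector_derivative v (at x)) / (norm (v x))\<^sup>2"
    have R: "R x = U x + p *\<^sub>R v x" and Ux: "U x = vector_derivative v (at x)"
      using False by (simp_all add: R_def U_def radial_def p_def)
    have ct: "herm (conj_transpose M *v X) Y = cnj (herm (M *v Y) X)" for M X Y
      by (simp add: herm_conj_transpose herm_cnj)
    have "?F x = herm (A x *v U x) (U x) + p * herm ((A x - conj_transpose (A x)) *v v x) (U x) - p\<^sup>2 * herm (A x *v v x) (v x)"
      using False by (simp add: Ux p_def Re_herm_eq_inner power_divide power_mult_distrib Let_def mult_ac flip: power_mult)
    also have "\<dots> = herm (A x *v U x) (U x) + p * (herm (A x *v v x) (U x) - cnj (herm (A x *v U x) (v x))) - p\<^sup>2 * herm (A x *v v x) (v x)"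
      by (simp add: matrix_vector_mult_diff_rdistrib herm_diff_left ct)
    finally show ?thesis
      by (simp add: R matrix_vector_right_distrib matrix_vector_scaleR herm_add_left herm_add_right herm_scaleR_left
          herm_scaleR_right algebra_simps power2_eq_square)
  qed (simp add: U_def R_def)
  have intF: "set_integrable lebesgue (einterval a b) ?F"
    unfolding F by (intro set_integral_add set_integral_diff int int_cnj) auto
  have "Re (?F x) = Re (eterm A v x)" for x
    by (simp add: eterm_def Re_ellform_expand Let_def)
  then show ?thesis
    using Re_set_integral(2)[OF intF] by (simp add: efun_def)
qed

end

subsection \<open>Reduction to a single integral functional\<close>

lemma strong_Phi_elliptic_iff:
  "strong_Phi_elliptic \<phi> a b A \<longleftrightarrow>
    (\<exists>\<kappa>>0. \<forall>\<xi> \<omega>. norm \<omega> = 1 \<longrightarrow> (\<forall>t>0. AE x in lebesgue. x \<in> einterval a b \<longrightarrow>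
        \<kappa> * (norm \<xi>)\<^sup>2 \<le> Re (ellform (A x) (Lambda \<phi> t) \<omega> \<xi> \<xi>)))"
  unfolding strong_Phi_elliptic_def by (simp add: Re_ellform_expand cong: conj_cong)

text \<open>For |\<omega>| = 1 the weak expression is q^2 times the strong form, because the real
  part of the adjoint term swaps the two vectors. So q = 1 gives one direction and multiplication by
  q^2 the other.\<close>

lemma weak_Phi_elliptic_iff_strong: "weak_Phi_elliptic \<phi> a b A \<longleftrightarrow> strong_Phi_elliptic \<phi> a b A"
proof -
  have ct: "Re (herm (conj_transpose M *v X) Y) = Re (herm (M *v Y) X)" for M :: "complex^'n^'n" and X Y
    by (metis herm_conj_transpose Re_herm_eq_inner inner_commute)
  have eq: "Re (herm ((q\<^sup>2 *\<^sub>R A x) *v \<eta>) \<eta>)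
        - (Lambda \<phi> t)\<^sup>2 * Re (herm ((q\<^sup>2 *\<^sub>R A x) *v \<omega>) \<omega>) * (Re (herm \<eta> \<omega>))\<^sup>2
        + Lambda \<phi> t * Re (herm ((q\<^sup>2 *\<^sub>R A x) *v \<omega>) \<eta> - herm ((q\<^sup>2 *\<^sub>R A x) *v \<eta>) \<omega>) * Re (herm \<eta> \<omega>)
     = q\<^sup>2 * Re (ellform (A x) (Lambda \<phi> t) \<omega> \<eta> \<eta>)"
    if "norm \<omega> = 1" for q \<eta> \<omega> t x
  proof -
    have c: "Re (herm \<omega> \<eta>) = Re (herm \<eta> \<omega>)" by (simp add: Re_herm_eq_inner inner_commute)
    show ?thesis
      using that
      by (simp add: Re_ellform_expand scaleR_matrix_vector herm_scaleR_left matrix_vector_mult_diff_rdistrib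
          herm_diff_left ct c algebra_simps flip: of_real_power)
  qed
  show ?thesis
  proof
    assume "weak_Phi_elliptic \<phi> a b A"
    then obtain \<kappa> where \<kappa>: "\<kappa> > 0" and w: "\<And>q \<eta> \<omega> t. norm \<omega> = 1 \<Longrightarrow> t > 0 \<Longrightarrow> AE x in lebesgue. x \<in> einterval a b \<longrightarrow>
        \<kappa> * q\<^sup>2 * (norm \<eta>)\<^sup>2 \<le> q\<^sup>2 * Re (ellform (A x) (Lambda \<phi> t) \<omega> \<eta> \<eta>)"
      unfolding weak_Phi_elliptic_def using eq by auto
    show "strong_Phi_elliptic \<phi> a b A"
      unfolding strong_Phi_elliptic_iff
    proof (intro exI[of _ \<kappa>] conjI \<kappa> allI impI)
      fix \<xi> \<omega> :: "complex^'a" and t :: real assume "norm \<omega> = 1" "t > 0"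
      from w[OF this, of 1 \<xi>] show "AE x in lebesgue. x \<in> einterval a b \<longrightarrow>
        \<kappa> * (norm \<xi>)\<^sup>2 \<le> Re (ellform (A x) (Lambda \<phi> t) \<omega> \<xi> \<xi>)" by simp
    qed
  next
    assume "strong_Phi_elliptic \<phi> a b A"
    then obtain \<kappa> where \<kappa>: "\<kappa> > 0" and w: "\<And>\<xi> \<omega> t. norm \<omega> = 1 \<Longrightarrow> t > 0 \<Longrightarrow> AE x in lebesgue. x \<in> einterval a b \<longrightarrow>
        \<kappa> * (norm \<xi>)\<^sup>2 \<le> Re (ellform (A x) (Lambda \<phi> t) \<omega> \<xi> \<xi>)"
      unfolding strong_Phi_elliptic_iff by blast
    show "weak_Phi_elliptic \<phi> a b A"
      unfolding weak_Phi_elliptic_def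
    proof (intro exI[of _ \<kappa>] conjI \<kappa> allI impI)
      fix q :: real and \<eta> \<omega> :: "complex^'a" and t :: real assume *: "norm \<omega> = 1" "t > 0"
      show "AE x in lebesgue. x \<in> einterval a b \<longrightarrow>
        Re (herm ((q\<^sup>2 *\<^sub>R A x) *v \<eta>) \<eta>)
        - (Lambda \<phi> t)\<^sup>2 * Re (herm ((q\<^sup>2 *\<^sub>R A x) *v \<omega>) \<omega>) * (Re (herm \<eta> \<omega>))\<^sup>2
        + Lambda \<phi> t * Re (herm ((q\<^sup>2 *\<^sub>R A x) *v \<omega>) \<eta> - herm ((q\<^sup>2 *\<^sub>R A x) *v \<eta>) \<omega>) * Re (herm \<eta> \<omega>)
        \<ge> \<kappa> * q\<^sup>2 * (norm \<eta>)\<^sup>2"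
        using w[OF *, of \<eta>] unfolding eq[OF *(1)]
      proof eventually_elim
        case (elim x)
        show ?case
        proof
          assume "x \<in> einterval a b"
          with elim have "q\<^sup>2 * (\<kappa> * (norm \<eta>)\<^sup>2) \<le> q\<^sup>2 * Re (ellform (A x) (Lambda \<phi> t) \<omega> \<eta> \<eta>)"
            by (intro mult_left_mono) auto
          then show "\<kappa> * q\<^sup>2 * (norm \<eta>)\<^sup>2 \<le> q\<^sup>2 * Re (ellform (A x) (Lambda \<phi> t) \<omega> \<eta> \<eta>)"
            by (simp add: mult_ac)
        qed
      qed
    qed
  qed
qed

context bounded_Lambda
begin

text \<open>The map \<open>vmap\<close> is a bijection with inverse \<open>ulift\<close>, so
  quantifying over u amounts to quantifying over v. The predicate \<open>Q\<close> stays abstract to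
  serve plain and strict dissipativity alike.\<close>

lemma LPhi_test_iff:
  "(\<forall>u \<in> C1_compact_support_vec a b.
        (\<lambda>x. \<phi> (norm (u x)) *\<^sub>R u x) \<in> C1_compact_support_vec a b \<longrightarrow>
          Q u (\<lambda>x. \<phi> (norm (u x)) *\<^sub>R u x) (\<lambda>x. sqrt (\<phi> (norm (u x))) *\<^sub>R u x)) \<longleftrightarrow>
   (\<forall>v. ulift v \<in> C1_compact_support_vec a b \<longrightarrow> wlift v \<in> C1_compact_support_vec a b \<longrightarrow>
          Q (ulift v) (wlift v) v)" (is "?L \<longleftrightarrow> ?R")
proof
  assume L: ?L
  show ?R
  proof (intro allI impI)
    fix v :: "real \<Rightarrow> complex^'a"
    assume v: "ulift v \<in> C1_compact_support_vec a b" "wlift v \<in> C1_compact_support_vec a b"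
    have eq: "(\<lambda>x. \<phi> (norm (ulift v x)) *\<^sub>R ulift v x) = wlift v" "(\<lambda>x. sqrt (\<phi> (norm (ulift v x))) *\<^sub>R ulift v x) = v"
      using vmap_ulift[of v] by (auto simp: phi_ulift vmap_def)
    show "Q (ulift v) (wlift v) v"
      using L[rule_format, OF v(1), unfolded eq] v(2) by simp
  qed
next
  assume R: ?R
  show ?L
  proof (intro ballI impI)
    fix u :: "real \<Rightarrow> complex^'a"
    assume u: "u \<in> C1_compact_support_vec a b" "(\<lambda>x. \<phi> (norm (u x)) *\<^sub>R u x) \<in> C1_compact_support_vec a b"
    have eq: "ulift (vmap u) = u" "wlift (vmap u) = (\<lambda>x. \<phi> (norm (u x)) *\<^sub>R u x)"
      using phi_ulift[of "vmap u"] by (auto simp: ulift_vmap fun_eq_iff)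
    show "Q u (\<lambda>x. \<phi> (norm (u x)) *\<^sub>R u x) (\<lambda>x. sqrt (\<phi> (norm (u x))) *\<^sub>R u x)"
      using R[rule_format, of "vmap u", unfolded eq] u by (simp add: vmap_def[abs_def])
  qed
qed

lemma LPhi_dissipative_iff:
  fixes A :: "real \<Rightarrow> complex^'m^'m"
  assumes A: "\<And>i j. (\<lambda>x. A x $ i $ j) \<in> L1_loc a b"
  shows "LPhi_dissipative \<phi> a b A \<longleftrightarrow>
    (\<forall>v. ulift v \<in> C1_compact_support_vec a b \<longrightarrow> wlift v \<in> C1_compact_support_vec a b \<longrightarrow> efun a b A v \<ge> 0)"
  unfolding LPhi_dissipative_def
    LPhi_test_iff[of a b "\<lambda>u w v. Re (LINT x:einterval a b|lebesgue.
              herm (A x *v vector_derivative u (at x)) (vector_derivative w (at x))) \<ge> 0"]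
  using dissipativity_integral[OF A] by simp

lemma strict_LPhi_dissipative_iff:
  fixes A :: "real \<Rightarrow> complex^'m^'m"
  assumes A: "\<And>i j. (\<lambda>x. A x $ i $ j) \<in> L1_loc a b"
  shows "strict_LPhi_dissipative \<phi> a b A \<longleftrightarrow> (\<exists>\<kappa>>0.
    (\<forall>v. ulift v \<in> C1_compact_support_vec a b \<longrightarrow> wlift v \<in> C1_compact_support_vec a b \<longrightarrow>
      efun a b A v \<ge> \<kappa> * energy a b v))"
proof -
  have "(\<forall>u \<in> C1_compact_support_vec a b.
        (\<lambda>x. \<phi> (norm (u x)) *\<^sub>R u x) \<in> C1_compact_support_vec a b \<longrightarrow>
        Re (LINT x:einterval a b|lebesgue.
              herm (A x *v vector_derivative u (at x))
                   (vector_derivative (\<lambda>y. \<phi> (norm (u y)) *\<^sub>R u y) (at x)))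
        \<ge> \<kappa> * (LINT x:einterval a b|lebesgue.
              (norm (vector_derivative (\<lambda>y. sqrt (\<phi> (norm (u y))) *\<^sub>R u y) (at x)))\<^sup>2)) \<longleftrightarrow>
     (\<forall>v. ulift v \<in> C1_compact_support_vec a b \<longrightarrow> wlift v \<in> C1_compact_support_vec a b \<longrightarrow>
      efun a b A v \<ge> \<kappa> * energy a b v)" for \<kappa>
    using LPhi_test_iff[of a b "\<lambda>u w v. Re (LINT x:einterval a b|lebesgue.
              herm (A x *v vector_derivative u (at x)) (vector_derivative w (at x))) \<ge>
         \<kappa> * (LINT x:einterval a b|lebesgue. (norm (vector_derivative v (at x)))\<^sup>2)"]
    using dissipativity_integral[OF A] by (simp add: energy_def)
  then show ?thesis unfolding strict_LPhi_dissipative_def by simp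
qed

lemma integral_Phi_elliptic_iff:
  fixes A :: "real \<Rightarrow> complex^'m^'m"
  assumes A: "\<And>i j. (\<lambda>x. A x $ i $ j) \<in> L1_loc a b"
  shows "integral_Phi_elliptic \<phi> a b A \<longleftrightarrow>
    (\<exists>\<kappa>>0. \<forall>v\<in>C1_compact_support_vec a b. efun a b A v \<ge> \<kappa> * energy a b v)"
  unfolding integral_Phi_elliptic_def energy_def
  using ellipticity_integral[OF A C1_compact_support_vec_tame] by (auto cong: conj_cong)

text \<open>The shift removes at most \<kappa> and at least \<kappa> (1 - lam^2) times the energy.
  Hence one direction keeps \<kappa> and the other returns \<kappa> (1 - lam^2).\<close>

lemma strict_iff_shifted_dissipative:
  fixes A :: "real \<Rightarrow> complex^'m^'m"
  assumes A: "\<And>i j. (\<lambda>x. A x $ i $ j) \<in> L1_loc a b"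
  shows "strict_LPhi_dissipative \<phi> a b A \<longleftrightarrow>
     (\<exists>\<kappa>>0. LPhi_dissipative \<phi> a b (\<lambda>x. A x - mat (complex_of_real \<kappa>)))"
proof -
  have Ak: "(\<lambda>x. (A x - mat (complex_of_real \<kappa>)) $ i $ j) \<in> L1_loc a b" for \<kappa> i j
    using A[of i j] L1_loc_const[of "mat (complex_of_real \<kappa>) $ i $ j" a b] by (auto simp: L1_loc_def)
  have ef: "efun a b (\<lambda>x. A x - mat (complex_of_real \<kappa>)) v = efun a b A v - \<kappa> * efun a b (\<lambda>_. mat 1) v"
    if "ulift v \<in> C1_compact_support_vec a b" "wlift v \<in> C1_compact_support_vec a b" for v \<kappa>
    by (rule efun_diff_mat[OF A lifts_tame(1)[OF that]])
  have lam2: "1 - lam\<^sup>2 > 0" using lam lam_nonneg by (simp add: abs_square_less_1)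
  show ?thesis
    unfolding strict_LPhi_dissipative_iff[OF A] LPhi_dissipative_iff[OF Ak]
  proof safe
    fix \<kappa> :: real assume \<kappa>: "\<kappa> > 0" and *: "\<forall>v. ulift v \<in> C1_compact_support_vec a b \<longrightarrow> wlift v \<in> C1_compact_support_vec a b \<longrightarrow>
      efun a b A v \<ge> \<kappa> * energy a b v"
    show "\<exists>\<kappa>>0. \<forall>v. ulift v \<in> C1_compact_support_vec a b \<longrightarrow> wlift v \<in> C1_compact_support_vec a b \<longrightarrow>
       efun a b (\<lambda>x. A x - mat (complex_of_real \<kappa>)) v \<ge> 0"
    proof (intro exI[of _ \<kappa>] conjI \<kappa> allI impI)
      fix v :: "real \<Rightarrow> complex^'m" assume v: "ulift v \<in> C1_compact_support_vec a b" "wlift v \<in> C1_compact_support_vec a b"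
      have "\<kappa> * efun a b (\<lambda>_. mat 1) v \<le> \<kappa> * energy a b v"
        using \<kappa> efun_mat_1_bounds(2)[OF lifts_tame(1)[OF v]] by simp
      then show "efun a b (\<lambda>x. A x - mat (complex_of_real \<kappa>)) v \<ge> 0"
        using * v ef[OF v] by force
    qed
  next
    fix \<kappa> :: real assume \<kappa>: "\<kappa> > 0" and *: "\<forall>v. ulift v \<in> C1_compact_support_vec a b \<longrightarrow> wlift v \<in> C1_compact_support_vec a b \<longrightarrow>
      efun a b (\<lambda>x. A x - mat (complex_of_real \<kappa>)) v \<ge> 0"
    show "\<exists>\<kappa>>0. \<forall>v. ulift v \<in> C1_compact_support_vec a b \<longrightarrow> wlift v \<in> C1_compact_support_vec a b \<longrightarrow>
       efun a b A v \<ge> \<kappa> * energy a b v"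
    proof (intro exI[of _ "\<kappa> * (1 - lam\<^sup>2)"] conjI allI impI)
      show "\<kappa> * (1 - lam\<^sup>2) > 0" using \<kappa> lam2 by simp
      fix v :: "real \<Rightarrow> complex^'m" assume v: "ulift v \<in> C1_compact_support_vec a b" "wlift v \<in> C1_compact_support_vec a b"
      have "\<kappa> * ((1 - lam\<^sup>2) * energy a b v) \<le> \<kappa> * efun a b (\<lambda>_. mat 1) v"
        using \<kappa> efun_mat_1_bounds(1)[OF lifts_tame(1)[OF v]] by simp
      then show "efun a b A v \<ge> \<kappa> * (1 - lam\<^sup>2) * energy a b v"
        using * v ef[OF v, of \<kappa>] by (force simp: mult.assoc)
    qed
  qed
qed

text \<open>The exceptional null set depends on (\<xi>, \<omega>, t). A countable dense set of
  parameters makes it uniform, and continuity of the form recovers the remaining ones. The weight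
  \<open>h\<close> accommodates inequalities known only at the point-dependent argument h(x)
  t.\<close>

lemma AE_all_parameters:
  fixes A :: "real \<Rightarrow> complex^'m^'m"
  assumes AE: "\<And>\<xi> \<omega> t. norm \<omega> = 1 \<Longrightarrow> t > 0 \<Longrightarrow>
       AE x in lebesgue. x \<in> S \<longrightarrow> \<kappa> * (norm \<xi>)\<^sup>2 \<le> Re (ellform (A x) (Lambda \<phi> (h x * t)) \<omega> \<xi> \<xi>)"
    and h: "\<And>x. x \<in> S \<Longrightarrow> h x > 0"
  shows "AE x in lebesgue. x \<in> S \<longrightarrow>
      (\<forall>\<xi> V t. V \<noteq> 0 \<longrightarrow> t > 0 \<longrightarrow> \<kappa> * (norm \<xi>)\<^sup>2 \<le> Re (ellform (A x) (Lambda \<phi> t) V \<xi> \<xi>))"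
proof -
  define P :: "((complex^'m) \<times> (complex^'m) \<times> real) set" where "P = {(\<xi>, \<omega>, t). norm \<omega> = 1 \<and> t > 0}"
  \<comment> \<open>\<open>T\<close> is dense in \<open>P\<close> and contained in it, so |\<omega>|
    = 1 and t > 0 hold exactly along approximating sequences.\<close>
  obtain T where T: "countable T" "T \<subseteq> P" "P \<subseteq> closure T" using separable by blast
  have "AE x in lebesgue. \<forall>p\<in>T. x \<in> S \<longrightarrow>
      (case p of (\<xi>, \<omega>, t) \<Rightarrow> \<kappa> * (norm \<xi>)\<^sup>2 \<le> Re (ellform (A x) (Lambda \<phi> (h x * t)) \<omega> \<xi> \<xi>))"
    using AE T(2) by (subst AE_ball_countable[OF T(1)]) (auto simp: P_def)
  then show ?thesis
  proof eventually_elim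
    case (elim x)
    show ?case
    proof (intro impI allI)
      fix \<xi> V :: "complex^'m" and t :: real assume x: "x \<in> S" and V: "V \<noteq> 0" and t: "t > 0"
      define \<omega> where "\<omega> = (1 / norm V) *\<^sub>R V"
      \<comment> \<open>For fixed x this parameter makes the argument h(x) s of \<Lambda> equal to
        t.\<close>
      define s where "s = t / h x"
      have \<omega>: "norm \<omega> = 1" and s: "s > 0" using V t h[OF x] by (auto simp: \<omega>_def s_def)
      then have "(\<xi>, \<omega>, s) \<in> closure T" using T(3) by (auto simp: P_def)
      then obtain p where p: "\<And>n. p n \<in> T" "p \<longlonglongrightarrow> (\<xi>, \<omega>, s)" unfolding closure_sequential by auto
      define \<xi>' \<omega>' s' where "\<xi>' n = fst (p n)" and "\<omega>' n = fst (snd (p n))" and "s' n = snd (snd (p n))" for n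
      have lims: "\<xi>' \<longlonglongrightarrow> \<xi>" "\<omega>' \<longlonglongrightarrow> \<omega>" "s' \<longlonglongrightarrow> s"
        using p(2) tendsto_fst[OF p(2)] tendsto_fst[OF tendsto_snd[OF p(2)]] tendsto_snd[OF tendsto_snd[OF p(2)]]
        by (simp_all add: \<xi>'_def[abs_def] \<omega>'_def[abs_def] s'_def[abs_def])
      have "\<kappa> * (norm (\<xi>' n))\<^sup>2 \<le> Re (ellform (A x) (Lambda \<phi> (h x * s' n)) (\<omega>' n) (\<xi>' n) (\<xi>' n))" for n
        using elim p(1)[of n] x by (auto simp: \<xi>'_def \<omega>'_def s'_def split: prod.splits)
      moreover have "(\<lambda>n. Lambda \<phi> (h x * s' n)) \<longlonglongrightarrow> Lambda \<phi> (h x * s)"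
        by (rule isCont_tendsto_compose[OF isCont_Lambda]) (use s h[OF x] lims in \<open>auto intro!: tendsto_intros\<close>)
      then have "(\<lambda>n. Re (ellform (A x) (Lambda \<phi> (h x * s' n)) (\<omega>' n) (\<xi>' n) (\<xi>' n)))
          \<longlonglongrightarrow> Re (ellform (A x) (Lambda \<phi> (h x * s)) \<omega> \<xi> \<xi>)"
        using \<omega> by (intro tendsto_Re tendsto_ellform lims) auto
      moreover have "(\<lambda>n. \<kappa> * (norm (\<xi>' n))\<^sup>2) \<longlonglongrightarrow> \<kappa> * (norm \<xi>)\<^sup>2"
        by (intro tendsto_intros lims)
      ultimately have "\<kappa> * (norm \<xi>)\<^sup>2 \<le> Re (ellform (A x) (Lambda \<phi> (h x * s)) \<omega> \<xi> \<xi>)"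
        by (intro LIMSEQ_le[of "\<lambda>n. \<kappa> * (norm (\<xi>' n))\<^sup>2"]) auto
      then show "\<kappa> * (norm \<xi>)\<^sup>2 \<le> Re (ellform (A x) (Lambda \<phi> t) V \<xi> \<xi>)"
        using V h[OF x] by (simp add: s_def \<omega>_def ellform_scaleR)
    qed
  qed
qed

section \<open>Integrating the strong condition\<close>

lemma strong_imp_efun_ge_energy:
  fixes A :: "real \<Rightarrow> complex^'m^'m"
  assumes A: "\<And>i j. (\<lambda>x. A x $ i $ j) \<in> L1_loc a b"
    and "strong_Phi_elliptic \<phi> a b A"
  shows "\<exists>\<kappa>>0. \<forall>v. tame a b v \<longrightarrow> efun a b A v \<ge> \<kappa> * energy a b v"
proof -
  obtain \<kappa> where \<kappa>: "\<kappa> > 0" and w: "\<And>\<xi> \<omega> t. norm \<omega> = 1 \<Longrightarrow> t > 0 \<Longrightarrow> AE x in lebesgue. x \<in> einterval a b \<longrightarrow>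
        \<kappa> * (norm \<xi>)\<^sup>2 \<le> Re (ellform (A x) (Lambda \<phi> t) \<omega> \<xi> \<xi>)"
    using assms(2) unfolding strong_Phi_elliptic_iff by blast
  have AE: "AE x in lebesgue. x \<in> einterval a b \<longrightarrow>
      (\<forall>\<xi> V t. V \<noteq> 0 \<longrightarrow> t > 0 \<longrightarrow> \<kappa> * (norm \<xi>)\<^sup>2 \<le> Re (ellform (A x) (Lambda \<phi> t) V \<xi> \<xi>))"
    by (rule AE_all_parameters[where h = "\<lambda>_. 1"]) (use w in simp_all)
  show ?thesis
  proof (intro exI[of _ \<kappa>] conjI \<kappa> allI impI)
    fix v :: "real \<Rightarrow> complex^'m" assume tame: "tame a b v"
    have z: "AE x in lebesgue. x \<in> einterval a b \<longrightarrow> v x = 0 \<longrightarrow> vector_derivative v (at x) = 0"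
      using tame by (simp add: tame_def Let_def)
    have "(LINT x:einterval a b|lebesgue. \<kappa> * (norm (vector_derivative v (at x)))\<^sup>2) \<le> efun a b A v"
      unfolding efun_def
    proof (rule set_integral_mono_AE_lebesgue)
      show "AE x in lebesgue. x \<in> einterval a b \<longrightarrow> \<kappa> * (norm (vector_derivative v (at x)))\<^sup>2 \<le> Re (eterm A v x)"
        using z AE by eventually_elim (auto simp: eterm_def)
    qed (use tame_energy_integrable[OF tame] Re_set_integral(1)[OF eterm_integrable[OF A tame]] in simp_all)
    then show "efun a b A v \<ge> \<kappa> * energy a b v" by (simp add: energy_def)
  qed
qed

end

subsection \<open>Test functions vanishing at high order\<close>

lemma has_vector_derivative_zero_powr:
  fixes f :: "real \<Rightarrow> 'a::real_normed_vector"
  assumes bd: "\<And>y. norm (f y - f x) \<le> C * \<bar>y - x\<bar> powr (1 + \<delta>)" and \<delta>: "\<delta> > 0"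
  shows "(f has_vector_derivative 0) (at x)"
proof -
  have lim: "((\<lambda>y. C * \<bar>y - x\<bar> powr \<delta>) \<longlongrightarrow> C * 0) (at x)"
    using \<delta> by (intro tendsto_mult_left tendsto_zero_powrI[where b = \<delta>]) (auto intro!: tendsto_eq_intros)
  have "((\<lambda>y. norm (f y - f x) / \<bar>y - x\<bar>) \<longlongrightarrow> 0) (at x)"
  proof (rule tendsto_sandwich[OF _ _ tendsto_const])
    show "((\<lambda>y. C * \<bar>y - x\<bar> powr \<delta>) \<longlongrightarrow> 0) (at x)" using lim by simp
    show "\<forall>\<^sub>F y in at x. norm (f y - f x) / \<bar>y - x\<bar> \<le> C * \<bar>y - x\<bar> powr \<delta>"
      using bd by (auto simp: eventually_at_filter powr_add divide_simps mult_ac)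
  qed auto
  then show ?thesis by (simp add: has_vector_derivative_def has_derivative_iff_norm)
qed

text \<open>Regularity is in question only at the endpoints. Decay of f of order 1 + \<delta> makes
  the derivative of the extension by 0 vanish there, and decay of \<open>D\<close> of order \<delta>
  makes that derivative continuous.\<close>

lemma C1_compact_support_of_decay:
  fixes f :: "real \<Rightarrow> complex^'m"
  assumes I: "{\<alpha>..\<beta>} \<subseteq> einterval a b"
    and D: "\<And>x. \<alpha> < x \<Longrightarrow> x < \<beta> \<Longrightarrow> (f has_vector_derivative D x) (at x)"
    and contD: "continuous_on {\<alpha><..<\<beta>} D"
    and f0: "\<And>x. \<not> (\<alpha> < x \<and> x < \<beta>) \<Longrightarrow> f x = 0"
    and fb: "\<And>x. \<alpha> < x \<Longrightarrow> x < \<beta> \<Longrightarrow> norm (f x) \<le> C * ((x - \<alpha>) * (\<beta> - x)) powr (1 + \<delta>)"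
    and Db: "\<And>x. \<alpha> < x \<Longrightarrow> x < \<beta> \<Longrightarrow> norm (D x) \<le> C * ((x - \<alpha>) * (\<beta> - x)) powr \<delta>"
    and \<delta>: "\<delta> > 0" and C: "C \<ge> 0"
  shows "f \<in> C1_compact_support_vec a b"
proof -
  define D' where "D' x = (if \<alpha> < x \<and> x < \<beta> then D x else 0)" for x
  \<comment> \<open>A point x outside the open interval lies at or beyond an endpoint, so one factor
    of (y - \<alpha>) (\<beta> - y) is at most |y - x| and the other at most \<beta> -
    \<alpha>.\<close>
  have dist: "((y - \<alpha>) * (\<beta> - y)) powr r \<le> \<bar>\<beta> - \<alpha>\<bar> powr r * \<bar>y - x\<bar> powr r"
    if "\<alpha> < y" "y < \<beta>" "\<not> (\<alpha> < x \<and> x < \<beta>)" "r > 0" for x y r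
  proof -
    have "(y - \<alpha>) * (\<beta> - y) \<le> \<bar>\<beta> - \<alpha>\<bar> * \<bar>y - x\<bar>"
    proof (cases "x \<le> \<alpha>")
      case True
      then have "(y - \<alpha>) * (\<beta> - y) \<le> \<bar>y - x\<bar> * \<bar>\<beta> - \<alpha>\<bar>" using that by (intro mult_mono) auto
      then show ?thesis by (simp add: mult.commute)
    next
      case False
      then show ?thesis using that by (intro mult_mono) auto
    qed
    then have "((y - \<alpha>) * (\<beta> - y)) powr r \<le> (\<bar>\<beta> - \<alpha>\<bar> * \<bar>y - x\<bar>) powr r"
      using that by (intro powr_mono2) auto
    then show ?thesis by (simp add: powr_mult)
  qed
  have der: "(f has_vector_derivative D' x) (at x)" for x
  proof (cases "\<alpha> < x \<and> x < \<beta>")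
    case True
    then show ?thesis using D by (simp add: D'_def)
  next
    case False
    have "(f has_vector_derivative 0) (at x)"
    proof (rule has_vector_derivative_zero_powr[OF _ \<delta>])
      show "norm (f y - f x) \<le> (C * \<bar>\<beta> - \<alpha>\<bar> powr (1 + \<delta>)) * \<bar>y - x\<bar> powr (1 + \<delta>)" for y
      proof (cases "\<alpha> < y \<and> y < \<beta>")
        case True
        have "norm (f y) \<le> C * ((y - \<alpha>) * (\<beta> - y)) powr (1 + \<delta>)" using fb True by simp
        also have "\<dots> \<le> C * (\<bar>\<beta> - \<alpha>\<bar> powr (1 + \<delta>) * \<bar>y - x\<bar> powr (1 + \<delta>))"
          using dist[of y x "1 + \<delta>"] True False \<delta> C by (intro mult_left_mono) auto
        finally show ?thesis using False by (simp add: f0 mult.assoc)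
      next
        case False': False
        then show ?thesis using False C by (simp add: f0)
      qed
    qed
    moreover have "D' x = 0" using False by (auto simp: D'_def)
    ultimately show ?thesis by simp
  qed
  have cont: "isCont D' x" for x
  proof (cases "\<alpha> < x \<and> x < \<beta>")
    case True
    have "continuous_on {\<alpha><..<\<beta>} D'"
      using contD by (rule continuous_on_cong[THEN iffD1, rotated 2]) (auto simp: D'_def)
    then show ?thesis using True by (auto simp: continuous_on_eq_continuous_at)
  next
    case False
    have "(D' \<longlongrightarrow> 0) (at x)"
    proof (rule Lim_null_comparison)
      show "\<forall>\<^sub>F y in at x. norm (D' y) \<le> (C * \<bar>\<beta> - \<alpha>\<bar> powr \<delta>) * \<bar>y - x\<bar> powr \<delta>"
      proof (intro always_eventually allI)
        fix y
        show "norm (D' y) \<le> (C * \<bar>\<beta> - \<alpha>\<bar> powr \<delta>) * \<bar>y - x\<bar> powr \<delta>"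
        proof (cases "\<alpha> < y \<and> y < \<beta>")
          case True
          have "norm (D y) \<le> C * ((y - \<alpha>) * (\<beta> - y)) powr \<delta>" using Db True by simp
          also have "\<dots> \<le> C * (\<bar>\<beta> - \<alpha>\<bar> powr \<delta> * \<bar>y - x\<bar> powr \<delta>)"
            using dist[of y x "\<delta>"] True False \<delta> C by (intro mult_left_mono) auto
          finally show ?thesis using True by (simp add: D'_def mult.assoc)
        qed (use C in \<open>auto simp: D'_def\<close>)
      qed
      have "((\<lambda>y. (C * \<bar>\<beta> - \<alpha>\<bar> powr \<delta>) * \<bar>y - x\<bar> powr \<delta>) \<longlongrightarrow> (C * \<bar>\<beta> - \<alpha>\<bar> powr \<delta>) * 0) (at x)"
        using \<delta> by (intro tendsto_mult_left tendsto_zero_powrI[where b = \<delta>]) (auto intro!: tendsto_eq_intros)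
      then show "((\<lambda>y. (C * \<bar>\<beta> - \<alpha>\<bar> powr \<delta>) * \<bar>y - x\<bar> powr \<delta>) \<longlongrightarrow> 0) (at x)" by simp
    qed
    moreover have "D' x = 0" using False by (auto simp: D'_def)
    ultimately show ?thesis by (simp add: isCont_def)
  qed
  show ?thesis
    unfolding C1_compact_support_vec_iff
  proof (intro conjI exI[of _ D'] exI[of _ "{\<alpha>..\<beta>}"] ballI)
    show "continuous_on (einterval a b) D'" using cont by (intro continuous_at_imp_continuous_on) auto
    show "f x = 0" if "x \<in> einterval a b - {\<alpha>..\<beta>}" for x using that by (intro f0) auto
  qed (use der I in auto)
qed

definition bump :: "nat \<Rightarrow> real \<Rightarrow> real \<Rightarrow> real \<Rightarrow> real" where
  "bump k \<alpha> \<beta> x = (if \<alpha> < x \<and> x < \<beta> then ((x - \<alpha>) * (\<beta> - x)) ^ k else 0)"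

lemma bump_pos: "\<alpha> < x \<Longrightarrow> x < \<beta> \<Longrightarrow> bump k \<alpha> \<beta> x > 0"
  by (simp add: bump_def)

lemma bump_deriv:
  assumes "\<alpha> < x" "x < \<beta>"
  shows "(bump k \<alpha> \<beta> has_real_derivative k * ((x - \<alpha>) * (\<beta> - x)) ^ (k - 1) * (\<alpha> + \<beta> - 2 * x)) (at x)"
proof -
  have "((\<lambda>x. ((x - \<alpha>) * (\<beta> - x)) ^ k) has_real_derivative
      k * ((x - \<alpha>) * (\<beta> - x)) ^ (k - 1) * (\<alpha> + \<beta> - 2 * x)) (at x)"
    by (auto intro!: derivative_eq_intros simp: algebra_simps)
  moreover have "\<forall>\<^sub>F y in nhds x. bump k \<alpha> \<beta> y = ((y - \<alpha>) * (\<beta> - y)) ^ k"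
    using eventually_nhds_in_open[of "{\<alpha><..<\<beta>}" x] assms by (auto elim!: eventually_mono simp: bump_def)
  ultimately show ?thesis by (simp add: DERIV_cong_ev)
qed

lemma bump_vector_derivative:
  fixes y :: "real \<Rightarrow> complex^'m"
  assumes "\<alpha> < x" "x < \<beta>" "(y has_vector_derivative y') (at x)"
  shows "((\<lambda>x. bump k \<alpha> \<beta> x *\<^sub>R y x) has_vector_derivative
     (bump k \<alpha> \<beta> x *\<^sub>R y' + (k * ((x - \<alpha>) * (\<beta> - x)) ^ (k - 1) * (\<alpha> + \<beta> - 2 * x)) *\<^sub>R y x)) (at x)"
  by (rule has_vector_derivative_scaleR[OF bump_deriv[OF assms(1,2)] assms(3)])

text \<open>Near the endpoints \<open>c(|v|)\<close> may blow up like \<open>|v| powr (-lam)\<close>; a bump of high enough order absorbs this.\<close>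

lemma bump_C1_compact_support:
  fixes y y' :: "real \<Rightarrow> complex^'m" and c l :: "real \<Rightarrow> real"
  assumes I: "{\<alpha>..\<beta>} \<subseteq> einterval a b"
    and y: "\<And>x. (y has_vector_derivative y' x) (at x)" "continuous_on UNIV y'"
    and y0: "\<And>x. \<alpha> \<le> x \<Longrightarrow> x \<le> \<beta> \<Longrightarrow> y x \<noteq> 0"
    and c: "\<And>t. t > 0 \<Longrightarrow> (c has_real_derivative (c t * l t / t)) (at t)" "\<And>t. t > 0 \<Longrightarrow> c t > 0"
    and l: "\<And>t. t > 0 \<Longrightarrow> \<bar>l t\<bar> \<le> lam" "continuous_on {0<..} l"
    and k: "k * (1 - lam) > 1" and lam: "0 \<le> lam"  "lam < 1"
    and \<alpha>\<beta>: "\<alpha> < \<beta>"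
  shows "(\<lambda>x. c (norm (bump k \<alpha> \<beta> x *\<^sub>R y x)) *\<^sub>R (bump k \<alpha> \<beta> x *\<^sub>R y x)) \<in> C1_compact_support_vec a b"
proof -
  define v where "v x = bump k \<alpha> \<beta> x *\<^sub>R y x" for x
  define d where "d x = (x - \<alpha>) * (\<beta> - x)" for x
  \<comment> \<open>The exponent balance: c(|v|) grows at most like d^(-k lam) and v' is of order
    d^(k - 1), so their product decays like d^\<delta>. The assumption on k says that \<delta> is
    positive.\<close>
  define \<delta> where "\<delta> = k * (1 - lam) - 1"
  define vd where "vd x = bump k \<alpha> \<beta> x *\<^sub>R y' x + (k * d x ^ (k - 1) * (\<alpha> + \<beta> - 2 * x)) *\<^sub>R y x" for x
  have k1: "k \<ge> 1" using k by (cases k) auto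
  have conty: "continuous_on UNIV y"
    using y(1) by (intro continuous_at_imp_continuous_on ballI has_vector_derivative_continuous) auto
  obtain M where M: "\<And>x. x \<in> {\<alpha>..\<beta>} \<Longrightarrow> norm (y x) \<le> M" "\<And>x. x \<in> {\<alpha>..\<beta>} \<Longrightarrow> norm (y' x) \<le> M" "M > 0"
  proof -
    have "bounded (y ` {\<alpha>..\<beta>})" "bounded (y' ` {\<alpha>..\<beta>})"
      by (intro compact_imp_bounded compact_continuous_image continuous_on_subset[OF conty] continuous_on_subset[OF y(2)]; simp)+
    then obtain B B' where "\<And>x. x \<in> {\<alpha>..\<beta>} \<Longrightarrow> norm (y x) \<le> B" "\<And>x. x \<in> {\<alpha>..\<beta>} \<Longrightarrow> norm (y' x) \<le> B'"
      unfolding bounded_iff by (metis imageI)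
    then show ?thesis by (intro that[of "max 1 (max B B')"]) (force simp: max_def)+
  qed
  \<comment> \<open>A positive lower bound for |y| makes |v| comparable to d^k, which turns a
    negative power of |v| into one of d.\<close>
  obtain m where m: "m > 0" "\<And>x. x \<in> {\<alpha>..\<beta>} \<Longrightarrow> m \<le> norm (y x)"
  proof -
    have "continuous_on {\<alpha>..\<beta>} (\<lambda>x. norm (y x))"
      by (intro continuous_intros continuous_on_subset[OF conty]) auto
    then obtain z where "z \<in> {\<alpha>..\<beta>}" "\<forall>x\<in>{\<alpha>..\<beta>}. norm (y z) \<le> norm (y x)"
      using continuous_attains_inf[of "{\<alpha>..\<beta>}" "\<lambda>x. norm (y x)"] \<alpha>\<beta> by auto
    then show ?thesis using y0[of z] by (intro that[of "norm (y z)"]) auto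
  qed
  define W where "W = \<beta> - \<alpha>"
  have W: "W > 0" using \<alpha>\<beta> by (simp add: W_def)
  have d: "d x > 0" "d x \<le> W * W" if "\<alpha> < x" "x < \<beta>" for x
    using that unfolding d_def W_def by (auto intro!: mult_pos_pos mult_mono)
  have bump: "bump k \<alpha> \<beta> x = d x ^ k" if "\<alpha> < x" "x < \<beta>" for x
    using that by (simp add: bump_def d_def)
  have v0: "v x \<noteq> 0" if "\<alpha> < x" "x < \<beta>" for x
    using that y0[of x] bump_pos[of \<alpha> x \<beta> k] by (simp add: v_def)
  have vder: "(v has_vector_derivative vd x) (at x)" if "\<alpha> < x" "x < \<beta>" for x
    unfolding v_def vd_def d_def by (rule bump_vector_derivative[OF that y(1)])
  \<comment> \<open>An upper bound for |v|, serving as reference point of the logarithmic derivative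
    estimate.\<close>
  define R where "R = (W * W) ^ k * M"
  have R: "norm (v x) \<le> R" if "\<alpha> < x" "x < \<beta>" for x
    unfolding v_def R_def using that d[OF that] M(1)[of x] by (auto simp: bump abs_mult intro!: mult_mono power_mono)
  have "R > 0" using W M(3) by (simp add: R_def)
  define Cc where "Cc = c R * R powr lam * m powr (-lam)"
  have Cc0: "Cc \<ge> 0" using c(2)[OF \<open>R > 0\<close>] by (simp add: Cc_def)
  have cb: "c (norm (v x)) \<le> Cc * (d x ^ k) powr (- lam)" if x: "\<alpha> < x" "x < \<beta>" for x
  proof -
    have 1: "c (norm (v x)) \<le> c R * R powr lam * norm (v x) powr (-lam)"
      by (rule logarithmic_derivative_bound[OF c l(1)]) (use v0[OF x] R[OF x] in auto)
    have "norm (v x) powr (-lam) \<le> (d x ^ k * m) powr (-lam)"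
    proof (rule powr_mono2')
      show "d x ^ k * m \<le> norm (v x)"
        unfolding v_def using x d[OF x] m(2)[of x] by (auto simp: bump intro!: mult_left_mono)
    qed (use d[OF x] m lam in auto)
    also have "(d x ^ k * m) powr (-lam) = (d x ^ k) powr (-lam) * m powr (-lam)"
      by (rule powr_mult)
    finally have 2: "c R * R powr lam * norm (v x) powr (-lam) \<le> c R * R powr lam * ((d x ^ k) powr (-lam) * m powr (-lam))"
      using c(2)[OF \<open>R > 0\<close>] by (intro mult_left_mono) auto
    show ?thesis using order_trans[OF 1 2] by (simp add: Cc_def mult_ac)
  qed
  \<comment> \<open>The two summands come from the product rule, with d^k \<le> W^2 d^(k - 1) and
    |\<alpha> + \<beta> - 2 x| \<le> W.\<close>
  define C1 where "C1 = W * W * M + k * W * M"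
  have C10: "C1 \<ge> 0" using W M by (simp add: C1_def)
  have vdb: "norm (vd x) \<le> C1 * d x ^ (k - 1)" if x: "\<alpha> < x" "x < \<beta>" for x
  proof -
    have "norm (bump k \<alpha> \<beta> x *\<^sub>R y' x) \<le> (W * W * d x ^ (k - 1)) * M"
    proof -
      have "d x ^ k = d x * d x ^ (k - 1)" using k1 by (cases k) auto
      also have "\<dots> \<le> W * W * d x ^ (k - 1)" using d[OF x] by (intro mult_right_mono) auto
      finally show ?thesis using x d[OF x] M(2)[of x] W by (auto simp: bump intro!: mult_mono)
    qed
    moreover have "norm ((k * d x ^ (k - 1) * (\<alpha> + \<beta> - 2 * x)) *\<^sub>R y x) \<le> (k * d x ^ (k - 1) * W) * M"
    proof -
      have "\<bar>\<alpha> + \<beta> - 2 * x\<bar> \<le> W" using x by (auto simp: W_def abs_le_iff)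
      then show ?thesis using d[OF x] M(1)[of x] x W by (auto simp: abs_mult intro!: mult_mono)
    qed
    ultimately have "norm (vd x) \<le> (W * W * d x ^ (k - 1)) * M + (k * d x ^ (k - 1) * W) * M"
      unfolding vd_def by (intro norm_triangle_le) linarith
    then show ?thesis by (simp add: C1_def algebra_simps)
  qed
  have pw: "(d x ^ k) powr (-lam) * d x ^ (k - 1) = d x powr \<delta>"
    "(d x ^ k) powr (-lam) * d x ^ k = d x powr (1 + \<delta>)" if x: "\<alpha> < x" "x < \<beta>" for x
  proof -
    have e: "d x ^ n = d x powr n" for n using d[OF x] by (simp add: powr_realpow)
    show "(d x ^ k) powr (-lam) * d x ^ (k - 1) = d x powr \<delta>"
      using k1 unfolding e powr_powr powr_add[symmetric] by (simp add: \<delta>_def of_nat_diff algebra_simps)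
    show "(d x ^ k) powr (-lam) * d x ^ k = d x powr (1 + \<delta>)"
      unfolding e powr_powr powr_add[symmetric] by (simp add: \<delta>_def algebra_simps)
  qed
  define C where "C = max (Cc * M) (Cc * (2 * C1))"
  have "(\<lambda>x. c (norm (v x)) *\<^sub>R v x) \<in> C1_compact_support_vec a b"
  proof (rule C1_compact_support_of_decay[OF I, where D = "\<lambda>x. c (norm (v x)) *\<^sub>R radial (l (norm (v x))) (v x) (vd x)"
        and \<delta> = \<delta> and C = C])
    show "((\<lambda>x. c (norm (v x)) *\<^sub>R v x) has_vector_derivative c (norm (v x)) *\<^sub>R radial (l (norm (v x))) (v x) (vd x)) (at x)"
      if "\<alpha> < x" "x < \<beta>" for x
      by (rule has_vector_derivative_radial[OF vder[OF that] v0[OF that] c(1)]) (use v0[OF that] in simp)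
    have contv: "continuous_on {\<alpha><..<\<beta>} v"
      using vder by (intro continuous_at_imp_continuous_on ballI has_vector_derivative_continuous) auto
    have contvd: "continuous_on {\<alpha><..<\<beta>} vd"
    proof -
      have "continuous_on {\<alpha><..<\<beta>} (bump k \<alpha> \<beta>)"
        using DERIV_isCont[OF bump_deriv] by (intro continuous_at_imp_continuous_on ballI) auto
      then show ?thesis unfolding vd_def d_def
        by (intro continuous_intros continuous_on_subset[OF conty] continuous_on_subset[OF y(2)]) auto
    qed
    have contf: "continuous_on {\<alpha><..<\<beta>} (\<lambda>x. g (norm (v x)))" if "continuous_on {0<..} g" for g :: "real \<Rightarrow> real"
      by (rule continuous_on_compose2[OF that continuous_on_norm[OF contv]]) (use v0 in auto)
    have contc: "continuous_on {0<..} c"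
      using DERIV_isCont[OF c(1)] by (intro continuous_at_imp_continuous_on ballI) auto
    show "continuous_on {\<alpha><..<\<beta>} (\<lambda>x. c (norm (v x)) *\<^sub>R radial (l (norm (v x))) (v x) (vd x))"
      by (intro continuous_on_scaleR continuous_on_radial contf contc l(2) contv contvd) (use v0 in auto)
    show "c (norm (v x)) *\<^sub>R v x = 0" if "\<not> (\<alpha> < x \<and> x < \<beta>)" for x
      using that by (auto simp: v_def bump_def)
    show "norm (c (norm (v x)) *\<^sub>R v x) \<le> C * ((x - \<alpha>) * (\<beta> - x)) powr (1 + \<delta>)" if x: "\<alpha> < x" "x < \<beta>" for x
    proof -
      have "norm (c (norm (v x)) *\<^sub>R v x) = c (norm (v x)) * norm (v x)"
        using c(2)[of "norm (v x)"] v0[OF x] by simp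
      also have "\<dots> \<le> (Cc * (d x ^ k) powr (- lam)) * (d x ^ k * M)"
      proof (intro mult_mono cb x)
        show "norm (v x) \<le> d x ^ k * M"
          unfolding v_def using d[OF x] M(1)[of x] x by (auto simp: bump intro!: mult_left_mono)
      qed (use Cc0 in auto)
      also have "\<dots> = Cc * M * d x powr (1 + \<delta>)" by (simp add: pw(2)[OF x, symmetric])
      also have "\<dots> \<le> C * d x powr (1 + \<delta>)" by (intro mult_right_mono) (auto simp: C_def)
      finally show ?thesis by (simp add: d_def)
    qed
    show "norm (c (norm (v x)) *\<^sub>R radial (l (norm (v x))) (v x) (vd x)) \<le> C * ((x - \<alpha>) * (\<beta> - x)) powr \<delta>"
      if x: "\<alpha> < x" "x < \<beta>" for x
    proof -
      have r: "norm (radial (l (norm (v x))) (v x) (vd x)) \<le> 2 * (C1 * d x ^ (k - 1))"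
      proof -
        have "norm (radial (l (norm (v x))) (v x) (vd x)) \<le> (1 + 1) * norm (vd x)"
          by (rule norm_radial_le) (use l(1)[of "norm (v x)"] v0[OF x] lam in auto)
        then show ?thesis using vdb[OF x] by simp
      qed
      have "norm (c (norm (v x)) *\<^sub>R radial (l (norm (v x))) (v x) (vd x)) = c (norm (v x)) * norm (radial (l (norm (v x))) (v x) (vd x))"
        using c(2)[of "norm (v x)"] v0[OF x] by simp
      also have "\<dots> \<le> (Cc * (d x ^ k) powr (- lam)) * (2 * (C1 * d x ^ (k - 1)))"
        by (intro mult_mono cb x r) (use Cc0 in auto)
      also have "\<dots> = Cc * (2 * C1) * d x powr \<delta>" by (simp add: pw(1)[OF x, symmetric])
      also have "\<dots> \<le> C * d x powr \<delta>" by (intro mult_right_mono) (auto simp: C_def)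
      finally show ?thesis by (simp add: d_def)
    qed
    show "\<delta> > 0" using k by (simp add: \<delta>_def)
    show "C \<ge> 0" using Cc0 M by (simp add: C_def le_max_iff_disj)
  qed
  then show ?thesis by (simp only: v_def)
qed

subsection \<open>From integrals against squared polynomials to pointwise bounds\<close>

lemma continuous_mult_absolutely_integrable:
  fixes f G :: "real \<Rightarrow> real"
  assumes f: "continuous_on {\<alpha>..\<beta>} f" and G: "G absolutely_integrable_on {\<alpha><..<\<beta>}"
  shows "(\<lambda>x. f x * G x) absolutely_integrable_on {\<alpha><..<\<beta>}"
proof (rule absolutely_integrable_bounded_measurable_product_real[OF _ _ _ G])
  have "continuous_on {\<alpha><..<\<beta>} f" by (rule continuous_on_subset[OF f]) auto
  then show "f \<in> borel_measurable (lebesgue_on {\<alpha><..<\<beta>})"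
    by (rule continuous_imp_measurable_on_sets_lebesgue) auto
  have "bounded (f ` {\<alpha>..\<beta>})"
    by (intro compact_imp_bounded compact_continuous_image f) auto
  then show "bounded (f ` {\<alpha><..<\<beta>})" by (rule bounded_subset) auto
qed auto

text \<open>The squared polynomials approximate the indicator functions of compact sets boundedly and pointwise.\<close>

lemma AE_nonneg_of_polynomial_squares:
  fixes G :: "real \<Rightarrow> real"
  assumes G: "G absolutely_integrable_on {\<alpha><..<\<beta>}"
    and pos: "\<And>p. real_polynomial_function p \<Longrightarrow> 0 \<le> integral {\<alpha><..<\<beta>} (\<lambda>x. (p x)\<^sup>2 * G x)"
  shows "AE x in lebesgue. x \<in> {\<alpha><..<\<beta>} \<longrightarrow> G x \<ge> 0"
proof (rule ccontr)
  define S where "S = {\<alpha><..<\<beta>}"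
  define N where "N = {x\<in>S. G x < 0}"
  assume contr: "\<not> ?thesis"
  have meas: "(\<lambda>x. indicator S x *\<^sub>R G x) \<in> borel_measurable lebesgue"
    using G by (auto simp: set_integrable_def S_def dest: borel_measurable_integrable)
  have "N = {x \<in> space lebesgue. indicator S x *\<^sub>R G x < 0}"
    by (auto simp: N_def indicator_def)
  then have N: "N \<in> sets lebesgue"
    using borel_measurable_less[OF meas borel_measurable_const, of 0] by simp
  have "N \<notin> null_sets lebesgue"
  proof
    assume "N \<in> null_sets lebesgue"
    then have "AE x in lebesgue. x \<in> S \<longrightarrow> G x \<ge> 0" by (rule AE_I'[of N]) (auto simp: N_def)
    then show False using contr by (simp add: S_def)
  qed
  then have Npos: "emeasure lebesgue N > 0" using N by (auto simp: null_sets_def zero_less_iff_neq_zero)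
  \<comment> \<open>Taking e below the measure of \<open>N\<close> ensures that a closed subset
    missing less than e cannot be null.\<close>
  obtain e :: real where e: "e > 0" "ennreal e < emeasure lebesgue N"
  proof -
    obtain r where "0 < r" "r < emeasure lebesgue N" using dense[OF Npos] by blast
    moreover from this have "r < top" using less_le_trans top_greatest by blast
    ultimately show ?thesis by (intro that[of "enn2real r"]) (simp_all add: enn2real_positive_iff ennreal_enn2real)
  qed
  obtain K where K: "closed K" "K \<subseteq> N" "N - K \<in> lmeasurable" "emeasure lebesgue (N - K) < ennreal e"
    by (rule sets_lebesgue_inner_closed[OF N e(1)])
  have Kleb: "K \<in> sets lebesgue" using K(1) by auto
  have Knull: "K \<notin> null_sets lebesgue"
  proof
    assume "K \<in> null_sets lebesgue"
    then have "emeasure lebesgue (N - K) = emeasure lebesgue N" by (rule emeasure_Diff_null_set[OF _ N])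
    then show False using K(4) e(2) by simp
  qed
  have Kne: "K \<noteq> {}" using Knull by auto
  \<comment> \<open>Continuous cutoffs that equal 1 on \<open>K\<close> and decrease pointwise to
    its indicator as j grows.\<close>
  define f where "f j x = max 0 (1 - real j * infdist x K)" for j x
  have contf: "continuous_on {\<alpha>..\<beta>} (f j)" for j
    unfolding f_def by (intro continuous_intros)
  have ex: "\<exists>p. real_polynomial_function p \<and> (\<forall>x\<in>{\<alpha>..\<beta>}. \<bar>f j x - p x\<bar> < 1 / real (Suc j))" for j
  proof -
    have "0 < 1 / real (Suc j)" by simp
    then obtain g where "real_polynomial_function g" "\<And>x. x \<in> {\<alpha>..\<beta>} \<Longrightarrow> \<bar>f j x - g x\<bar> < 1 / real (Suc j)"
      using Stone_Weierstrass_real_polynomial_function[OF compact_Icc contf] by metis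
    then show ?thesis by (intro exI[of _ g]) simp
  qed
  obtain p where "\<forall>j. real_polynomial_function (p j) \<and> (\<forall>x\<in>{\<alpha>..\<beta>}. \<bar>f j x - p j x\<bar> < 1 / real (Suc j))"
    using choice[OF allI[OF ex]] ..
  then have p: "\<And>j. real_polynomial_function (p j)" "\<And>j x. x \<in> {\<alpha>..\<beta>} \<Longrightarrow> \<bar>f j x - p j x\<bar> < 1 / real (Suc j)"
    by blast+
  have f01: "0 \<le> f j x" "f j x \<le> 1" for j x by (auto simp: f_def infdist_nonneg)
  have flim: "(\<lambda>j. f j x) \<longlonglongrightarrow> indicator K x" for x
  proof (cases "x \<in> K")
    case False
    have d: "infdist x K > 0" by (rule infdist_pos_not_in_closed[OF K(1) Kne False])
    obtain n where n: "1 / infdist x K < real n" using reals_Archimedean2 by blast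
    have "\<forall>\<^sub>F j in sequentially. f j x = 0"
    proof (rule eventually_sequentiallyI[of n])
      fix j assume "n \<le> j"
      then have "1 / infdist x K \<le> real j" using n by linarith
      then show "f j x = 0" using d by (simp add: f_def field_simps)
    qed
    then show ?thesis using False by (simp add: tendsto_eventually)
  qed (simp add: f_def)
  have plim: "(\<lambda>j. p j x) \<longlonglongrightarrow> indicator K x" if x: "x \<in> {\<alpha>..\<beta>}" for x
  proof -
    have "(\<lambda>j. f j x - p j x) \<longlonglongrightarrow> 0"
      by (rule Lim_null_comparison[OF always_eventually LIMSEQ_inverse_real_of_nat])
         (use p(2)[OF x] in \<open>auto simp: inverse_eq_divide intro: less_imp_le\<close>)
    from tendsto_diff[OF flim[of x] this] show ?thesis by simp
  qed
  \<comment> \<open>The cutoff and the polynomial error are each at most 1, whence the bound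
    2^2.\<close>
  have pb: "(p j x)\<^sup>2 \<le> 4" if x: "x \<in> {\<alpha>..\<beta>}" for j x
  proof -
    have "1 / real (Suc j) \<le> 1" by simp
    then have "\<bar>p j x\<bar> \<le> 2" using p(2)[OF x, of j] f01[of j x] by linarith
    then show ?thesis using power_mono[of "\<bar>p j x\<bar>" 2 2] by simp
  qed
  have contp: "continuous_on {\<alpha>..\<beta>} (\<lambda>x. (p j x)\<^sup>2)" for j
    using continuous_on_polymonial_function[of "p j"] p(1)[of j]
    by (intro continuous_intros) (auto simp: real_polynomial_function_eq)
  have dom: "(\<lambda>x. 4 * \<bar>G x\<bar>) integrable_on S"
    using integrable_cmul[of "\<lambda>x. norm (G x)" S 4] G by (simp add: absolutely_integrable_on_def S_def)
  have fi: "(\<lambda>x. (p j x)\<^sup>2 * G x) integrable_on S" for j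
    using continuous_mult_absolutely_integrable[OF contp G] by (simp add: S_def absolutely_integrable_on_def)
  have le: "norm ((p j x)\<^sup>2 * G x) \<le> 4 * \<bar>G x\<bar>" if "x \<in> S" for j x
    using pb[of x j] that by (auto simp: abs_mult S_def intro!: mult_right_mono)
  have conv: "(\<lambda>j. (p j x)\<^sup>2 * G x) \<longlonglongrightarrow> indicator K x * G x" if "x \<in> S" for x
  proof -
    have "(\<lambda>j. (p j x)\<^sup>2 * G x) \<longlonglongrightarrow> (indicator K x)\<^sup>2 * G x"
      using that by (intro tendsto_intros plim) (auto simp: S_def)
    then show ?thesis by (cases "x \<in> K") simp_all
  qed
  have lim: "(\<lambda>j. integral S (\<lambda>x. (p j x)\<^sup>2 * G x)) \<longlonglongrightarrow> integral S (\<lambda>x. indicator K x * G x)"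
    by (rule dominated_convergence(2)[OF fi dom le conv])
  then have ge: "integral S (\<lambda>x. indicator K x * G x) \<ge> 0"
    by (rule LIMSEQ_le_const) (use pos[OF p(1)] in \<open>auto simp: S_def\<close>)
  have KS: "K \<subseteq> S" using K(2) by (auto simp: N_def)
  have GK: "set_integrable lebesgue K G"
    by (rule set_integrable_subset[OF G Kleb]) (use KS in \<open>simp add: S_def\<close>)
  have ind: "indicator S x *\<^sub>R (indicator K x * G x) = indicator K x *\<^sub>R G x" for x
    using KS by (auto simp: indicator_def)
  have GS: "set_integrable lebesgue S (\<lambda>x. indicator K x * G x)"
    using GK unfolding set_integrable_def ind .
  have ge': "(LINT x:K|lebesgue. G x) \<ge> 0"
    using ge set_lebesgue_integral_eq_integral(2)[OF GS] unfolding set_lebesgue_integral_def ind by simp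
  \<comment> \<open>\<open>G\<close> is negative on \<open>K\<close>, so \<open>H\<close> is
    non-negative, yet its integral is at most 0. It therefore vanishes almost everywhere, which is
    possible only if \<open>K\<close> is null.\<close>
  define H where "H x = - (indicator K x *\<^sub>R G x)" for x
  have Hi: "integrable lebesgue H" using GK by (simp add: H_def[abs_def] set_integrable_def)
  have H0: "H x \<ge> 0" for x using K(2) by (auto simp: H_def indicator_def N_def)
  have "integral\<^sup>L lebesgue H \<le> 0"
    using ge' by (simp add: H_def[abs_def] set_lebesgue_integral_def)
  moreover have "integral\<^sup>L lebesgue H \<ge> 0" using H0 by simp
  ultimately have "AE x in lebesgue. H x = 0"
    using integral_nonneg_eq_0_iff_AE[OF Hi] H0 by simp
  then have "AE x in lebesgue. x \<notin> K"
    by eventually_elim (use K(2) in \<open>auto simp: H_def N_def\<close>)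
  then show False using Knull Kleb by (simp add: AE_iff_null_sets)
qed

subsection \<open>Oscillating test functions\<close>

lemma tendsto_mult_bounded_zero:
  fixes f c :: "nat \<Rightarrow> real"
  assumes "f \<longlonglongrightarrow> 0" "\<And>n. \<bar>c n\<bar> \<le> 1"
  shows "(\<lambda>n. c n * f n) \<longlonglongrightarrow> 0"
proof (rule Lim_null_comparison[OF always_eventually])
  show "\<forall>n. norm (c n * f n) \<le> \<bar>f n\<bar>"
    using assms(2) by (auto simp: abs_mult intro: mult_left_le_one_le)
  show "(\<lambda>n. \<bar>f n\<bar>) \<longlonglongrightarrow> 0" using assms(1) by (rule tendsto_rabs_zero)
qed

text \<open>Adding the two phases removes the oscillating factors because \<open>cos\<^sup>2 + sin\<^sup>2 = 1\<close>,
  so no Riemann--Lebesgue argument is needed.\<close>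

lemma two_phase_limit:
  fixes c e f g c' e' f' g' :: "nat \<Rightarrow> real"
  assumes c: "\<And>n. (c n)\<^sup>2 + (c' n)\<^sup>2 = 1"
    and lim: "e \<longlonglongrightarrow> L" "e' \<longlonglongrightarrow> L" "f \<longlonglongrightarrow> 0" "f' \<longlonglongrightarrow> 0" "g \<longlonglongrightarrow> 0" "g' \<longlonglongrightarrow> 0"
  shows "(\<lambda>n. ((c n)\<^sup>2 * e n + c n * f n + g n) + ((c' n)\<^sup>2 * e' n + c' n * f' n + g' n)) \<longlonglongrightarrow> L"
proof -
  have sq: "(c n)\<^sup>2 \<le> 1" "(c' n)\<^sup>2 \<le> 1" for n
    using c[of n] zero_le_power2[of "c n"] zero_le_power2[of "c' n"] by linarith+
  then have b: "\<bar>c n\<bar> \<le> 1" "\<bar>c' n\<bar> \<le> 1" "\<bar>(c n)\<^sup>2\<bar> \<le> 1" "\<bar>(c' n)\<^sup>2\<bar> \<le> 1" for n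
    by (simp_all add: abs_square_le_1)
  have z: "(\<lambda>n. e n - L) \<longlonglongrightarrow> 0" "(\<lambda>n. e' n - L) \<longlonglongrightarrow> 0"
    using lim(1,2) by (simp_all add: LIM_zero_iff)
  have "(\<lambda>n. (((c n)\<^sup>2 * (e n - L) + c n * f n + g n) + ((c' n)\<^sup>2 * (e' n - L) + c' n * f' n + g' n)) + L)
      \<longlonglongrightarrow> (((0 + 0 + 0) + (0 + 0 + 0)) + L)"
    by (intro tendsto_add tendsto_const lim(5,6) tendsto_mult_bounded_zero z lim(3,4) b)
  moreover have "(((c n)\<^sup>2 * (e n - L) + c n * f n + g n) + ((c' n)\<^sup>2 * (e' n - L) + c' n * f' n + g' n)) + L
     = ((c n)\<^sup>2 * e n + c n * f n + g n) + ((c' n)\<^sup>2 * e' n + c' n * f' n + g' n)" for n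
  proof -
    \<comment> \<open>Splitting L between the two phases lets the errors e - L and e' - L be treated
      separately.\<close>
    have "L = ((c n)\<^sup>2 + (c' n)\<^sup>2) * L" using c by simp
    then show ?thesis by (simp add: algebra_simps)
  qed
  ultimately show ?thesis by simp
qed

lemma continuous_bound_Icc:
  fixes f :: "real \<Rightarrow> real"
  assumes "continuous_on {\<alpha>..\<beta>} f"
  obtains M where "M \<ge> 0" "\<And>x. x \<in> {\<alpha>..\<beta>} \<Longrightarrow> \<bar>f x\<bar> \<le> M"
proof -
  have "bounded (f ` {\<alpha>..\<beta>})"
    by (intro compact_imp_bounded compact_continuous_image assms) auto
  then obtain B where B: "\<forall>y\<in>f ` {\<alpha>..\<beta>}. norm y \<le> B" unfolding bounded_iff by blast
  show ?thesis by (rule that[of "max 0 B"]) (use B in \<open>auto simp: le_max_iff_disj\<close>)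
qed

context bounded_Lambda
begin

text \<open>The conversion factors \<zeta>(t) / t, t / \<zeta>(t) and 1 have logarithmic derivatives
  \<Lambda>, -\<Lambda> and 0, all bounded by lam. The same test functions thus serve dissipativity
  and integral ellipticity.\<close>

lemma bump_lifts:
  fixes y y' :: "real \<Rightarrow> complex^'m"
  assumes I: "{\<alpha>..\<beta>} \<subseteq> einterval a b"
    and y: "\<And>x. (y has_vector_derivative y' x) (at x)" "continuous_on UNIV y'"
    and y0: "\<And>x. \<alpha> \<le> x \<Longrightarrow> x \<le> \<beta> \<Longrightarrow> y x \<noteq> 0"
    and k: "k * (1 - lam) > 1" and \<alpha>\<beta>: "\<alpha> < \<beta>"
  shows "(\<lambda>x. bump k \<alpha> \<beta> x *\<^sub>R y x) \<in> C1_compact_support_vec a b"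
    "ulift (\<lambda>x. bump k \<alpha> \<beta> x *\<^sub>R y x) \<in> C1_compact_support_vec a b"
    "wlift (\<lambda>x. bump k \<alpha> \<beta> x *\<^sub>R y x) \<in> C1_compact_support_vec a b"
proof -
  show "ulift (\<lambda>x. bump k \<alpha> \<beta> x *\<^sub>R y x) \<in> C1_compact_support_vec a b"
    unfolding ulift_def[abs_def]
    by (rule bump_C1_compact_support[OF I y y0 _ _ _ _ k lam_nonneg lam \<alpha>\<beta>, of "\<lambda>t. zeta t / t" "Lambda \<phi>"])
       (use zeta_over_deriv zeta_pos Lambda_le continuous_on_Lambda in auto)
  show "wlift (\<lambda>x. bump k \<alpha> \<beta> x *\<^sub>R y x) \<in> C1_compact_support_vec a b"
    unfolding wlift_def[abs_def]
    by (rule bump_C1_compact_support[OF I y y0 _ _ _ _ k lam_nonneg lam \<alpha>\<beta>, of "\<lambda>t. t / zeta t" "\<lambda>t. - Lambda \<phi> t"])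
       (use over_zeta_deriv zeta_pos Lambda_le continuous_on_Lambda in \<open>auto intro: continuous_on_minus\<close>)
  have "(\<lambda>x. (\<lambda>_. 1) (norm (bump k \<alpha> \<beta> x *\<^sub>R y x)) *\<^sub>R (bump k \<alpha> \<beta> x *\<^sub>R y x)) \<in> C1_compact_support_vec a b"
    by (rule bump_C1_compact_support[OF I y y0 _ _ _ _ k lam_nonneg lam \<alpha>\<beta>, of "\<lambda>t. 1" "\<lambda>t. 0"])
       (use lam_nonneg in auto)
  then show "(\<lambda>x. bump k \<alpha> \<beta> x *\<^sub>R y x) \<in> C1_compact_support_vec a b" by simp
qed

text \<open>Outside \<open>S\<close> the function v vanishes, and so does v' almost everywhere in
  the interval; the integral over the whole interval therefore reduces to \<open>S\<close>.\<close>

lemma test_integral_nonneg: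
  fixes A :: "real \<Rightarrow> complex^'m^'m"
  assumes A: "\<And>i j. (\<lambda>x. A x $ i $ j) \<in> L1_loc a b"
    and tame: "tame a b v" and ge: "\<kappa> * energy a b v \<le> efun a b A v"
    and S: "S \<subseteq> einterval a b" "open S" "\<And>x. x \<notin> S \<Longrightarrow> v x = 0"
  defines "F \<equiv> \<lambda>x. Re (eterm A v x) - \<kappa> * (norm (vector_derivative v (at x)))\<^sup>2"
  shows "F absolutely_integrable_on S" "0 \<le> integral S F"
proof -
  have 1: "set_integrable lebesgue (einterval a b) (\<lambda>x. Re (eterm A v x))"
    by (rule Re_set_integral(1)[OF eterm_integrable[OF A tame]])
  have 2: "set_integrable lebesgue (einterval a b) (\<lambda>x. \<kappa> * (norm (vector_derivative v (at x)))\<^sup>2)"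
    using tame_energy_integrable[OF tame] by simp
  have F: "set_integrable lebesgue (einterval a b) F" "(LINT x:einterval a b|lebesgue. F x) = efun a b A v - \<kappa> * energy a b v"
    using set_integral_diff[OF 1 2] by (simp_all add: F_def efun_def energy_def)
  show FS: "F absolutely_integrable_on S"
    by (rule set_integrable_subset[OF F(1)]) (use S in auto)
  have z: "AE x in lebesgue. x \<in> einterval a b \<longrightarrow> v x = 0 \<longrightarrow> vector_derivative v (at x) = 0"
    using tame by (simp add: tame_def Let_def)
  have "(LINT x:einterval a b|lebesgue. indicator S x * F x) = (LINT x:einterval a b|lebesgue. F x)"
    by (rule set_integral_cong_AE_lebesgue(2)[OF F(1)])
       (use z in \<open>eventually_elim, use S(3) in \<open>auto simp: F_def eterm_def indicator_def\<close>\<close>)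
  moreover have "(LINT x:einterval a b|lebesgue. indicator S x * F x) = (LINT x:S|lebesgue. F x)"
    unfolding set_lebesgue_integral_def
    by (rule arg_cong[where f = "integral\<^sup>L lebesgue"], rule ext) (use S(1) in \<open>auto simp: indicator_def\<close>)
  ultimately show "0 \<le> integral S F"
    using set_lebesgue_integral_eq_integral(2)[OF FS] F(2) ge by simp
qed


text \<open>The defect in the strong condition with constant \<kappa>, polarised. As \<Lambda> is
  taken at |V|, the vector V carries both the direction \<omega> and the parameter t.\<close>

definition gform :: "real \<Rightarrow> complex^'m^'m \<Rightarrow> complex^'m \<Rightarrow> complex^'m \<Rightarrow> complex^'m \<Rightarrow> real" where
  "gform \<kappa> M V W Z = Re (ellform M (Lambda \<phi> (norm V)) V W Z) - \<kappa> * (W \<bullet> Z)"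

lemma gform_add_left: "gform \<kappa> M V (W + W') Z = gform \<kappa> M V W Z + gform \<kappa> M V W' Z"
  by (simp add: gform_def ellform_add_left inner_add_left algebra_simps)

lemma gform_add_right: "gform \<kappa> M V W (Z + Z') = gform \<kappa> M V W Z + gform \<kappa> M V W Z'"
  by (simp add: gform_def ellform_add_right inner_add_right algebra_simps)

lemma gform_scaleR_left: "gform \<kappa> M V (c *\<^sub>R W) Z = c * gform \<kappa> M V W Z"
  by (simp add: gform_def ellform_scaleR_left algebra_simps)

lemma gform_scaleR_right: "gform \<kappa> M V W (c *\<^sub>R Z) = c * gform \<kappa> M V W Z"
  by (simp add: gform_def ellform_scaleR_right algebra_simps)

lemma gform_square:
  "gform \<kappa> M V (c *\<^sub>R E + D) (c *\<^sub>R E + D) =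
     c\<^sup>2 * gform \<kappa> M V E E + c * (gform \<kappa> M V E D + gform \<kappa> M V D E) + gform \<kappa> M V D D"
  by (simp add: gform_add_left gform_add_right gform_scaleR_left gform_scaleR_right algebra_simps power2_eq_square)

lemma gform_zero [simp]: "gform \<kappa> M V 0 Z = 0" "gform \<kappa> M V W 0 = 0"
  by (simp_all add: gform_def)

lemma tendsto_gform:
  assumes "(V \<longlongrightarrow> V0) F" "V0 \<noteq> 0" "(W \<longlongrightarrow> W0) F" "(Z \<longlongrightarrow> Z0) F"
  shows "((\<lambda>x. gform \<kappa> M (V x) (W x) (Z x)) \<longlongrightarrow> gform \<kappa> M V0 W0 Z0) F"
proof -
  have "((\<lambda>x. Lambda \<phi> (norm (V x))) \<longlongrightarrow> Lambda \<phi> (norm V0)) F"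
    by (rule isCont_tendsto_compose[OF isCont_Lambda]) (use assms in \<open>auto intro: tendsto_norm\<close>)
  then show ?thesis
    unfolding gform_def using assms by (intro tendsto_intros tendsto_Re tendsto_ellform)
qed

lemma abs_gform_le:
  assumes "V \<noteq> 0" "norm W \<le> B"
  shows "\<bar>gform \<kappa> M V W W\<bar> \<le> (\<Sum>i\<in>UNIV. \<Sum>j\<in>UNIV. cmod (M $ i $ j)) * (4 * (B * B)) + \<bar>\<kappa>\<bar> * (B * B)"
proof -
  have WB: "norm W * norm W \<le> B * B" using assms(2) by (intro mult_mono) (auto intro: order_trans[OF norm_ge_zero])
  have "\<bar>Re (ellform M (Lambda \<phi> (norm V)) V W W)\<bar> \<le> cmod (ellform M (Lambda \<phi> (norm V)) V W W)"
    by (rule abs_Re_le_cmod)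
  also have "\<dots> \<le> (\<Sum>i\<in>UNIV. \<Sum>j\<in>UNIV. cmod (M $ i $ j)) * (4 * (norm W * norm W))"
    by (rule norm_ellform_le) (use Lambda_abs_less_1[of "norm V"] assms(1) in auto)
  also have "\<dots> \<le> (\<Sum>i\<in>UNIV. \<Sum>j\<in>UNIV. cmod (M $ i $ j)) * (4 * (B * B))"
    using WB by (intro mult_left_mono sum_nonneg) auto
  finally have 1: "\<bar>Re (ellform M (Lambda \<phi> (norm V)) V W W)\<bar> \<le> (\<Sum>i\<in>UNIV. \<Sum>j\<in>UNIV. cmod (M $ i $ j)) * (4 * (B * B))" .
  have 2: "\<bar>\<kappa> * (W \<bullet> W)\<bar> \<le> \<bar>\<kappa>\<bar> * (B * B)"
    using WB by (simp add: abs_mult dot_square_norm power2_eq_square mult_left_mono)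
  show ?thesis unfolding gform_def using 1 2 by linarith
qed

text \<open>Divided by sqrt(r), the derivative of the test function is cos(r x + \<theta>) E + D
  with E = \<eta> p \<xi> fixed and D tending to 0. Once the phases 0 and pi/2 are added the forms
  converge pointwise, and an integrable majorant independent of j carries the limit through the
  integral.\<close>

lemma limit_inequality:
  fixes A :: "real \<Rightarrow> complex^'m^'m" and \<xi> \<omega> :: "complex^'m" and p :: "real \<Rightarrow> real"
  assumes A: "\<And>i j. (\<lambda>x. A x $ i $ j) \<in> L1_loc a b"
    and H: "\<And>v. v \<in> C1_compact_support_vec a b \<Longrightarrow> ulift v \<in> C1_compact_support_vec a b \<Longrightarrow>
       wlift v \<in> C1_compact_support_vec a b \<Longrightarrow> \<kappa> * energy a b v \<le> efun a b A v"
    and k: "k * (1 - lam) > 1" and \<alpha>\<beta>: "\<alpha> < \<beta>" and I: "{\<alpha>..\<beta>} \<subseteq> einterval a b"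
    and \<omega>: "norm \<omega> = 1" and t: "t > 0"
    and p: "\<And>x. (p has_real_derivative p' x) (at x)" "continuous_on UNIV p'"
  defines "G \<equiv> \<lambda>x. (bump k \<alpha> \<beta> x)\<^sup>2 * gform \<kappa> (A x) ((bump k \<alpha> \<beta> x * t) *\<^sub>R \<omega>) \<xi> \<xi>"
  shows "(\<lambda>x. (p x)\<^sup>2 * G x) absolutely_integrable_on {\<alpha><..<\<beta>}"
    "0 \<le> integral {\<alpha><..<\<beta>} (\<lambda>x. (p x)\<^sup>2 * G x)"
proof -
  define S where "S = {\<alpha><..<\<beta>}"
  define \<eta> where "\<eta> = bump k \<alpha> \<beta>"
  define \<eta>' where "\<eta>' x = k * ((x - \<alpha>) * (\<beta> - x)) ^ (k - 1) * (\<alpha> + \<beta> - 2 * x)" for x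
  have contp: "continuous_on UNIV p"
    using DERIV_isCont[OF p(1)] by (intro continuous_at_imp_continuous_on) auto
  obtain Mp where Mp: "Mp \<ge> 0" "\<And>x. x \<in> {\<alpha>..\<beta>} \<Longrightarrow> \<bar>p x\<bar> \<le> Mp"
    using continuous_bound_Icc[OF continuous_on_subset[OF contp subset_UNIV]] by metis
  obtain Mp' where Mp': "Mp' \<ge> 0" "\<And>x. x \<in> {\<alpha>..\<beta>} \<Longrightarrow> \<bar>p' x\<bar> \<le> Mp'"
    using continuous_bound_Icc[OF continuous_on_subset[OF p(2) subset_UNIV]] by metis
  have "continuous_on {\<alpha>..\<beta>} (\<lambda>x. ((x - \<alpha>) * (\<beta> - x)) ^ k)" by (intro continuous_intros)
  then obtain M\<eta> where M\<eta>: "M\<eta> \<ge> 0" "\<And>x. x \<in> {\<alpha>..\<beta>} \<Longrightarrow> \<bar>((x - \<alpha>) * (\<beta> - x)) ^ k\<bar> \<le> M\<eta>"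
    by (rule continuous_bound_Icc) blast
  have \<eta>b: "\<bar>\<eta> x\<bar> \<le> M\<eta>" if "x \<in> {\<alpha>..\<beta>}" for x
    using M\<eta>(1) M\<eta>(2)[OF that] unfolding \<eta>_def bump_def by auto
  have "continuous_on {\<alpha>..\<beta>} \<eta>'" unfolding \<eta>'_def by (intro continuous_intros)
  then obtain M\<eta>' where M\<eta>': "M\<eta>' \<ge> 0" "\<And>x. x \<in> {\<alpha>..\<beta>} \<Longrightarrow> \<bar>\<eta>' x\<bar> \<le> M\<eta>'"
    by (rule continuous_bound_Icc) blast
  \<comment> \<open>This \<open>N\<close> makes the amplitude small against t from the start, so
    that y has no zeros on [\<alpha>, \<beta>]; the added 1 gives r \<ge> 1, used in the uniform
    bounds.\<close>
  obtain N where N: "((Mp * norm \<xi> / t)\<^sup>2 + 1) < real N" using reals_Archimedean2 by blast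
  define r where "r j = real (j + N)" for j :: nat
  have r1: "r j \<ge> 1" for j using N zero_le_power2[of "Mp * norm \<xi> / t"] unfolding r_def of_nat_add by linarith
  have rpos: "r j > 0" for j using r1[of j] by linarith
  have sr1: "sqrt (r j) \<ge> 1" for j using r1[of j] by simp
  have small: "Mp * norm \<xi> < t * sqrt (r j)" for j
  proof -
    have "(Mp * norm \<xi> / t)\<^sup>2 < r j" using N unfolding r_def of_nat_add by linarith
    then have "Mp * norm \<xi> / t < sqrt (r j)" using real_less_rsqrt by blast
    then show ?thesis using t by (simp add: field_simps)
  qed
  define y where "y \<theta> j x = t *\<^sub>R \<omega> + (p x * sin (r j * x + \<theta>) / sqrt (r j)) *\<^sub>R \<xi>" for \<theta> j x
  define y' where "y' \<theta> j x = ((p' x * sin (r j * x + \<theta>) + p x * (r j * cos (r j * x + \<theta>))) / sqrt (r j)) *\<^sub>R \<xi>" for \<theta> j x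
  have y: "(y \<theta> j has_vector_derivative y' \<theta> j x) (at x)" for \<theta> j x
  proof -
    have "((\<lambda>x. p x * sin (r j * x + \<theta>) / sqrt (r j)) has_real_derivative
       (p' x * sin (r j * x + \<theta>) + p x * (r j * cos (r j * x + \<theta>))) / sqrt (r j)) (at x)"
    proof -
      have "((\<lambda>x. sin (r j * x + \<theta>)) has_real_derivative cos (r j * x + \<theta>) * r j) (at x)"
        by (auto intro!: derivative_eq_intros)
      from DERIV_cdivide[OF DERIV_mult[OF p(1) this]] show ?thesis by (simp add: mult_ac)
    qed
    from has_vector_derivative_add[OF has_vector_derivative_const[of "t *\<^sub>R \<omega>"] has_vector_derivative_scaleR[OF this has_vector_derivative_const[of \<xi>]]]
    show ?thesis by (simp add: y_def[abs_def] y'_def)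
  qed
  have y'c: "continuous_on UNIV (y' \<theta> j)" for \<theta> j
    unfolding y'_def[abs_def] by (intro continuous_intros p(2) contp) (use rpos[of j] in auto)
  have psb: "\<bar>p x * sin (r j * x + \<theta>) / sqrt (r j)\<bar> * norm \<xi> < t" if "x \<in> {\<alpha>..\<beta>}" for x j \<theta>
  proof -
    have "\<bar>p x\<bar> * \<bar>sin (r j * x + \<theta>)\<bar> \<le> Mp * 1" using Mp(1) Mp(2)[OF that] by (intro mult_mono) auto
    then have "\<bar>p x\<bar> * \<bar>sin (r j * x + \<theta>)\<bar> * norm \<xi> \<le> Mp * norm \<xi>" by (intro mult_right_mono) auto
    also have "\<dots> < t * sqrt (r j)" by (rule small)
    finally show ?thesis using rpos[of j] by (simp add: abs_mult field_simps)
  qed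
  have y0: "y \<theta> j x \<noteq> 0" if "\<alpha> \<le> x" "x \<le> \<beta>" for \<theta> j x
  proof
    assume "y \<theta> j x = 0"
    then have "t *\<^sub>R \<omega> = - ((p x * sin (r j * x + \<theta>) / sqrt (r j)) *\<^sub>R \<xi>)" by (simp add: y_def add_eq_0_iff2)
    then have "norm (t *\<^sub>R \<omega>) = norm ((p x * sin (r j * x + \<theta>) / sqrt (r j)) *\<^sub>R \<xi>)" by simp
    then show False using psb[of x j \<theta>] that \<omega> t by simp
  qed
  have yb: "norm (y \<theta> j x) \<le> 2 * t" if "x \<in> {\<alpha>..\<beta>}" for \<theta> j x
  proof -
    have "norm (y \<theta> j x) \<le> norm (t *\<^sub>R \<omega>) + norm ((p x * sin (r j * x + \<theta>) / sqrt (r j)) *\<^sub>R \<xi>)"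
      unfolding y_def by (rule norm_triangle_ineq)
    then show ?thesis using psb[OF that, of j \<theta>] \<omega> t by simp
  qed
  define v where "v \<theta> j x = \<eta> x *\<^sub>R y \<theta> j x" for \<theta> j x
  have lifts: "v \<theta> j \<in> C1_compact_support_vec a b" "ulift (v \<theta> j) \<in> C1_compact_support_vec a b"
     "wlift (v \<theta> j) \<in> C1_compact_support_vec a b" for \<theta> j
    unfolding v_def[abs_def] \<eta>_def by (rule bump_lifts[OF I y y'c _ k \<alpha>\<beta>], erule (1) y0)+
  define E where "E x = (\<eta> x * p x) *\<^sub>R \<xi>" for x
  define D where "D \<theta> j x = (\<eta>' x / sqrt (r j)) *\<^sub>R y \<theta> j x + (\<eta> x * p' x * sin (r j * x + \<theta>) / r j) *\<^sub>R \<xi>" for \<theta> j x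
  define c where "c \<theta> j x = cos (r j * x + \<theta>)" for \<theta> j x
  define W where "W \<theta> j x = c \<theta> j x *\<^sub>R E x + D \<theta> j x" for \<theta> j x
  have vd: "vector_derivative (v \<theta> j) (at x) = sqrt (r j) *\<^sub>R W \<theta> j x" if x: "x \<in> S" for \<theta> j x
  proof -
    have "(v \<theta> j has_vector_derivative (\<eta> x *\<^sub>R y' \<theta> j x + \<eta>' x *\<^sub>R y \<theta> j x)) (at x)"
      unfolding v_def[abs_def] \<eta>_def \<eta>'_def by (rule bump_vector_derivative[OF _ _ y]) (use x in \<open>auto simp: S_def\<close>)
    moreover have "\<eta> x *\<^sub>R y' \<theta> j x + \<eta>' x *\<^sub>R y \<theta> j x = sqrt (r j) *\<^sub>R W \<theta> j x"
    proof -
      have sq: "r j / sqrt (r j) = sqrt (r j)" "sqrt (r j) / r j = 1 / sqrt (r j)" "sqrt (r j) \<noteq> 0"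
        using rpos[of j] real_div_sqrt[of "r j"] by (simp_all add: field_simps)
      have e1: "sqrt (r j) *\<^sub>R ((\<eta>' x / sqrt (r j)) *\<^sub>R y \<theta> j x) = \<eta>' x *\<^sub>R y \<theta> j x" using sq(3) by simp
      have e2: "sqrt (r j) * (\<eta> x * p' x * sin (r j * x + \<theta>) / r j) = \<eta> x * p' x * sin (r j * x + \<theta>) * (1 / sqrt (r j))"
        by (subst sq(2)[symmetric]) simp
      have e3: "\<eta> x *\<^sub>R y' \<theta> j x = (\<eta> x * p' x * sin (r j * x + \<theta>) * (1 / sqrt (r j))) *\<^sub>R \<xi>
          + (\<eta> x * p x * cos (r j * x + \<theta>) * (r j / sqrt (r j))) *\<^sub>R \<xi>"
        unfolding y'_def scaleR_scaleR scaleR_add_left[symmetric]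
        by (rule arg_cong[where f = "\<lambda>c. c *\<^sub>R \<xi>"]) (use sq(3) in \<open>simp add: field_simps\<close>)
      show ?thesis
        unfolding W_def D_def E_def c_def scaleR_add_right e1 e3 unfolding scaleR_scaleR e2 sq(1)
        by (simp add: mult_ac add_ac)
    qed
    ultimately show ?thesis using vector_derivative_at by metis
  qed
  have v0: "v \<theta> j x \<noteq> 0" if "x \<in> S" for \<theta> j x
    using that y0[of x \<theta> j] bump_pos[of \<alpha> x \<beta> k] by (auto simp: v_def \<eta>_def S_def)
  define J where "J \<theta> j x = gform \<kappa> (A x) (v \<theta> j x) (W \<theta> j x) (W \<theta> j x)" for \<theta> j x
  have J: "J \<theta> j absolutely_integrable_on S" "0 \<le> integral S (J \<theta> j)" for \<theta> j
  proof -
    define F where "F x = Re (eterm A (v \<theta> j) x) - \<kappa> * (norm (vector_derivative (v \<theta> j) (at x)))\<^sup>2" for x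
    have Fx: "F absolutely_integrable_on S" "0 \<le> integral S F"
      unfolding F_def[abs_def]
      by (rule test_integral_nonneg[OF A C1_compact_support_vec_tame[OF lifts(1)] H[OF lifts]];
          use I in \<open>auto simp: S_def v_def \<eta>_def bump_def\<close>)+
    have eq: "F x = r j * J \<theta> j x" if "x \<in> S" for x
      using v0[OF that, of \<theta> j] rpos[of j]
      by (simp add: F_def J_def gform_def eterm_def vd[OF that] ellform_scaleR_left ellform_scaleR_right
          power_mult_distrib dot_square_norm right_diff_distrib flip: of_real_mult mult.assoc)
    have eq': "J \<theta> j x = (1 / r j) * F x" if "x \<in> S" for x
      using eq[OF that] rpos[of j] by simp
    have "(\<lambda>x. (1 / r j) * F x) absolutely_integrable_on S" using Fx(1) by simp
    then show "J \<theta> j absolutely_integrable_on S"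
      by (rule absolutely_integrable_spike[of _ _ "{}"]) (use eq' in auto)
    have "integral S (J \<theta> j) = integral S (\<lambda>x. (1 / r j) * F x)"
      by (rule integral_cong) (rule eq')
    then show "0 \<le> integral S (J \<theta> j)" using Fx(2) rpos[of j] by simp
  qed
  \<comment> \<open>The summands bound the oscillating leading part and the two parts of
    \<open>D\<close>, independently of j and \<theta>.\<close>
  define B where "B = M\<eta> * Mp * norm \<xi> + (M\<eta>' * (2 * t) + M\<eta> * Mp' * norm \<xi>)"
  have WB: "norm (W \<theta> j x) \<le> B" if x: "x \<in> S" for \<theta> j x
  proof -
    have xi: "x \<in> {\<alpha>..\<beta>}" using x by (auto simp: S_def)
    have 1: "norm (c \<theta> j x *\<^sub>R E x) \<le> M\<eta> * Mp * norm \<xi>"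
    proof -
      have "norm (c \<theta> j x *\<^sub>R E x) = \<bar>c \<theta> j x\<bar> * (\<bar>\<eta> x\<bar> * \<bar>p x\<bar> * norm \<xi>)" by (simp add: E_def abs_mult)
      also have "\<dots> \<le> 1 * (M\<eta> * Mp * norm \<xi>)"
        using \<eta>b[OF xi] Mp(2)[OF xi] M\<eta>(1) by (intro mult_mono) (auto simp: c_def)
      finally show ?thesis by simp
    qed
    have 2: "norm ((\<eta>' x / sqrt (r j)) *\<^sub>R y \<theta> j x) \<le> M\<eta>' * (2 * t)"
    proof -
      have "\<bar>\<eta>' x\<bar> / sqrt (r j) \<le> M\<eta>' / 1" using M\<eta>'(1) M\<eta>'(2)[OF xi] sr1[of j] by (intro frac_le) auto
      then have "\<bar>\<eta>' x\<bar> / sqrt (r j) * norm (y \<theta> j x) \<le> M\<eta>' / 1 * (2 * t)"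
        using yb[OF xi, of \<theta> j] M\<eta>'(1) by (intro mult_mono) auto
      then show ?thesis using rpos[of j] by simp
    qed
    have 3: "norm ((\<eta> x * p' x * sin (r j * x + \<theta>) / r j) *\<^sub>R \<xi>) \<le> M\<eta> * Mp' * norm \<xi>"
    proof -
      have "\<bar>\<eta> x\<bar> * \<bar>p' x\<bar> * \<bar>sin (r j * x + \<theta>)\<bar> \<le> M\<eta> * Mp' * 1"
        using \<eta>b[OF xi] Mp'(2)[OF xi] M\<eta>(1) Mp'(1) by (intro mult_mono) auto
      then have "\<bar>\<eta> x\<bar> * \<bar>p' x\<bar> * \<bar>sin (r j * x + \<theta>)\<bar> / r j \<le> M\<eta> * Mp' * 1 / 1"
        using r1[of j] M\<eta>(1) Mp'(1) by (intro frac_le) auto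
      then have "\<bar>\<eta> x\<bar> * \<bar>p' x\<bar> * \<bar>sin (r j * x + \<theta>)\<bar> / r j * norm \<xi> \<le> M\<eta> * Mp' * 1 / 1 * norm \<xi>"
        by (rule mult_right_mono) simp
      then show ?thesis using rpos[of j] by (simp add: abs_mult)
    qed
    show ?thesis
      unfolding W_def D_def B_def by (intro norm_triangle_mono 1 2 3)
  qed
  \<comment> \<open>As \<open>B\<close> does not depend on j, this dominates every \<open>J\<close>.
    It is integrable on \<open>S\<close> because \<open>S\<close> lies in a compact subinterval of
    the domain.\<close>
  define h where "h x = (\<Sum>i\<in>UNIV. \<Sum>j\<in>UNIV. cmod (A x $ i $ j)) * (4 * (B * B)) + \<bar>\<kappa>\<bar> * (B * B)" for x
  have Jh: "\<bar>J \<theta> j x\<bar> \<le> h x" if "x \<in> S" for \<theta> j x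
    unfolding J_def h_def by (rule abs_gform_le[OF v0[OF that] WB[OF that]])
  have hI: "h integrable_on S"
  proof -
    have AS: "(\<lambda>x. A x $ i $ j) absolutely_integrable_on S" for i j
      by (rule set_integrable_subset[of _ "{\<alpha>..\<beta>}"]) (use A[of i j] I in \<open>auto simp: L1_loc_def S_def\<close>)
    then have "(\<lambda>x. cmod (A x $ i $ j)) integrable_on S" for i j
      by (simp add: absolutely_integrable_on_def)
    then have "(\<lambda>x. (\<Sum>i\<in>UNIV. \<Sum>j\<in>UNIV. cmod (A x $ i $ j))) integrable_on S"
      by (intro integrable_sum) auto
    then have 1: "(\<lambda>x. (4 * (B * B)) *\<^sub>R (\<Sum>i\<in>UNIV. \<Sum>j\<in>UNIV. cmod (A x $ i $ j))) integrable_on S"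
      by (rule integrable_cmul)
    have 2: "(\<lambda>x. \<bar>\<kappa>\<bar> * (B * B)) integrable_on S"
      unfolding S_def by (simp add: integrable_on_open_interval_real integrable_const_ivl)
    show ?thesis using integrable_add[OF 1 2] by (simp add: h_def[abs_def] mult.commute)
  qed
  \<comment> \<open>The shift by pi/2 replaces cos by -sin, and the two squares add up to 1.\<close>
  define HH where "HH j x = J 0 j x + J (pi / 2) j x" for j x
  have HHi: "HH j absolutely_integrable_on S" for j
    unfolding HH_def[abs_def] by (intro set_integral_add J)
  have HH0: "0 \<le> integral S (HH j)" for j
    using J unfolding HH_def[abs_def] by (subst integral_add) (auto simp: absolutely_integrable_on_def)
  have r_lim: "filterlim r at_top sequentially"
    unfolding r_def[abs_def]
    by (intro filterlim_compose[OF filterlim_real_sequentially] filterlim_add_const_nat_at_top)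
  have inv_r: "(\<lambda>j. 1 / r j) \<longlonglongrightarrow> 0"
    using tendsto_inverse_0_at_top[OF r_lim] by (simp add: inverse_eq_divide)
  have inv_sr: "(\<lambda>j. 1 / sqrt (r j)) \<longlonglongrightarrow> 0"
    using tendsto_real_sqrt[OF inv_r] by (simp add: real_sqrt_divide)
  have conv: "(\<lambda>j. HH j x) \<longlonglongrightarrow> (p x)\<^sup>2 * G x" if x: "x \<in> S" for x
  proof -
    define V where "V = (\<eta> x * t) *\<^sub>R \<omega>"
    have V0: "V \<noteq> 0" using \<omega> t bump_pos[of \<alpha> x \<beta> k] x by (auto simp: V_def \<eta>_def S_def)
    have ylim: "(\<lambda>j. y \<theta> j x) \<longlonglongrightarrow> t *\<^sub>R \<omega>" for \<theta>
    proof -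
      have "(\<lambda>j. sin (r j * x + \<theta>) * (1 / sqrt (r j))) \<longlonglongrightarrow> 0"
        by (rule tendsto_mult_bounded_zero[OF inv_sr]) simp
      then have "(\<lambda>j. t *\<^sub>R \<omega> + (p x * (sin (r j * x + \<theta>) * (1 / sqrt (r j)))) *\<^sub>R \<xi>) \<longlonglongrightarrow> t *\<^sub>R \<omega> + (p x * 0) *\<^sub>R \<xi>"
        by (intro tendsto_intros)
      then show ?thesis by (simp add: y_def[abs_def])
    qed
    have vlim: "(\<lambda>j. v \<theta> j x) \<longlonglongrightarrow> V" for \<theta>
      using tendsto_scaleR[OF tendsto_const[of "\<eta> x"] ylim[of \<theta>]] by (simp add: v_def[abs_def] V_def)
    have Dlim: "(\<lambda>j. D \<theta> j x) \<longlonglongrightarrow> 0" for \<theta>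
    proof -
      have "(\<lambda>j. sin (r j * x + \<theta>) * (1 / r j)) \<longlonglongrightarrow> 0"
        by (rule tendsto_mult_bounded_zero[OF inv_r]) simp
      then have "(\<lambda>j. (\<eta>' x * (1 / sqrt (r j))) *\<^sub>R y \<theta> j x + (\<eta> x * p' x * (sin (r j * x + \<theta>) * (1 / r j))) *\<^sub>R \<xi>)
         \<longlonglongrightarrow> (\<eta>' x * 0) *\<^sub>R (t *\<^sub>R \<omega>) + (\<eta> x * p' x * 0) *\<^sub>R \<xi>"
        by (intro tendsto_intros inv_sr ylim)
      then show ?thesis by (simp add: D_def[abs_def])
    qed
    let ?e = "\<lambda>\<theta> j. gform \<kappa> (A x) (v \<theta> j x) (E x) (E x)"
    let ?f = "\<lambda>\<theta> j. gform \<kappa> (A x) (v \<theta> j x) (E x) (D \<theta> j x) + gform \<kappa> (A x) (v \<theta> j x) (D \<theta> j x) (E x)"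
    let ?g = "\<lambda>\<theta> j. gform \<kappa> (A x) (v \<theta> j x) (D \<theta> j x) (D \<theta> j x)"
    have e: "?e \<theta> \<longlonglongrightarrow> gform \<kappa> (A x) V (E x) (E x)" for \<theta>
      by (intro tendsto_gform vlim V0 tendsto_const)
    have f: "?f \<theta> \<longlonglongrightarrow> 0" for \<theta>
    proof -
      have "?f \<theta> \<longlonglongrightarrow> gform \<kappa> (A x) V (E x) 0 + gform \<kappa> (A x) V 0 (E x)"
        by (intro tendsto_add tendsto_gform vlim V0 tendsto_const Dlim)
      then show ?thesis by simp
    qed
    have g: "?g \<theta> \<longlonglongrightarrow> 0" for \<theta>
    proof -
      have "?g \<theta> \<longlonglongrightarrow> gform \<kappa> (A x) V 0 0" by (intro tendsto_gform vlim V0 Dlim)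
      then show ?thesis by simp
    qed
    have cs: "(c 0 j x)\<^sup>2 + (c (pi / 2) j x)\<^sup>2 = 1" for j
      by (simp add: c_def cos_add)
    have "(\<lambda>j. HH j x) \<longlonglongrightarrow> gform \<kappa> (A x) V (E x) (E x)"
      using two_phase_limit[OF cs e[of 0] e[of "pi/2"] f[of 0] f[of "pi/2"] g[of 0] g[of "pi/2"]]
      by (simp add: HH_def J_def W_def gform_square)
    moreover have "gform \<kappa> (A x) V (E x) (E x) = (p x)\<^sup>2 * G x"
      by (simp add: E_def G_def V_def \<eta>_def gform_scaleR_left gform_scaleR_right power2_eq_square)
    ultimately show ?thesis by simp
  qed
  have dom: "norm (HH j x) \<le> 2 * h x" if "x \<in> S" for j x
    using Jh[OF that, of 0 j] Jh[OF that, of "pi/2" j] unfolding HH_def by simp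
  have hI2: "(\<lambda>x. 2 * h x) integrable_on S" using integrable_cmul[OF hI, of 2] by simp
  \<comment> \<open>The majorant passes to the limit, which gives absolute integrability of the
    limit function.\<close>
  have normG: "norm ((p x)\<^sup>2 * G x) \<le> 2 * h x" if "x \<in> S" for x
    by (rule LIMSEQ_le_const2[OF tendsto_norm[OF conv[OF that]]]) (use dom[OF that] in blast)
  show "(\<lambda>x. (p x)\<^sup>2 * G x) absolutely_integrable_on {\<alpha><..<\<beta>}"
    using dominated_convergence_absolutely_integrable[OF HHi hI2 normG conv] by (simp add: S_def)
  have "(\<lambda>j. integral S (HH j)) \<longlonglongrightarrow> integral S (\<lambda>x. (p x)\<^sup>2 * G x)"
    by (rule dominated_convergence(2)[OF _ hI2 dom conv]) (use HHi in \<open>auto simp: absolutely_integrable_on_def\<close>)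
  then have "0 \<le> integral S (\<lambda>x. (p x)\<^sup>2 * G x)"
    by (rule LIMSEQ_le_const) (use HH0 in blast)
  then show "0 \<le> integral {\<alpha><..<\<beta>} (\<lambda>x. (p x)\<^sup>2 * G x)" by (simp add: S_def)
qed


text \<open>Non-negativity of \<open>G\<close> is divided by \<eta>(x)^2 > 0, leaving the form with
  \<Lambda> at \<eta>(x) t; taking the bump as the weight in \<open>AE_all_parameters\<close> then
  frees t.\<close>

lemma local_strong_ellipticity:
  fixes A :: "real \<Rightarrow> complex^'m^'m"
  assumes A: "\<And>i j. (\<lambda>x. A x $ i $ j) \<in> L1_loc a b"
    and H: "\<And>v. v \<in> C1_compact_support_vec a b \<Longrightarrow> ulift v \<in> C1_compact_support_vec a b \<Longrightarrow>
       wlift v \<in> C1_compact_support_vec a b \<Longrightarrow> \<kappa> * energy a b v \<le> efun a b A v"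
    and \<alpha>\<beta>: "\<alpha> < \<beta>" and I: "{\<alpha>..\<beta>} \<subseteq> einterval a b"
  shows "AE x in lebesgue. x \<in> {\<alpha><..<\<beta>} \<longrightarrow>
      (\<forall>\<xi> V t. V \<noteq> 0 \<longrightarrow> t > 0 \<longrightarrow> \<kappa> * (norm \<xi>)\<^sup>2 \<le> Re (ellform (A x) (Lambda \<phi> t) V \<xi> \<xi>))"
proof -
  \<comment> \<open>Such an order exists because lam < 1; it absorbs all three conversion factors at
    once.\<close>
  obtain k :: nat where "1 / (1 - lam) < k" using reals_Archimedean2 by blast
  then have k: "k * (1 - lam) > 1" using lam by (simp add: field_simps)
  show ?thesis
  proof (rule AE_all_parameters[where h = "bump k \<alpha> \<beta>"])
    show "bump k \<alpha> \<beta> x > 0" if "x \<in> {\<alpha><..<\<beta>}" for x using that bump_pos by auto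
    fix \<xi> \<omega> :: "complex^'m" and t :: real assume \<omega>: "norm \<omega> = 1" and t: "t > 0"
    define G where "G x = (bump k \<alpha> \<beta> x)\<^sup>2 * gform \<kappa> (A x) ((bump k \<alpha> \<beta> x * t) *\<^sub>R \<omega>) \<xi> \<xi>" for x
    have G: "(\<lambda>x. (p x)\<^sup>2 * G x) absolutely_integrable_on {\<alpha><..<\<beta>}"
      "0 \<le> integral {\<alpha><..<\<beta>} (\<lambda>x. (p x)\<^sup>2 * G x)" if p: "real_polynomial_function p" for p
    proof -
      obtain p' where p': "real_polynomial_function p'" "\<And>x. (p has_real_derivative p' x) (at x)"
        using has_real_derivative_polynomial_function[OF p] by blast
      have cont: "continuous_on UNIV p'"
        using p'(1) by (intro continuous_on_polymonial_function) (simp add: real_polynomial_function_eq)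
      show "(\<lambda>x. (p x)\<^sup>2 * G x) absolutely_integrable_on {\<alpha><..<\<beta>}"
        "0 \<le> integral {\<alpha><..<\<beta>} (\<lambda>x. (p x)\<^sup>2 * G x)"
        using limit_inequality[OF A H k \<alpha>\<beta> I \<omega> t p'(2) cont, of \<xi>] by (simp_all add: G_def)
    qed
    \<comment> \<open>The constant polynomial 1 isolates \<open>G\<close>.\<close>
    have "G absolutely_integrable_on {\<alpha><..<\<beta>}" using G(1)[of "\<lambda>_. 1"] by (simp add: real_polynomial_function.intros)
    then have "AE x in lebesgue. x \<in> {\<alpha><..<\<beta>} \<longrightarrow> 0 \<le> G x"
      by (rule AE_nonneg_of_polynomial_squares) (rule G(2))
    then show "AE x in lebesgue. x \<in> {\<alpha><..<\<beta>} \<longrightarrow>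
        \<kappa> * (norm \<xi>)\<^sup>2 \<le> Re (ellform (A x) (Lambda \<phi> (bump k \<alpha> \<beta> x * t)) \<omega> \<xi> \<xi>)"
    proof eventually_elim
      case (elim x)
      show ?case
      proof
        assume x: "x \<in> {\<alpha><..<\<beta>}"
        then have pos: "bump k \<alpha> \<beta> x > 0" using bump_pos by auto
        have "gform \<kappa> (A x) ((bump k \<alpha> \<beta> x * t) *\<^sub>R \<omega>) \<xi> \<xi> \<ge> 0"
          using elim x pos by (simp add: G_def zero_le_mult_iff)
        then show "\<kappa> * (norm \<xi>)\<^sup>2 \<le> Re (ellform (A x) (Lambda \<phi> (bump k \<alpha> \<beta> x * t)) \<omega> \<xi> \<xi>)"
          using pos t \<omega> by (simp add: gform_def ellform_scaleR dot_square_norm)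
      qed
    qed
  qed
qed

text \<open>The inequality is demanded only on the intersection of the test classes, so strict
  dissipativity and integral ellipticity both supply it. Countably many intervals with rational
  endpoints cover (a,b), which keeps the union of the exceptional sets null and \<kappa>
  unchanged.\<close>

lemma restricted_imp_strong:
  fixes A :: "real \<Rightarrow> complex^'m^'m"
  assumes A: "\<And>i j. (\<lambda>x. A x $ i $ j) \<in> L1_loc a b" and \<kappa>: "\<kappa> > 0"
    and H: "\<And>v. v \<in> C1_compact_support_vec a b \<Longrightarrow> ulift v \<in> C1_compact_support_vec a b \<Longrightarrow>
       wlift v \<in> C1_compact_support_vec a b \<Longrightarrow> \<kappa> * energy a b v \<le> efun a b A v"
  shows "strong_Phi_elliptic \<phi> a b A"
proof -
  have "AE x in lebesgue. \<forall>q::rat \<times> rat. of_rat (fst q) < (of_rat (snd q) :: real) \<longrightarrow> {of_rat (fst q)..of_rat (snd q)} \<subseteq> einterval a b \<longrightarrow>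
      x \<in> {of_rat (fst q)<..<of_rat (snd q)} \<longrightarrow>
      (\<forall>\<xi> V t. V \<noteq> 0 \<longrightarrow> t > 0 \<longrightarrow> \<kappa> * (norm \<xi>)\<^sup>2 \<le> Re (ellform (A x) (Lambda \<phi> t) V \<xi> \<xi>))"
    unfolding AE_all_countable
  proof
    fix q :: "rat \<times> rat"
    show "AE x in lebesgue. of_rat (fst q) < (of_rat (snd q) :: real) \<longrightarrow> {of_rat (fst q)..of_rat (snd q)} \<subseteq> einterval a b \<longrightarrow>
      x \<in> {of_rat (fst q)<..<of_rat (snd q)} \<longrightarrow>
      (\<forall>\<xi> V t. V \<noteq> 0 \<longrightarrow> t > 0 \<longrightarrow> \<kappa> * (norm \<xi>)\<^sup>2 \<le> Re (ellform (A x) (Lambda \<phi> t) V \<xi> \<xi>))"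
    proof (cases "of_rat (fst q) < (of_rat (snd q) :: real) \<and> {of_rat (fst q)..of_rat (snd q)} \<subseteq> einterval a b")
      case True
      then show ?thesis
        using local_strong_ellipticity[OF A H, of "of_rat (fst q)" "of_rat (snd q)"]
        by (auto elim!: eventually_mono)
    qed auto
  qed
  then have AE: "AE x in lebesgue. x \<in> einterval a b \<longrightarrow>
      (\<forall>\<xi> V t. V \<noteq> 0 \<longrightarrow> t > 0 \<longrightarrow> \<kappa> * (norm \<xi>)\<^sup>2 \<le> Re (ellform (A x) (Lambda \<phi> t) V \<xi> \<xi>))"
  proof eventually_elim
    case (elim x)
    show ?case
    proof
      assume x: "x \<in> einterval a b"
      obtain e where e: "e > 0" "cball x e \<subseteq> einterval a b"
        using open_contains_cball[of "einterval a b"] x by auto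
      obtain q1 where q1: "x - e < of_rat q1" "of_rat q1 < x" using of_rat_dense[of "x - e" x] e by auto
      obtain q2 where q2: "x < of_rat q2" "of_rat q2 < x + e" using of_rat_dense[of x "x + e"] e by auto
      have "{of_rat q1..of_rat q2} \<subseteq> cball x e" using q1 q2 by (auto simp: dist_real_def)
      then show "\<forall>\<xi> V t. V \<noteq> 0 \<longrightarrow> t > 0 \<longrightarrow> \<kappa> * (norm \<xi>)\<^sup>2 \<le> Re (ellform (A x) (Lambda \<phi> t) V \<xi> \<xi>)"
        using elim[rule_format, of "(q1, q2)"] q1 q2 e(2) by auto
    qed
  qed
  show ?thesis
    unfolding strong_Phi_elliptic_iff
  proof (intro exI[of _ \<kappa>] conjI \<kappa> allI impI)
    fix \<xi> \<omega> :: "complex^'m" and t :: real assume "norm \<omega> = 1" "t > 0"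
    then have "\<omega> \<noteq> 0" by auto
    show "AE x in lebesgue. x \<in> einterval a b \<longrightarrow> \<kappa> * (norm \<xi>)\<^sup>2 \<le> Re (ellform (A x) (Lambda \<phi> t) \<omega> \<xi> \<xi>)"
      using AE by eventually_elim (use \<open>\<omega> \<noteq> 0\<close> \<open>t > 0\<close> in blast)
  qed
qed

section \<open>Closing the equivalences\<close>

lemma strict_iff_strong:
  fixes A :: "real \<Rightarrow> complex^'m^'m"
  assumes A: "\<And>i j. (\<lambda>x. A x $ i $ j) \<in> L1_loc a b"
  shows "strict_LPhi_dissipative \<phi> a b A \<longleftrightarrow> strong_Phi_elliptic \<phi> a b A"
proof
  assume "strict_LPhi_dissipative \<phi> a b A"
  then show "strong_Phi_elliptic \<phi> a b A"
    unfolding strict_LPhi_dissipative_iff[OF A] using restricted_imp_strong[OF A] by blast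
next
  assume "strong_Phi_elliptic \<phi> a b A"
  from strong_imp_efun_ge_energy[OF A this] show "strict_LPhi_dissipative \<phi> a b A"
    unfolding strict_LPhi_dissipative_iff[OF A] using lifts_tame(1) by blast
qed

lemma integral_iff_strong:
  fixes A :: "real \<Rightarrow> complex^'m^'m"
  assumes A: "\<And>i j. (\<lambda>x. A x $ i $ j) \<in> L1_loc a b"
  shows "integral_Phi_elliptic \<phi> a b A \<longleftrightarrow> strong_Phi_elliptic \<phi> a b A"
proof
  assume "integral_Phi_elliptic \<phi> a b A"
  then show "strong_Phi_elliptic \<phi> a b A"
    unfolding integral_Phi_elliptic_iff[OF A] using restricted_imp_strong[OF A] by blast
next
  assume "strong_Phi_elliptic \<phi> a b A"
  from strong_imp_efun_ge_energy[OF A this] show "integral_Phi_elliptic \<phi> a b A"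
    unfolding integral_Phi_elliptic_iff[OF A] using C1_compact_support_vec_tame by blast
qed

end

theorem theorem7:
  fixes \<phi> :: "real \<Rightarrow> real"
    and a b :: ereal
    and A :: "real \<Rightarrow> complex ^ 'm ^ 'm"
  assumes "admissible_phi \<phi>"
    and "a < b"
    and "\<And>i j. (\<lambda>x. A x $ i $ j) \<in> L1_loc a b"
    and "(Lambda_infinity \<phi>)\<^sup>2 < 1"
  shows "(strict_LPhi_dissipative \<phi> a b A \<longleftrightarrow>
            (\<exists>\<kappa>>0. LPhi_dissipative \<phi> a b (\<lambda>x. A x - mat (complex_of_real \<kappa>))))
       \<and> (strict_LPhi_dissipative \<phi> a b A \<longleftrightarrow> strong_Phi_elliptic \<phi> a b A)
       \<and> (strict_LPhi_dissipative \<phi> a b A \<longleftrightarrow> integral_Phi_elliptic \<phi> a b A)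
       \<and> (strict_LPhi_dissipative \<phi> a b A \<longleftrightarrow> weak_Phi_elliptic \<phi> a b A)"
proof -
  interpret admissible \<phi> by standard (rule assms(1))
  \<comment> \<open>Here lam is |\<Lambda>_\<infinity>|: the hypothesis makes it smaller than 1, and
    it bounds |\<Lambda>| everywhere because |\<Lambda>| increases to it.\<close>
  interpret bounded_Lambda \<phi> "\<bar>Lambda_infinity \<phi>\<bar>"
    by standard (use assms(4) Lambda_le_Lambda_infinity in \<open>auto simp: abs_square_less_1\<close>)
  show ?thesis
    using strict_iff_shifted_dissipative[OF assms(3)] strict_iff_strong[OF assms(3)]
      integral_iff_strong[OF assms(3)] weak_Phi_elliptic_iff_strong[of \<phi> a b A] by blast
qed

end
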